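(* Let $G$ be a finite nilpotent group with $\lambda(G)=6$. Then $G \cong P \times C_n$ for some prime $p$ and positive integer $n$, where $P$ is a Sylow $p$-subgroup of $G$ and $p$ does not divide $n$. Moreover, $G$ is isomorphic to one of the following groups: (a) $C_4 \times C_4 \times C_n$, where $n$ is an odd positive integer; (b) $C_5 \times C_5 \times C_n$, where $5$ does not divide $n$; (c) $C_3 \times C_9 \times C_n$, where $3$ does not divide $n$; (d) $R_3 \times C_n$, where $R_3 = \langle a,b \mid a^9=1=b^3,\ a^b=a^4\rangle$ and $3$ does not divide $n$; (e) $C_2 \times C_{16} \times C_n$, where $n$ is an odd positive integer; (f) $T_5 \times C_n$, where $T_5 = \langle a,b \mid a^{16}=1=b^2,\ a^b=a^9\rangle$ and $n$ is an odd positive integer.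
   Context: A covering of a finite group $G$ is a family of subgroups $X_1,\dots,X_n$ ($n\geq 2$) with $\bigcup_{i=1}^n X_i = G$. It is irredundant if $X_i \nsubseteq \bigcup_{j\neq i} X_j$ for every $i$. For a non-cyclic finite group $G$, $\lambda(G)$ denotes the maximum number of subgroups in an irredundant covering of $G$; for cyclic $G$ the convention is $\lambda(G)=1$. $C_n$ is the cyclic group of order $n$, and $a^b = b^{-1}ab$. *)

theory Defs
  imports "HOL-Algebra.Algebra"
begin

section \<open>Irredundant coverings\<close>

definition covering :: "('a, 'b) monoid_scheme \<Rightarrow> nat \<Rightarrow> (nat \<Rightarrow> 'a set) \<Rightarrow> bool"
  where "covering G n H \<longleftrightarrow>
    2 \<le> n \<and> (\<forall>i\<in>{1..n}. subgroup (H i) G) \<and> (\<Union>i\<in>{1..n}. H i) = carrier G"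

definition irredundant_covering :: "('a, 'b) monoid_scheme \<Rightarrow> nat \<Rightarrow> (nat \<Rightarrow> 'a set) \<Rightarrow> bool"
  where "irredundant_covering G n H \<longleftrightarrow>
    covering G n H \<and> (\<forall>i\<in>{1..n}. \<not> H i \<subseteq> (\<Union>j\<in>{1..n} - {i}. H j))"

text \<open>For a finite non-cyclic group the set below is nonempty (the maximal cyclic subgroups form an
  irredundant covering) and finite, so that \<open>Max\<close> is a genuine maximum.\<close>

definition lambda_cov :: "('a, 'b) monoid_scheme \<Rightarrow> nat"
  where "lambda_cov G =
    (if cyclic_group G then 1 else Max {n. \<exists>H. irredundant_covering G n H})"

lemma irredundant_covering_inj_on:
  assumes "irredundant_covering G n H"
  shows "inj_on H {1..n}"
proof (rule inj_onI)
  fix i j assume "i \<in> {1..n}" "j \<in> {1..n}" "H i = H j"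
  then show "i = j"
    using assms unfolding irredundant_covering_def by blast
qed

lemma finite_irredundant_covering:
  assumes "finite (carrier G)"
  shows "finite {n. \<exists>H. irredundant_covering G n H}"
proof (rule finite_subset)
  show "{n. \<exists>H. irredundant_covering G n H} \<subseteq> {..card (Pow (carrier G))}"
  proof
    fix n assume "n \<in> {n. \<exists>H. irredundant_covering G n H}"
    then obtain H where H: "irredundant_covering G n H"
      by blast
    then have "H ` {1..n} \<subseteq> Pow (carrier G)"
      unfolding irredundant_covering_def covering_def by blast
    then have "card {1..n} \<le> card (Pow (carrier G))"
      using card_inj_on_le[OF irredundant_covering_inj_on[OF H]] assms finite_Pow_iff by blast
    then show "n \<in> {..card (Pow (carrier G))}" by simp
  qed
qed simp


section \<open>Nilpotent groups and Sylow subgroups\<close>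

primrec lower_central :: "('a, 'b) monoid_scheme \<Rightarrow> nat \<Rightarrow> 'a set"
  where
    "lower_central G 0 = carrier G"
  | "lower_central G (Suc k) = generate G
      (\<Union>x\<in>lower_central G k. \<Union>y\<in>carrier G. {x \<otimes>\<^bsub>G\<^esub> y \<otimes>\<^bsub>G\<^esub> inv\<^bsub>G\<^esub> x \<otimes>\<^bsub>G\<^esub> inv\<^bsub>G\<^esub> y})"

definition nilpotent :: "('a, 'b) monoid_scheme \<Rightarrow> bool"
  where "nilpotent G \<longleftrightarrow> (\<exists>k. lower_central G k = {\<one>\<^bsub>G\<^esub>})"

definition sylow_subgroup :: "nat \<Rightarrow> 'a set \<Rightarrow> ('a, 'b) monoid_scheme \<Rightarrow> bool"
  where "sylow_subgroup p P G \<longleftrightarrow> subgroup P G \<and> card P = p ^ multiplicity p (order G)"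


section \<open>Groups given by generators and relations\<close>

text \<open>Words are lists of letters \<open>(x, True)\<close>, standing for the generator \<open>x\<close>, and
  \<open>(x, False)\<close>, standing for its formal inverse; every element of the type \<open>'x\<close> is a generator.
  A pair \<open>(u, v)\<close> in \<open>R\<close> is the relation \<open>u = v\<close>, and \<open>pres_eq R\<close> is the least congruence
  on words that contains \<open>R\<close> and makes the two letters of a generator inverse to each other.\<close>

type_synonym 'x word = "('x \<times> bool) list"

inductive pres_eq :: "('x word \<times> 'x word) set \<Rightarrow> 'x word \<Rightarrow> 'x word \<Rightarrow> bool"
  for R where
    pres_rel: "(u, v) \<in> R \<Longrightarrow> pres_eq R u v"
  | pres_cancel: "pres_eq R [(x, s), (x, \<not> s)] []"
  | pres_refl: "pres_eq R u u"
  | pres_sym: "pres_eq R u v \<Longrightarrow> pres_eq R v u"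
  | pres_trans: "pres_eq R u v \<Longrightarrow> pres_eq R v w \<Longrightarrow> pres_eq R u w"
  | pres_append: "pres_eq R u u' \<Longrightarrow> pres_eq R v v' \<Longrightarrow> pres_eq R (u @ v) (u' @ v')"

definition pres_class :: "('x word \<times> 'x word) set \<Rightarrow> 'x word \<Rightarrow> 'x word set"
  where "pres_class R u = {v. pres_eq R u v}"

definition presented_group :: "('x word \<times> 'x word) set \<Rightarrow> 'x word set monoid"
  where "presented_group R =
    \<lparr>carrier = range (pres_class R),
     monoid.mult = (\<lambda>U V. \<Union>u\<in>U. \<Union>v\<in>V. pres_class R (u @ v)),
     one = pres_class R []\<rparr>"

lemma pres_class_eq_iff: "pres_class R u = pres_class R v \<longleftrightarrow> pres_eq R u v"
proof
  assume "pres_class R u = pres_class R v"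
  moreover have "v \<in> pres_class R v"
    by (simp add: pres_class_def pres_refl)
  ultimately have "v \<in> pres_class R u"
    by (simp only:)
  then show "pres_eq R u v"
    by (simp add: pres_class_def)
next
  assume "pres_eq R u v"
  then have "pres_eq R u w \<longleftrightarrow> pres_eq R v w" for w
    by (meson pres_sym pres_trans)
  then show "pres_class R u = pres_class R v"
    by (simp add: pres_class_def)
qed

lemma presented_group_mult:
  "pres_class R u \<otimes>\<^bsub>presented_group R\<^esub> pres_class R v = pres_class R (u @ v)"
proof -
  have "pres_class R (u' @ v') = pres_class R (u @ v)"
    if "u' \<in> pres_class R u" "v' \<in> pres_class R v" for u' v'
    using that unfolding pres_class_eq_iff by (simp add: pres_class_def pres_append pres_sym)
  moreover have "u \<in> pres_class R u" "v \<in> pres_class R v"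
    by (simp_all add: pres_class_def pres_refl)
  ultimately show ?thesis
    unfolding presented_group_def monoid.simps by blast
qed

definition inv_word :: "'x word \<Rightarrow> 'x word"
  where "inv_word u = rev (map (\<lambda>(x, s). (x, \<not> s)) u)"

lemma pres_eq_inv_word: "pres_eq R (inv_word u @ u) []"
proof (induction u)
  case Nil
  show ?case by (simp add: inv_word_def pres_refl)
next
  case (Cons l u)
  obtain x s where l: "l = (x, s)" by fastforce
  have "pres_eq R (inv_word u @ [(x, \<not> s), (x, \<not> \<not> s)] @ u) (inv_word u @ [] @ u)"
    by (intro pres_append pres_refl pres_cancel)
  then have "pres_eq R (inv_word u @ [(x, \<not> s), (x, \<not> \<not> s)] @ u) []"
    using Cons.IH by (simp only: append_Nil) (rule pres_trans)
  then show ?case by (simp add: inv_word_def l)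
qed

lemma group_presented_group: "group (presented_group R)"
proof (rule groupI)
  show "\<one>\<^bsub>presented_group R\<^esub> \<in> carrier (presented_group R)"
    by (simp add: presented_group_def)
next
  fix U V assume "U \<in> carrier (presented_group R)" "V \<in> carrier (presented_group R)"
  then obtain u v where "U = pres_class R u" "V = pres_class R v"
    by (auto simp: presented_group_def)
  then have "U \<otimes>\<^bsub>presented_group R\<^esub> V = pres_class R (u @ v)"
    by (simp add: presented_group_mult)
  then show "U \<otimes>\<^bsub>presented_group R\<^esub> V \<in> carrier (presented_group R)"
    by (simp add: presented_group_def)
next
  fix U V W
  assume "U \<in> carrier (presented_group R)" "V \<in> carrier (presented_group R)"
    "W \<in> carrier (presented_group R)"
  then obtain u v w where "U = pres_class R u" "V = pres_class R v" "W = pres_class R w"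
    by (auto simp: presented_group_def)
  then show "U \<otimes>\<^bsub>presented_group R\<^esub> V \<otimes>\<^bsub>presented_group R\<^esub> W
      = U \<otimes>\<^bsub>presented_group R\<^esub> (V \<otimes>\<^bsub>presented_group R\<^esub> W)"
    by (simp add: presented_group_mult)
next
  fix U assume "U \<in> carrier (presented_group R)"
  then obtain u where U: "U = pres_class R u"
    by (auto simp: presented_group_def)
  have one: "\<one>\<^bsub>presented_group R\<^esub> = pres_class R []"
    by (simp add: presented_group_def)
  show "\<one>\<^bsub>presented_group R\<^esub> \<otimes>\<^bsub>presented_group R\<^esub> U = U"
    by (simp add: U one presented_group_mult)
  show "\<exists>V\<in>carrier (presented_group R). V \<otimes>\<^bsub>presented_group R\<^esub> U = \<one>\<^bsub>presented_group R\<^esub>"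
  proof
    show "pres_class R (inv_word u) \<otimes>\<^bsub>presented_group R\<^esub> U = \<one>\<^bsub>presented_group R\<^esub>"
      by (simp add: U one presented_group_mult pres_class_eq_iff pres_eq_inv_word)
    show "pres_class R (inv_word u) \<in> carrier (presented_group R)"
      by (simp add: presented_group_def)
  qed
qed

datatype two_gens = GenA | GenB

abbreviation a_pow :: "nat \<Rightarrow> two_gens word"
  where "a_pow k \<equiv> replicate k (GenA, True)"

abbreviation b_pow :: "nat \<Rightarrow> two_gens word"
  where "b_pow k \<equiv> replicate k (GenB, True)"

text \<open>The conjugate \<open>a\<^sup>b = b\<^sup>-\<^sup>1 a b\<close>.\<close>

abbreviation a_conj_b :: "two_gens word"
  where "a_conj_b \<equiv> [(GenB, False), (GenA, True), (GenB, True)]"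

definition R3 :: "two_gens word set monoid"
  where "R3 = presented_group {(a_pow 9, []), (b_pow 3, []), (a_conj_b, a_pow 4)}"

definition T5 :: "two_gens word set monoid"
  where "T5 = presented_group {(a_pow 16, []), (b_pow 2, []), (a_conj_b, a_pow 9)}"

end

theory Submission
  imports Defs "HOL-Number_Theory.Cong"
begin

text \<open>The maximal cyclic subgroups form the largest irredundant covering: in any irredundant covering
  choose for each member an element that lies in no other member, and a maximal cyclic subgroup
  containing it. Hence \<open>\<lambda>(G)\<close> is the number of maximal cyclic subgroups. It is multiplicative over
  direct factors of coprime order and at least \<open>3\<close> for noncyclic groups, so exactly one Sylow subgroup
  \<open>P\<close> of a nilpotent \<open>G\<close> with \<open>\<lambda>(G) = 6\<close> is noncyclic.

  The \<open>p\<close>-group \<open>P\<close> has a normal subgroup \<open>N\<close> with elementary abelian quotient of order \<open>p\<^sup>2\<close>. Each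
  \<open>x \<notin> N\<close> generates a maximal cyclic subgroup and lies in exactly one of the \<open>p + 1\<close> maximal subgroups
  above \<open>N\<close>, so \<open>p \<le> 5\<close>. In such a subgroup \<open>M\<close> the orders of the cyclic groups \<open>\<langle>x\<rangle>\<close>,
  \<open>x \<in> M - N\<close>, add up to \<open>|M|\<close>; hence there is one of them and \<open>M\<close> is cyclic, or there are at least
  \<open>p\<close> of them. This leaves few distributions of \<open>6\<close> over the \<open>p + 1\<close> subgroups. Apart from the quaternion
  group, a group with two cyclic \<open>M\<close> is a split extension of a cyclic group by one of order \<open>p\<close>.\<close>

section \<open>Maximal cyclic subgroups\<close>

text \<open>The groups \<open>\<langle>x\<rangle>\<close> with \<open>x \<notin> N\<close> give at
  first only a lower bound for the number of maximal cyclic subgroups, since one of these could lie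
  inside \<open>N\<close>. The analysis needs equality. If some \<open>M\<close> is cyclic, equality
  holds, because \<open>N\<close> then lies in a cyclic group generated outside \<open>N\<close>. If
  no \<open>M\<close> is cyclic, there are at least \<open>p * (p + 1)\<close> such groups; this
  forces \<open>p = 2\<close> with two of them in each \<open>M\<close>, and the bound is attained.
  The surviving distributions are six ones for \<open>p = 5\<close>; 1, 1, 1, 3 for
  \<open>p = 3\<close>; and 1, 1, 4 or 1, 2, 3 or 2, 2, 2 for \<open>p = 2\<close>. The distribution
  1, 2, 3 dies by arithmetic with exponents modulo 8. The hardest one is 2, 2, 2, where no cyclic
  \<open>M\<close> is at hand: there \<open>N\<close> is covered by three subgroups of index 2,
  generated by the squares from the three \<open>M\<close>. For the groups given by relations only
  an upper bound on the order is computed; the lower bound comes from the group under study, onto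
  which the presented group maps.\<close>

definition max_cyclic :: "('a, 'b) monoid_scheme \<Rightarrow> 'a set set"
  where "max_cyclic G = {generate G {x} | x. x \<in> carrier G \<and>
    (\<forall>y\<in>carrier G. x \<in> generate G {y} \<longrightarrow> y \<in> generate G {x})}"

context group
begin

text \<open>Cancelling a factor that already lies in \<open>H\<close>. This and its left-hand twin
  settle most of the later claims that a product avoids a subgroup.\<close>

lemma subgroup_mult_right_iff:
  assumes "subgroup H G" "x \<in> carrier G" "y \<in> H"
  shows "x \<otimes> y \<in> H \<longleftrightarrow> x \<in> H"
proof -
  have "y \<in> carrier G"
    using assms subgroup.subset by blast
  then have "x = x \<otimes> y \<otimes> inv y"
    using assms by (simp add: m_assoc)
  then show ?thesis
    using assms subgroup.m_closed[OF assms(1)] subgroup.m_inv_closed[OF assms(1)] by metis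
qed

lemma subgroup_mult_left_iff:
  assumes "subgroup H G" "x \<in> H" "y \<in> carrier G"
  shows "x \<otimes> y \<in> H \<longleftrightarrow> y \<in> H"
proof -
  have "x \<in> carrier G"
    using assms subgroup.subset by blast
  then have "y = inv x \<otimes> (x \<otimes> y)"
    using assms by (simp flip: m_assoc)
  then show ?thesis
    using assms subgroup.m_closed[OF assms(1)] subgroup.m_inv_closed[OF assms(1)] by metis
qed

lemma generate_singleton_mem: "x \<in> generate G {x}"
  by (simp add: generate.incl)

lemma generate_singleton_subset: "x \<in> carrier G \<Longrightarrow> generate G {x} \<subseteq> carrier G"
  by (simp add: generate_incl)

lemma generate_singleton_le_iff:
  assumes "x \<in> carrier G" "y \<in> carrier G"
  shows "generate G {x} \<subseteq> generate G {y} \<longleftrightarrow> x \<in> generate G {y}"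
  using assms generate_subgroup_incl[of "{x}" "generate G {y}"] generate_is_subgroup[of "{y}"]
    generate_singleton_mem by blast

lemma pow_mem_generate: "x \<in> carrier G \<Longrightarrow> x [^] (k::nat) \<in> generate G {x}"
  using subgroup_int_pow_closed[of "generate G {x}" x "int k"] generate_is_subgroup[of "{x}"]
    generate_singleton_mem by (simp add: int_pow_int)

lemma mem_generate_iff:
  assumes "finite (carrier G)" "x \<in> carrier G"
  shows "y \<in> generate G {x} \<longleftrightarrow> (\<exists>k::nat. y = x [^] k)"
  using generate_pow_on_finite_carrier[OF assms] by auto

lemma cyclic_group_iff_generate:
  "cyclic_group G \<longleftrightarrow> (\<exists>x\<in>carrier G. generate G {x} = carrier G)"
proof -
  have "generate G {x} = range (\<lambda>n::int. x [^] n)" if "x \<in> carrier G" for x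
    using generate_pow[OF that] by auto
  then show ?thesis
    unfolding cyclic_group by metis
qed

lemma max_cyclic_subset: "C \<in> max_cyclic G \<Longrightarrow> C \<subseteq> carrier G"
  unfolding max_cyclic_def using generate_singleton_subset by blast

lemma max_cyclic_subgroup: "C \<in> max_cyclic G \<Longrightarrow> subgroup C G"
  unfolding max_cyclic_def using generate_is_subgroup by blast

lemma finite_max_cyclic: "finite (carrier G) \<Longrightarrow> finite (max_cyclic G)"
  using max_cyclic_subset by (metis PowI finite_Pow_iff rev_finite_subset subsetI)

lemma max_cyclic_antichain:
  assumes "C \<in> max_cyclic G" "D \<in> max_cyclic G" "C \<subseteq> D"
  shows "C = D"
proof -
  obtain x y where x: "x \<in> carrier G" "C = generate G {x}"
      "\<forall>y\<in>carrier G. x \<in> generate G {y} \<longrightarrow> y \<in> generate G {x}"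
    and y: "y \<in> carrier G" "D = generate G {y}"
    using assms unfolding max_cyclic_def by blast
  have "y \<in> C"
    using x y assms(3) generate_singleton_mem by blast
  then show ?thesis
    using x y assms(3) generate_singleton_le_iff by blast
qed

text \<open>Among the elements whose cyclic group contains \<open>x\<close>, one with the largest
  cyclic group works: whatever generates a larger group is again such an element.\<close>

lemma ex_max_cyclic:
  assumes "finite (carrier G)" "x \<in> carrier G"
  shows "\<exists>C\<in>max_cyclic G. x \<in> C"
proof -
  let ?S = "{y \<in> carrier G. x \<in> generate G {y}}"
  have "?S \<noteq> {}" "finite ?S"
    using assms generate_singleton_mem by auto
  then have "Max ((\<lambda>y. card (generate G {y})) ` ?S) \<in> (\<lambda>y. card (generate G {y})) ` ?S"
    by (intro Max_in) auto
  then obtain y where y: "y \<in> ?S" "card (generate G {y}) = Max ((\<lambda>y. card (generate G {y})) ` ?S)"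
    by auto
  have max: "card (generate G {z}) \<le> card (generate G {y})" if "z \<in> ?S" for z
    unfolding y(2) using that \<open>finite ?S\<close> by (intro Max_ge) auto
  have "z \<in> generate G {y}" if z: "z \<in> carrier G" "y \<in> generate G {z}" for z
  proof -
    have sub: "generate G {y} \<subseteq> generate G {z}"
      using that y generate_singleton_le_iff by blast
    then have "z \<in> ?S"
      using y z by blast
    then have "card (generate G {z}) \<le> card (generate G {y})"
      by (rule max)
    then have "generate G {y} = generate G {z}"
      using sub card_seteq assms(1) generate_singleton_subset[OF z(1)] finite_subset by metis
    then show ?thesis
      using generate_singleton_mem by blast
  qed
  then have "generate G {y} \<in> max_cyclic G"
    using y unfolding max_cyclic_def by blast
  then show ?thesis
    using y by blast
qed

text \<open>A generator is a private point of its maximal cyclic subgroup: any member containing it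
  contains the whole subgroup, and members form an antichain. This makes the covering by these
  subgroups irredundant.\<close>

lemma max_cyclic_generator:
  assumes "C \<in> max_cyclic G"
  obtains x where "x \<in> carrier G" "C = generate G {x}" "x \<in> C"
    "\<And>D. D \<in> max_cyclic G \<Longrightarrow> x \<in> D \<Longrightarrow> D = C"
proof -
  obtain x where x: "x \<in> carrier G" "C = generate G {x}"
    using assms unfolding max_cyclic_def by blast
  have "D = C" if D: "D \<in> max_cyclic G" "x \<in> D" for D
  proof -
    have "C \<subseteq> D"
      unfolding x(2) using generate_subgroup_incl[of "{x}" D] D max_cyclic_subgroup by blast
    then show ?thesis
      using max_cyclic_antichain assms D by blast
  qed
  then show thesis
    using that x generate_singleton_mem by blast
qed

lemma max_cyclic_eq_carrier:
  assumes "finite (carrier G)" "cyclic_group G"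
  shows "max_cyclic G = {carrier G}"
proof -
  obtain x where x: "x \<in> carrier G" "generate G {x} = carrier G"
    using assms cyclic_group_iff_generate by blast
  then have m: "carrier G \<in> max_cyclic G"
    unfolding max_cyclic_def by auto
  then show ?thesis
    using max_cyclic_antichain[OF _ m] max_cyclic_subset by blast
qed

text \<open>No group is the union of two proper subgroups: if \<open>x\<close> lies outside the
  first and \<open>y\<close> outside the second, then \<open>x \<otimes> y\<close> lies outside
  both.\<close>

lemma card_max_cyclic_noncyclic:
  assumes "finite (carrier G)" "\<not> cyclic_group G"
  shows "3 \<le> card (max_cyclic G)"
proof (rule ccontr)
  assume "\<not> 3 \<le> card (max_cyclic G)"
  moreover have "max_cyclic G \<noteq> {}"
    using ex_max_cyclic[OF assms(1) one_closed] by blast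
  ultimately have "card (max_cyclic G) = 1 \<or> card (max_cyclic G) = 2"
    using finite_max_cyclic[OF assms(1)] card_0_eq[of "max_cyclic G"] by linarith
  then have "\<exists>C D. max_cyclic G = {C, D}"
    by (metis card_1_singletonE card_2_iff insert_absorb2)
  then obtain C D where CD: "max_cyclic G = {C, D}"
    by blast
  then have sub: "subgroup C G" "subgroup D G"
    using max_cyclic_subgroup by auto
  have cov: "carrier G \<subseteq> C \<union> D"
    using ex_max_cyclic[OF assms(1)] CD by auto
  have proper: "E \<noteq> carrier G" if "E \<in> max_cyclic G" for E
    using that assms(2) cyclic_group_iff_generate unfolding max_cyclic_def by auto
  have "C \<noteq> carrier G" "D \<noteq> carrier G"
    using CD proper by auto
  then obtain x y where xy: "x \<in> carrier G" "x \<notin> C" "y \<in> carrier G" "y \<notin> D"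
    using sub subgroup.subset by blast
  have "x \<in> D" "y \<in> C"
    using xy cov by auto
  have "x \<otimes> y \<notin> C"
    using subgroup_mult_right_iff[OF sub(1) xy(1) \<open>y \<in> C\<close>] xy by blast
  moreover have "x \<otimes> y \<notin> D"
    using subgroup_mult_left_iff[OF sub(2) \<open>x \<in> D\<close> xy(3)] xy by blast
  ultimately show False
    using cov xy by blast
qed

lemma card_max_cyclic_eq_1_iff:
  assumes "finite (carrier G)"
  shows "card (max_cyclic G) = 1 \<longleftrightarrow> cyclic_group G"
  using max_cyclic_eq_carrier[OF assms] card_max_cyclic_noncyclic[OF assms] by (cases "cyclic_group G") auto

lemma irredundant_covering_max_cyclic:
  assumes "finite (carrier G)" "\<not> cyclic_group G"
  shows "\<exists>H. irredundant_covering G (card (max_cyclic G)) H"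
proof -
  let ?n = "card (max_cyclic G)"
  obtain H where H: "bij_betw H {1..?n} (max_cyclic G)"
    using ex_bij_betw_nat_finite_1[OF finite_max_cyclic[OF assms(1)]] by blast
  have mem: "H i \<in> max_cyclic G" if "i \<in> {1..?n}" for i
    using that H bij_betwE by blast
  have "covering G ?n H"
    unfolding covering_def
  proof (intro conjI ballI)
    show "2 \<le> ?n"
      using card_max_cyclic_noncyclic[OF assms] by simp
    show "subgroup (H i) G" if "i \<in> {1..?n}" for i
      using mem[OF that] max_cyclic_subgroup by blast
    have "(\<Union>i\<in>{1..?n}. H i) = \<Union>(max_cyclic G)"
      using H by (simp add: bij_betw_def)
    also have "\<dots> = carrier G"
      using ex_max_cyclic[OF assms(1)] max_cyclic_subset by blast
    finally show "(\<Union>i\<in>{1..?n}. H i) = carrier G" .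
  qed
  moreover have "\<not> H i \<subseteq> (\<Union>j\<in>{1..?n} - {i}. H j)" if i: "i \<in> {1..?n}" for i
  proof
    assume *: "H i \<subseteq> (\<Union>j\<in>{1..?n} - {i}. H j)"
    obtain x where x: "x \<in> H i" "\<And>D. D \<in> max_cyclic G \<Longrightarrow> x \<in> D \<Longrightarrow> D = H i"
      using max_cyclic_generator[OF mem[OF i]] by metis
    then obtain j where "j \<in> {1..?n}" "j \<noteq> i" "x \<in> H j"
      using * by blast
    then show False
      using x mem H i unfolding bij_betw_def inj_on_def by metis
  qed
  ultimately show ?thesis
    unfolding irredundant_covering_def by blast
qed

lemma irredundant_covering_le_max_cyclic:
  assumes "finite (carrier G)" "irredundant_covering G n H"
  shows "n \<le> card (max_cyclic G)"
proof -
  have sub: "subgroup (H i) G" if "i \<in> {1..n}" for i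
    using assms that unfolding irredundant_covering_def covering_def by blast
  have "\<exists>C\<in>max_cyclic G. C \<subseteq> H i \<and> \<not> C \<subseteq> (\<Union>j\<in>{1..n} - {i}. H j)" if i: "i \<in> {1..n}" for i
  proof -
    obtain x where x: "x \<in> H i" "x \<notin> (\<Union>j\<in>{1..n} - {i}. H j)"
      using assms i unfolding irredundant_covering_def by blast
    then have "x \<in> carrier G"
      using sub[OF i] subgroup.subset by blast
    then obtain C where C: "C \<in> max_cyclic G" "x \<in> C"
      using ex_max_cyclic assms by blast
    obtain c where c: "c \<in> carrier G" "C = generate G {c}"
      using max_cyclic_generator[OF C(1)] by blast
    \<comment> \<open>Some member contains the generator \<open>c\<close>, hence all of
      \<open>C\<close>, hence \<open>x\<close>. As \<open>x\<close> is private to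
      \<open>H i\<close>, that member is \<open>H i\<close>.\<close>
    obtain j where j: "j \<in> {1..n}" "c \<in> H j"
      using c assms(2) unfolding irredundant_covering_def covering_def by blast
    have "C \<subseteq> H j"
      using generate_subgroup_incl[of "{c}" "H j"] c j sub by blast
    then have "j = i"
      using x C j by blast
    then show ?thesis
      using C x \<open>C \<subseteq> H j\<close> by blast
  qed
  then obtain f where f: "\<And>i. i \<in> {1..n} \<Longrightarrow> f i \<in> max_cyclic G \<and> f i \<subseteq> H i \<and>
      \<not> f i \<subseteq> (\<Union>j\<in>{1..n} - {i}. H j)"
    by metis
  have "inj_on f {1..n}"
  proof (rule inj_onI, rule ccontr)
    fix i j assume "i \<in> {1..n}" "j \<in> {1..n}" "f i = f j" "i \<noteq> j"
    then show False
      using f[of i] f[of j] by blast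
  qed
  then have "card {1..n} \<le> card (max_cyclic G)"
    using f finite_max_cyclic[OF assms(1)] by (intro card_inj_on_le[of f]) auto
  then show ?thesis
    by simp
qed

lemma lambda_cov_eq_card_max_cyclic:
  assumes "finite (carrier G)"
  shows "lambda_cov G = card (max_cyclic G)"
proof (cases "cyclic_group G")
  case True
  then show ?thesis
    using card_max_cyclic_eq_1_iff[OF assms] by (simp add: lambda_cov_def)
next
  case False
  have "Max {n. \<exists>H. irredundant_covering G n H} = card (max_cyclic G)"
    using finite_irredundant_covering[OF assms] irredundant_covering_max_cyclic[OF assms False]
      irredundant_covering_le_max_cyclic[OF assms]
    by (intro Max_eqI) auto
  then show ?thesis
    using False by (simp add: lambda_cov_def)
qed

end

section \<open>Invariance of the count under isomorphism\<close>

lemma card_max_cyclic_iso_le: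
  assumes "G \<cong> H" "group G" "group H" "finite (carrier H)"
  shows "card (max_cyclic G) \<le> card (max_cyclic H)"
proof -
  obtain f where f: "f \<in> iso G H"
    using assms unfolding is_iso_def by blast
  then have hom: "group_hom G H f" and inj: "inj_on f (carrier G)"
      and img: "f ` carrier G = carrier H"
    using assms by (auto simp: iso_iff group_hom_def group_hom_axioms_def)
  have gen: "f ` generate G {x} = generate H {f x}" if "x \<in> carrier G" for x
    using group_hom.generate_img[OF hom, of "{x}"] that by simp
  have mem: "f x \<in> generate H {f y} \<longleftrightarrow> x \<in> generate G {y}"
    if "x \<in> carrier G" "y \<in> carrier G" for x y
    using that gen inj group.generate_singleton_subset[OF assms(2)] by (metis inj_on_image_mem_iff)
  have "f ` C \<in> max_cyclic H" if C: "C \<in> max_cyclic G" for C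
  proof -
    obtain x where x: "x \<in> carrier G" "C = generate G {x}"
      "\<forall>y\<in>carrier G. x \<in> generate G {y} \<longrightarrow> y \<in> generate G {x}"
      using C unfolding max_cyclic_def by blast
    then have "\<forall>y\<in>carrier G. f x \<in> generate H {f y} \<longrightarrow> f y \<in> generate H {f x}"
      using mem by simp
    then have "\<forall>y\<in>carrier H. f x \<in> generate H {y} \<longrightarrow> y \<in> generate H {f x}"
      unfolding img[symmetric] by blast
    then show ?thesis
      unfolding max_cyclic_def x(2) gen[OF x(1)] using x(1) img by blast
  qed
  moreover have "inj_on ((`) f) (max_cyclic G)"
    using inj group.max_cyclic_subset[OF assms(2)] by (metis inj_on_image_eq_iff inj_onI)
  ultimately show ?thesis
    using group.finite_max_cyclic[OF assms(3,4)] card_inj_on_le[of "(`) f"] by blast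
qed

lemma card_max_cyclic_iso:
  assumes "G \<cong> H" "group G" "group H" "finite (carrier G)"
  shows "card (max_cyclic G) = card (max_cyclic H)"
  using card_max_cyclic_iso_le[OF assms(1-3)] assms iso_finite[OF assms(1)]
    card_max_cyclic_iso_le[OF group.iso_sym[OF assms(2,1)] assms(3,2,4)] by simp

section \<open>Direct products of groups of coprime order\<close>

lemma nat_pow_DirProd:
  assumes "group G" "group H" "x \<in> carrier G" "y \<in> carrier H"
  shows "(x, y) [^]\<^bsub>G \<times>\<times> H\<^esub> (k::nat) = (x [^]\<^bsub>G\<^esub> k, y [^]\<^bsub>H\<^esub> k)"
  by (induction k) (simp_all add: DirProd_def)

text \<open>The Chinese remainder theorem: the orders of \<open>x\<close> and \<open>y\<close> are
  coprime, so a single exponent realizes any prescribed pair of exponents in the two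
  coordinates.\<close>

lemma generate_DirProd_coprime:
  assumes "group G" "group H" "finite (carrier G)" "finite (carrier H)"
    and "coprime (order G) (order H)" and "x \<in> carrier G" "y \<in> carrier H"
  shows "generate (G \<times>\<times> H) {(x, y)} = generate G {x} \<times> generate H {y}"
proof -
  interpret G: group G by fact
  interpret H: group H by fact
  interpret GH: group "G \<times>\<times> H" by (rule DirProd_group) fact+
  have fin: "finite (carrier (G \<times>\<times> H))"
    using assms by (simp add: DirProd_def)
  have xy: "(x, y) \<in> carrier (G \<times>\<times> H)"
    using assms by (simp add: DirProd_def)
  have cop: "coprime (G.ord x) (H.ord y)"
    using assms G.ord_dvd_group_order H.ord_dvd_group_order coprime_divisors by blast
  note pow = nat_pow_DirProd[OF assms(1,2,6,7)]
  have "(u, v) \<in> generate (G \<times>\<times> H) {(x, y)} \<longleftrightarrow> u \<in> generate G {x} \<and> v \<in> generate H {y}" for u v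
  proof
    assume "u \<in> generate G {x} \<and> v \<in> generate H {y}"
    then obtain i j :: nat where ij: "u = x [^]\<^bsub>G\<^esub> i" "v = y [^]\<^bsub>H\<^esub> j"
      using assms G.mem_generate_iff H.mem_generate_iff by meson
    obtain k where k: "[k = i] (mod G.ord x)" "[k = j] (mod H.ord y)"
      using binary_chinese_remainder_nat[OF cop] by blast
    have "x [^]\<^bsub>G\<^esub> k = u" "y [^]\<^bsub>H\<^esub> k = v"
      using k assms ij G.int_pow_eq[of x "int k" "int i"] H.int_pow_eq[of y "int k" "int j"]
      by (metis int_pow_int cong_iff_dvd_diff cong_int_iff cong_sym)
        (metis k assms ij H.int_pow_eq int_pow_int cong_iff_dvd_diff cong_int_iff cong_sym)
    then show "(u, v) \<in> generate (G \<times>\<times> H) {(x, y)}"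
      using GH.mem_generate_iff[OF fin xy] pow by metis
  qed (use GH.mem_generate_iff[OF fin xy] pow assms G.mem_generate_iff H.mem_generate_iff in auto)
  then show ?thesis
    by auto
qed

lemma max_cyclic_DirProd_coprime:
  assumes "group G" "group H" "finite (carrier G)" "finite (carrier H)"
    and "coprime (order G) (order H)"
  shows "max_cyclic (G \<times>\<times> H) = (\<lambda>(A, B). A \<times> B) ` (max_cyclic G \<times> max_cyclic H)"
proof -
  interpret G: group G by fact
  interpret H: group H by fact
  note gen = generate_DirProd_coprime[OF assms]
  have eq: "(\<forall>z\<in>carrier (G \<times>\<times> H). (x, y) \<in> generate (G \<times>\<times> H) {z} \<longrightarrow> z \<in> generate (G \<times>\<times> H) {(x, y)})
    \<longleftrightarrow> (\<forall>u\<in>carrier G. x \<in> generate G {u} \<longrightarrow> u \<in> generate G {x}) \<and>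
        (\<forall>v\<in>carrier H. y \<in> generate H {v} \<longrightarrow> v \<in> generate H {y})" (is "?L \<longleftrightarrow> ?R")
    if "x \<in> carrier G" "y \<in> carrier H" for x y
  proof
    assume L: ?L
    then have *: "x \<in> generate G {u} \<Longrightarrow> y \<in> generate H {v} \<Longrightarrow> u \<in> generate G {x} \<and> v \<in> generate H {y}"
      if "u \<in> carrier G" "v \<in> carrier H" for u v
      using that \<open>x \<in> carrier G\<close> \<open>y \<in> carrier H\<close> gen by (auto simp: DirProd_def)
    \<comment> \<open>One coordinate at a time: with \<open>v = y\<close> or \<open>u = x\<close>
      the premise on the other side becomes trivial.\<close>
    then show ?R
      using that G.generate_singleton_mem H.generate_singleton_mem by blast
  qed (use that gen in \<open>auto simp: DirProd_def\<close>)
  show ?thesis (is "?A = ?B")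
  proof (intro equalityI subsetI)
    fix C assume "C \<in> ?A"
    then obtain x y where xy: "x \<in> carrier G" "y \<in> carrier H" "C = generate (G \<times>\<times> H) {(x, y)}"
      "\<forall>z\<in>carrier (G \<times>\<times> H). (x, y) \<in> generate (G \<times>\<times> H) {z} \<longrightarrow> z \<in> generate (G \<times>\<times> H) {(x, y)}"
      unfolding max_cyclic_def by (auto simp: DirProd_def)
    then have "generate G {x} \<in> max_cyclic G" "generate H {y} \<in> max_cyclic H"
      using eq unfolding max_cyclic_def by blast+
    then show "C \<in> ?B"
      using xy gen by auto
  next
    fix C assume "C \<in> ?B"
    then obtain x y where xy: "x \<in> carrier G" "y \<in> carrier H"
      "C = generate G {x} \<times> generate H {y}"
      "\<forall>u\<in>carrier G. x \<in> generate G {u} \<longrightarrow> u \<in> generate G {x}"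
      "\<forall>v\<in>carrier H. y \<in> generate H {v} \<longrightarrow> v \<in> generate H {y}"
      unfolding max_cyclic_def by auto
    then have "C = generate (G \<times>\<times> H) {(x, y)}" "(x, y) \<in> carrier (G \<times>\<times> H)"
      using gen by (auto simp: DirProd_def)
    then show "C \<in> ?A"
      using xy eq[OF xy(1,2)] unfolding max_cyclic_def by blast
  qed
qed

lemma card_max_cyclic_DirProd_coprime:
  assumes "group G" "group H" "finite (carrier G)" "finite (carrier H)"
    and "coprime (order G) (order H)"
  shows "card (max_cyclic (G \<times>\<times> H)) = card (max_cyclic G) * card (max_cyclic H)"
proof -
  \<comment> \<open>A product of sets determines its factors only when these are nonempty.\<close>
  have "A \<noteq> {}" if "A \<in> max_cyclic G" for A
    using that by (auto simp: max_cyclic_def intro: generate.one)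
  moreover have "B \<noteq> {}" if "B \<in> max_cyclic H" for B
    using that by (auto simp: max_cyclic_def intro: generate.one)
  ultimately have "inj_on (\<lambda>(A, B). A \<times> B) (max_cyclic G \<times> max_cyclic H)"
    by (auto simp: inj_on_def times_eq_iff)
  then show ?thesis
    by (simp add: max_cyclic_DirProd_coprime[OF assms] card_image card_cartesian_product)
qed

lemma (in group) cyclic_iso_integer_mod_group:
  assumes "finite (carrier G)" "cyclic_group G"
  shows "G \<cong> integer_mod_group (order G)"
proof -
  obtain x where x: "x \<in> carrier G" "generate G {x} = carrier G"
    using assms(2) cyclic_group_iff_generate by blast
  define n where "n = order G"
  \<comment> \<open>Positivity matters: \<open>integer_mod_group 0\<close> is the group of all
    integers, and only for \<open>0 < n\<close> is the carrier \<open>{0..<int n}\<close>.\<close>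
  have n: "0 < n" "ord x = n"
    using assms(1) x generate_pow_card[OF x(1)] unfolding n_def order_def
    by (auto simp: card_gt_0_iff)
  have "(\<lambda>i::int. x [^] i) \<in> iso (integer_mod_group n) G"
    unfolding iso_def
  proof (intro CollectI conjI)
    have "x [^] ((i + j) mod int n) = x [^] i \<otimes> x [^] j" for i j :: int
    proof -
      have "x [^] ((i + j) mod int n) = x [^] (i + j)"
        using x n by (simp add: int_pow_eq minus_mod_eq_mult_div)
      then show ?thesis
        by (simp add: int_pow_mult x)
    qed
    then show "(\<lambda>i::int. x [^] i) \<in> hom (integer_mod_group n) G"
      by (auto simp: hom_def x)
    have "inj_on (\<lambda>i::int. x [^] i) {0..<int n}"
    proof (rule inj_onI)
      fix i j assume ij: "i \<in> {0..<int n}" "j \<in> {0..<int n}" "x [^] i = x [^] j"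
      then have "int n dvd j - i"
        using int_pow_eq[OF x(1)] n by simp
      then have "j mod int n = i mod int n"
        by (simp add: mod_eq_dvd_iff)
      then show "i = j"
        using ij by simp
    qed
    moreover have "(\<lambda>i::int. x [^] i) ` {0..<int n} = carrier G"
    proof (intro equalityI subsetI)
      fix y assume "y \<in> carrier G"
      then obtain i :: int where "y = x [^] i"
        using x generate_pow[OF x(1)] by auto
      then have "y = x [^] (i mod int n)"
        using x n by (simp add: int_pow_eq mod_eq_dvd_iff[symmetric])
      then show "y \<in> (\<lambda>i::int. x [^] i) ` {0..<int n}"
        using n by (intro image_eqI[of _ _ "i mod int n"]) auto
    qed (use x in auto)
    ultimately show "bij_betw (\<lambda>i::int. x [^] i) (carrier (integer_mod_group n)) (carrier G)"
      using n by (simp add: bij_betw_def carrier_integer_mod_group)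
  qed
  then have "integer_mod_group n \<cong> G"
    by (rule is_isoI)
  then show ?thesis
    unfolding n_def by (rule group.iso_sym[OF group_integer_mod_group])
qed

section \<open>Nilpotent groups\<close>

lemma (in normal) r_coset_eq_one_iff:
  assumes "a \<in> carrier G"
  shows "H #> a = \<one>\<^bsub>G Mod H\<^esub> \<longleftrightarrow> a \<in> H"
  using assms coset_join1 coset_join2 subgroup_axioms subset unfolding FactGroup_def
  by (metis monoid.simps(2))

lemma (in normal) group_hom_r_coset: "group_hom G (G Mod H) ((#>) H)"
  using r_coset_hom_Mod factorgroup_is_group by (simp add: group_hom_def group_hom_axioms_def)

context group
begin

text \<open>The generators of each term are permuted by conjugation: conjugating a commutator
  conjugates both entries, and the first entry stays in the previous term, which is normal by
  induction.\<close>

lemma lower_central_normal: "lower_central G k \<lhd> G"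
proof (induction k)
  case 0
  show ?case
    by (simp add: normal_self)
next
  case (Suc k)
  then interpret L: normal "lower_central G k" G .
  have sub: "lower_central G k \<subseteq> carrier G"
    using L.subset .
  show ?case
    unfolding lower_central.simps
  proof (rule normal_generateI)
    show "(\<Union>x\<in>lower_central G k. \<Union>y\<in>carrier G. {x \<otimes> y \<otimes> inv x \<otimes> inv y}) \<subseteq> carrier G"
      using sub by auto
    fix h g
    assume h: "h \<in> (\<Union>x\<in>lower_central G k. \<Union>y\<in>carrier G. {x \<otimes> y \<otimes> inv x \<otimes> inv y})"
      and g: "g \<in> carrier G"
    then obtain x y where xy: "x \<in> lower_central G k" "y \<in> carrier G"
      "h = x \<otimes> y \<otimes> inv x \<otimes> inv y"
      by blast
    have x: "x \<in> carrier G"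
      using xy sub by blast
    have cancel: "inv g \<otimes> (g \<otimes> w) = w" if "w \<in> carrier G" for w
      using that g by (simp flip: m_assoc)
    have "g \<otimes> h \<otimes> inv g = (g \<otimes> x \<otimes> inv g) \<otimes> (g \<otimes> y \<otimes> inv g) \<otimes> inv (g \<otimes> x \<otimes> inv g) \<otimes> inv (g \<otimes> y \<otimes> inv g)"
      using x xy(2) g by (simp add: xy(3) inv_mult_group m_assoc cancel)
    moreover have "g \<otimes> x \<otimes> inv g \<in> lower_central G k"
      using L.inv_op_closed2 g xy(1) by blast
    moreover have "g \<otimes> y \<otimes> inv g \<in> carrier G"
      using g xy(2) by simp
    ultimately show "g \<otimes> h \<otimes> inv g \<in> (\<Union>x\<in>lower_central G k. \<Union>y\<in>carrier G. {x \<otimes> y \<otimes> inv x \<otimes> inv y})"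
      by (intro UN_I[of "g \<otimes> x \<otimes> inv g"] UN_I[of "g \<otimes> y \<otimes> inv g"]) simp_all
  qed
qed

lemma commutator_lower_central:
  assumes "x \<in> lower_central G k" "y \<in> carrier G"
  shows "x \<otimes> y \<otimes> inv x \<otimes> inv y \<in> lower_central G (Suc k)"
  unfolding lower_central.simps using assms by (intro generate.incl) blast

lemma conjugate_nat_pow:
  assumes "x \<in> carrier G" "y \<in> carrier G"
  shows "(x \<otimes> y \<otimes> inv x) [^] (k::nat) = x \<otimes> y [^] k \<otimes> inv x"
proof (induction k)
  case (Suc k)
  have "inv x \<otimes> (x \<otimes> w) = w" if "w \<in> carrier G" for w
    using that assms by (simp flip: m_assoc)
  then have "x \<otimes> y [^] k \<otimes> inv x \<otimes> (x \<otimes> y \<otimes> inv x) = x \<otimes> y [^] Suc k \<otimes> inv x"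
    using assms by (simp add: m_assoc)
  then show ?case
    by (simp only: nat_pow_Suc Suc)
qed (use assms in auto)

text \<open>Let \<open>c\<close> be the commutator. Since \<open>x\<close> conjugates
  \<open>y\<close> to \<open>c \<otimes> y\<close> and \<open>c\<close> commutes with
  \<open>y\<close>, comparing \<open>k\<close>-th powers gives \<open>c [^] k = \<one>\<close>.
  Symmetrically \<open>c [^] m = \<one>\<close>, and coprimality leaves only the identity.\<close>

lemma commute_if_commutator_central:
  assumes x: "x \<in> carrier G" and y: "y \<in> carrier G"
    and cx: "(x \<otimes> y \<otimes> inv x \<otimes> inv y) \<otimes> x = x \<otimes> (x \<otimes> y \<otimes> inv x \<otimes> inv y)"
    and cy: "(x \<otimes> y \<otimes> inv x \<otimes> inv y) \<otimes> y = y \<otimes> (x \<otimes> y \<otimes> inv x \<otimes> inv y)"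
    and "x [^] (m::nat) = \<one>" "y [^] (k::nat) = \<one>" "coprime m k"
  shows "x \<otimes> y \<otimes> inv x \<otimes> inv y = \<one>"
proof -
  define c where "c = x \<otimes> y \<otimes> inv x \<otimes> inv y"
  have c: "c \<in> carrier G"
    using x y by (simp add: c_def)
  have 1: "x \<otimes> y \<otimes> inv x = c \<otimes> y"
    using x y by (simp add: c_def m_assoc)
  have "(c \<otimes> y) [^] k = \<one>"
    using conjugate_nat_pow[OF x y, of k] x assms unfolding 1 by simp
  then have ck: "c [^] k = \<one>"
    using pow_mult_distrib[of c y k] cy c y assms unfolding c_def by simp
  have yx: "y \<otimes> x \<otimes> inv y = inv c \<otimes> x"
    using x y by (simp add: c_def inv_mult_group m_assoc)
  have icx: "inv c \<otimes> x = x \<otimes> inv c"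
    using cx c x unfolding c_def[symmetric] by (metis inv_closed inv_solve_left inv_solve_right m_assoc m_closed)
  have "(inv c \<otimes> x) [^] m = \<one>"
    using conjugate_nat_pow[OF y x, of m] y assms unfolding yx by simp
  then have "inv c [^] m = \<one>"
    using pow_mult_distrib[OF icx] c x assms by simp
  then have "ord c dvd m"
    using c pow_eq_id[of "inv c"] by simp
  moreover have "ord c dvd k"
    using ck c pow_eq_id by blast
  ultimately have "ord c = 1"
    using assms(7) by (meson coprime_common_divisor_nat)
  then show ?thesis
    using ord_eq_1 c unfolding c_def by blast
qed

text \<open>The commutator slides down the lower central series: once in some term, it is central
  modulo the next, so \<open>commute_if_commutator_central\<close> in the quotient puts it into the
  next term. The series ends at the identity.\<close>

lemma nilpotent_coprime_commute:
  assumes "nilpotent G" and x: "x \<in> carrier G" and y: "y \<in> carrier G" and "coprime (ord x) (ord y)"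
  shows "x \<otimes> y = y \<otimes> x"
proof -
  define c where "c = x \<otimes> y \<otimes> inv x \<otimes> inv y"
  have c: "c \<in> carrier G"
    using x y by (simp add: c_def)
  have "c \<in> lower_central G k" for k
  proof (induction k)
    case 0
    then show ?case
      using c by simp
  next
    case (Suc k)
    define D where "D = lower_central G (Suc k)"
    interpret D: normal D G
      unfolding D_def by (rule lower_central_normal)
    interpret Q: group "G Mod D"
      by (rule D.factorgroup_is_group)
    define q where "q = (\<lambda>a. D #> a)"
    interpret q: group_hom G "G Mod D" q
      unfolding q_def by (rule D.group_hom_r_coset)
    have q_eq_one: "q a = \<one>\<^bsub>G Mod D\<^esub> \<longleftrightarrow> a \<in> D" if "a \<in> carrier G" for a
      unfolding q_def by (rule D.r_coset_eq_one_iff[OF that])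
    have central: "q c \<otimes>\<^bsub>G Mod D\<^esub> q g = q g \<otimes>\<^bsub>G Mod D\<^esub> q c" if g: "g \<in> carrier G" for g
    proof -
      have "c \<otimes> g \<otimes> inv c \<otimes> inv g \<in> D"
        unfolding D_def using commutator_lower_central Suc g by blast
      then have "q (c \<otimes> g \<otimes> inv c \<otimes> inv g) = \<one>\<^bsub>G Mod D\<^esub>"
        by (subst q_eq_one) (use c g in auto)
      moreover have "c \<otimes> g = (c \<otimes> g \<otimes> inv c \<otimes> inv g) \<otimes> (g \<otimes> c)"
      proof -
        have "inv g \<otimes> (g \<otimes> c) = c"
          using c g by (simp flip: m_assoc)
        then show ?thesis
          using c g by (simp add: m_assoc)
      qed
      ultimately have "q (c \<otimes> g) = q (g \<otimes> c)"
        using c g by (metis Q.l_one inv_closed m_closed q.hom_closed q.hom_mult)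
      then show ?thesis
        using c g by simp
    qed
    have qc: "q c = q x \<otimes>\<^bsub>G Mod D\<^esub> q y \<otimes>\<^bsub>G Mod D\<^esub> inv\<^bsub>G Mod D\<^esub> q x \<otimes>\<^bsub>G Mod D\<^esub> inv\<^bsub>G Mod D\<^esub> q y"
      using x y by (simp add: c_def)
    have "q x [^]\<^bsub>G Mod D\<^esub> ord x = \<one>\<^bsub>G Mod D\<^esub>" "q y [^]\<^bsub>G Mod D\<^esub> ord y = \<one>\<^bsub>G Mod D\<^esub>"
      using x y by (simp_all flip: q.hom_nat_pow)
    then have "q c = \<one>\<^bsub>G Mod D\<^esub>"
      using Q.commute_if_commutator_central[of "q x" "q y" "ord x" "ord y"] x y assms(4)
        central[OF x] central[OF y] unfolding qc by simp
    then show ?case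
      using q_eq_one[OF c] unfolding D_def by blast
  qed
  then have "c = \<one>"
    using assms(1) unfolding nilpotent_def by blast
  then show ?thesis
    using x y unfolding c_def by (metis inv_closed inv_solve_right' l_one m_assoc m_closed)
qed

section \<open>Subgroups of coprime orders and the Sylow decomposition\<close>

lemma subgroup_ord_dvd_card:
  assumes "subgroup H G" "x \<in> H"
  shows "ord x dvd card H"
proof -
  interpret H: group "G\<lparr>carrier := H\<rparr>"
    using assms(1) by (rule subgroup_imp_group)
  have "x \<in> carrier G"
    using assms subgroup.subset by blast
  moreover have "x [^] card H = \<one>"
    using H.pow_order_eq_1[of x] assms nat_pow_consistent[of x "card H" H] by (simp add: order_def)
  ultimately show ?thesis
    using pow_eq_id by blast
qed

lemma coprime_card_Int:
  assumes "subgroup A G" "subgroup B G" "coprime (card A) (card B)"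
  shows "A \<inter> B = {\<one>}"
proof -
  have "x = \<one>" if "x \<in> A" "x \<in> B" for x
  proof -
    have "ord x = 1"
      using subgroup_ord_dvd_card assms that by (meson coprime_common_divisor_nat)
    then show ?thesis
      using ord_eq_1 that assms subgroup.subset by blast
  qed
  then show ?thesis
    using assms subgroup.one_closed by blast
qed

text \<open>The internal direct product. It serves twice: to split off a Sylow subgroup, and to
  identify the abelian groups of the final list.\<close>

lemma commuting_set_mult:
  assumes A: "subgroup A G" and B: "subgroup B G" and "A \<inter> B = {\<one>}"
    and comm: "\<And>x y. x \<in> A \<Longrightarrow> y \<in> B \<Longrightarrow> x \<otimes> y = y \<otimes> x"
  shows "subgroup (A <#> B) G" "card (A <#> B) = card A * card B"
    "(\<lambda>(x, y). x \<otimes> y) \<in> iso (G\<lparr>carrier := A\<rparr> \<times>\<times> G\<lparr>carrier := B\<rparr>) (G\<lparr>carrier := A <#> B\<rparr>)"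
proof -
  interpret D: group_disjoint_sum G A B
    using A B by (simp add: group_disjoint_sum_def)
  have sub: "A \<subseteq> carrier G" "B \<subseteq> carrier G"
    using A B subgroup.subset by auto
  show S: "subgroup (A <#> B) G"
  proof (rule subgroupI)
    show "A <#> B \<subseteq> carrier G"
      using sub setmult_subset_G by blast
    show "A <#> B \<noteq> {}"
      using A B subgroup.one_closed unfolding set_mult_def by blast
  next
    fix a assume "a \<in> A <#> B"
    then obtain x y where xy: "x \<in> A" "y \<in> B" "a = x \<otimes> y"
      unfolding set_mult_def by blast
    then have "inv a = inv x \<otimes> inv y"
      using sub comm by (metis inv_mult_group subsetD)
    then show "inv a \<in> A <#> B"
      using xy A B subgroup.m_inv_closed unfolding set_mult_def by blast
  next
    fix a b assume "a \<in> A <#> B" "b \<in> A <#> B"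
    then obtain x y u v where xy: "x \<in> A" "y \<in> B" "a = x \<otimes> y" "u \<in> A" "v \<in> B" "b = u \<otimes> v"
      unfolding set_mult_def by blast
    then have c: "x \<in> carrier G" "y \<in> carrier G" "u \<in> carrier G" "v \<in> carrier G"
      using sub by auto
    have "a \<otimes> b = x \<otimes> (y \<otimes> u) \<otimes> v"
      using xy c by (simp add: m_assoc)
    also have "\<dots> = x \<otimes> (u \<otimes> y) \<otimes> v"
      using comm[OF xy(4,2)] by simp
    also have "\<dots> = (x \<otimes> u) \<otimes> (y \<otimes> v)"
      using c by (simp add: m_assoc)
    finally show "a \<otimes> b \<in> A <#> B"
      using xy A B subgroup.m_closed unfolding set_mult_def by blast
  qed
  have inj: "inj_on (\<lambda>(x, y). x \<otimes> y) (A \<times> B)"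
    using D.cancel assms(3) by (auto simp: inj_on_def)
  have img: "(\<lambda>(x, y). x \<otimes> y) ` (A \<times> B) = A <#> B"
    unfolding set_mult_def by auto
  show "card (A <#> B) = card A * card B"
    using card_image[OF inj] img by (simp add: card_cartesian_product)
  have "(x \<otimes> u) \<otimes> (y \<otimes> v) = (x \<otimes> y) \<otimes> (u \<otimes> v)" if "x \<in> A" "u \<in> A" "y \<in> B" "v \<in> B" for x u y v
  proof -
    have c: "x \<in> carrier G" "y \<in> carrier G" "u \<in> carrier G" "v \<in> carrier G"
      using sub that by auto
    have "(x \<otimes> u) \<otimes> (y \<otimes> v) = x \<otimes> (u \<otimes> y) \<otimes> v"
      using c by (simp add: m_assoc)
    also have "\<dots> = x \<otimes> (y \<otimes> u) \<otimes> v"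
      using comm that by simp
    finally show ?thesis
      using c by (simp add: m_assoc)
  qed
  then show "(\<lambda>(x, y). x \<otimes> y) \<in> iso (G\<lparr>carrier := A\<rparr> \<times>\<times> G\<lparr>carrier := B\<rparr>) (G\<lparr>carrier := A <#> B\<rparr>)"
    using inj img unfolding iso_def hom_def bij_betw_def
    by (auto simp: DirProd_def)
qed

lemma ord_mult_coprime:
  assumes x: "x \<in> carrier G" and y: "y \<in> carrier G" and "x \<otimes> y = y \<otimes> x"
    and cop: "coprime (ord x) (ord y)"
  shows "ord (x \<otimes> y) = ord x * ord y"
proof (rule dvd_antisym)
  show "ord (x \<otimes> y) dvd ord x * ord y"
    using assms by (intro ord_mul_divides)
  have *: "ord u dvd ord (u \<otimes> v)"
    if "u \<in> carrier G" "v \<in> carrier G" "u \<otimes> v = v \<otimes> u" "coprime (ord u) (ord v)" for u v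
  proof -
    \<comment> \<open>An exponent divisible by \<open>ord v\<close> removes \<open>v\<close>, so
      \<open>ord u\<close> divides \<open>ord (u \<otimes> v) * ord v\<close>; coprimality strips
      the second factor.\<close>
    have "\<one> = (u \<otimes> v) [^] (ord (u \<otimes> v) * ord v)"
      using pow_eq_id[OF m_closed[OF that(1,2)], of "ord (u \<otimes> v) * ord v"] by simp
    also have "\<dots> = u [^] (ord (u \<otimes> v) * ord v) \<otimes> v [^] (ord (u \<otimes> v) * ord v)"
      using that by (intro pow_mult_distrib)
    also have "v [^] (ord (u \<otimes> v) * ord v) = \<one>"
      using that by (simp add: pow_eq_id)
    finally have "u [^] (ord (u \<otimes> v) * ord v) = \<one>"
      using that(1) by simp
    then have "ord u dvd ord (u \<otimes> v) * ord v"
      using pow_eq_id[OF that(1)] by blast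
    then show ?thesis
      using that coprime_dvd_mult_left_iff by blast
  qed
  show "ord x * ord y dvd ord (x \<otimes> y)"
    using *[of x y] *[of y x] assms by (simp add: divides_mult coprime_commute)
qed

lemma coprime_subgroups_commute:
  assumes "\<And>x y. x \<in> carrier G \<Longrightarrow> y \<in> carrier G \<Longrightarrow> coprime (ord x) (ord y) \<Longrightarrow> x \<otimes> y = y \<otimes> x"
    and "subgroup A G" "subgroup B G" "coprime (card A) (card B)" "x \<in> A" "y \<in> B"
  shows "x \<otimes> y = y \<otimes> x"
  using assms subgroup_ord_dvd_card coprime_divisors subgroup.mem_carrier by meson

text \<open>Induction on \<open>m\<close>, splitting off the full power of one prime: a Sylow
  subgroup and the subgroup for the remaining factor have coprime orders, so they commute
  elementwise and their product is a subgroup. The result supplies a complement to a Sylow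
  subgroup.\<close>

lemma ex_subgroup_of_unitary_divisor:
  assumes "finite (carrier G)"
    and comm: "\<And>x y. x \<in> carrier G \<Longrightarrow> y \<in> carrier G \<Longrightarrow> coprime (ord x) (ord y) \<Longrightarrow> x \<otimes> y = y \<otimes> x"
    and "order G = m * k" "coprime m k"
  shows "\<exists>H. subgroup H G \<and> card H = m"
  using assms(3,4)
proof (induction m arbitrary: k rule: less_induct)
  case (less m)
  have "0 < order G"
    using assms(1) order_gt_0_iff_finite by blast
  then have "m \<noteq> 0"
    using less.prems by auto
  show ?case
  proof (cases "m = 1")
    case True
    then show ?thesis
      using triv_subgroup by (intro exI[of _ "{\<one>}"]) simp
  next
    case False
    then obtain p where p: "Factorial_Ring.prime p" "p dvd m"
      using prime_factor_nat by blast
    then obtain m' where m': "m = p ^ multiplicity p m * m'" "\<not> p dvd m'"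
      using multiplicity_decompose'[of m p] \<open>m \<noteq> 0\<close> not_prime_unit by blast
    define a where "a = multiplicity p m"
    have a: "m = p ^ a * m'" "0 < a"
      using m' p \<open>m \<noteq> 0\<close> by (auto simp: a_def prime_multiplicity_gt_zero_iff)
    have cop: "coprime (p ^ a) m'"
      using m' p by (simp add: prime_imp_coprime)
    have "m' < m"
      using a \<open>m \<noteq> 0\<close> one_less_power[OF prime_gt_1_nat[OF p(1)] a(2)] by (auto intro: n_less_n_mult_m)
    moreover have "coprime m' (p ^ a * k)"
      using less.prems(2) cop unfolding a(1) by (simp add: coprime_commute)
    moreover have "order G = m' * (p ^ a * k)"
      using less.prems a by simp
    ultimately obtain K where K: "subgroup K G" "card K = m'"
      using less.IH by blast
    obtain P where P: "subgroup P G" "card P = p ^ a"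
      using sylow_thm[OF p(1) is_group _ assms(1), of a "m' * k"] less.prems a by auto
    have "coprime (card P) (card K)"
      using cop K P by simp
    then have "subgroup (P <#> K) G" "card (P <#> K) = p ^ a * m'"
      using commuting_set_mult[OF P(1) K(1) coprime_card_Int[OF P(1) K(1)]] K P
        coprime_subgroups_commute[OF comm P(1) K(1)] by auto
    then show ?thesis
      using a by blast
  qed
qed

text \<open>The same induction with elements in place of subgroups. For \<open>m = order G\<close>
  it says that a group with cyclic Sylow subgroups is cyclic; it is applied in contrapositive
  form.\<close>

lemma ex_element_of_unitary_divisor:
  assumes "finite (carrier G)"
    and comm: "\<And>x y. x \<in> carrier G \<Longrightarrow> y \<in> carrier G \<Longrightarrow> coprime (ord x) (ord y) \<Longrightarrow> x \<otimes> y = y \<otimes> x"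
    and syl: "\<And>p. Factorial_Ring.prime p \<Longrightarrow> \<exists>x\<in>carrier G. ord x = p ^ multiplicity p (order G)"
    and "order G = m * k" "coprime m k"
  shows "\<exists>x\<in>carrier G. ord x = m"
  using assms(4,5)
proof (induction m arbitrary: k rule: less_induct)
  case (less m)
  have "0 < order G"
    using assms(1) order_gt_0_iff_finite by blast
  then have "m \<noteq> 0" "k \<noteq> 0"
    using less.prems by auto
  show ?case
  proof (cases "m = 1")
    case True
    then show ?thesis
      using ord_id by blast
  next
    case False
    then obtain p where p: "Factorial_Ring.prime p" "p dvd m"
      using prime_factor_nat by blast
    then obtain m' where m': "m = p ^ multiplicity p m * m'" "\<not> p dvd m'"
      using multiplicity_decompose'[of m p] \<open>m \<noteq> 0\<close> not_prime_unit by blast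
    define a where "a = multiplicity p m"
    have a: "m = p ^ a * m'" "0 < a"
      using m' p \<open>m \<noteq> 0\<close> by (auto simp: a_def prime_multiplicity_gt_zero_iff)
    have cop: "coprime (p ^ a) m'"
      using m' p by (simp add: prime_imp_coprime)
    have "m' < m"
      using a \<open>m \<noteq> 0\<close> one_less_power[OF prime_gt_1_nat[OF p(1)] a(2)] by (auto intro: n_less_n_mult_m)
    moreover have "coprime m' (p ^ a * k)"
      using less.prems(2) cop unfolding a(1) by (simp add: coprime_commute)
    moreover have "order G = m' * (p ^ a * k)"
      using less.prems a by simp
    ultimately obtain x where x: "x \<in> carrier G" "ord x = m'"
      using less.IH by blast
    have "\<not> p dvd k"
      using p less.prems(2) coprime_common_divisor[of m k p] not_prime_unit by blast
    then have "multiplicity p (order G) = a"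
      using p \<open>m \<noteq> 0\<close> \<open>k \<noteq> 0\<close>
      by (simp add: less.prems(1) a_def prime_elem_multiplicity_mult_distrib not_dvd_imp_multiplicity_0)
    then obtain y where y: "y \<in> carrier G" "ord y = p ^ a"
      using syl[OF p(1)] by auto
    have "coprime (ord y) (ord x)"
      using cop x y by simp
    then have "ord (y \<otimes> x) = p ^ a * m'"
      using ord_mult_coprime[of y x] comm x y by simp
    then show ?thesis
      using a x y by blast
  qed
qed

lemma cyclic_if_ord_eq_order:
  assumes "finite (carrier G)" "x \<in> carrier G" "ord x = order G"
  shows "cyclic_group G"
proof -
  have "generate G {x} = carrier G"
    using card_subset_eq[OF assms(1) generate_singleton_subset[OF assms(2)]]
      generate_pow_card[OF assms(2)] assms(3) by (simp add: order_def)
  then show ?thesis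
    using assms(2) cyclic_group_iff_generate by blast
qed

lemma ex_noncyclic_sylow:
  assumes "finite (carrier G)" "\<not> cyclic_group G"
    and comm: "\<And>x y. x \<in> carrier G \<Longrightarrow> y \<in> carrier G \<Longrightarrow> coprime (ord x) (ord y) \<Longrightarrow> x \<otimes> y = y \<otimes> x"
  shows "\<exists>p P. Factorial_Ring.prime p \<and> sylow_subgroup p P G \<and> \<not> cyclic_group (G\<lparr>carrier := P\<rparr>)"
proof -
  have "\<not> (\<exists>x\<in>carrier G. ord x = order G)"
    using assms cyclic_if_ord_eq_order by blast
  then obtain p where p: "Factorial_Ring.prime p"
    "\<And>x. x \<in> carrier G \<Longrightarrow> ord x \<noteq> p ^ multiplicity p (order G)"
    using ex_element_of_unitary_divisor[OF assms(1) comm _ _ coprime_1_right, of "order G"] by auto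
  have "p ^ multiplicity p (order G) dvd order G"
    by (rule multiplicity_dvd)
  then obtain P where P: "subgroup P G" "card P = p ^ multiplicity p (order G)"
    using sylow_thm[OF p(1) is_group _ assms(1)] by (metis dvdE)
  interpret P: group "G\<lparr>carrier := P\<rparr>"
    using P(1) by (rule subgroup_imp_group)
  have "\<not> cyclic_group (G\<lparr>carrier := P\<rparr>)"
  proof
    assume "cyclic_group (G\<lparr>carrier := P\<rparr>)"
    then obtain x where "x \<in> P" "generate (G\<lparr>carrier := P\<rparr>) {x} = P"
      using P.cyclic_group_iff_generate by auto
    then have "generate G {x} = P"
      using generate_consistent[of "{x}" P] P by simp
    moreover have "x \<in> carrier G"
      using \<open>x \<in> P\<close> P subgroup.subset by blast
    ultimately show False
      using p(2)[of x] P(2) generate_pow_card[of x] by simp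
  qed
  then show ?thesis
    using p P unfolding sylow_subgroup_def by blast
qed

theorem nilpotent_lambda_six_decomposition:
  assumes "finite (carrier G)" "nilpotent G" "lambda_cov G = 6"
  shows "\<exists>p P n. Factorial_Ring.prime p \<and> sylow_subgroup p P G \<and> 0 < n \<and> \<not> p dvd n \<and>
    \<not> cyclic_group (G\<lparr>carrier := P\<rparr>) \<and> card (max_cyclic (G\<lparr>carrier := P\<rparr>)) = 6 \<and>
    G \<cong> G\<lparr>carrier := P\<rparr> \<times>\<times> integer_mod_group n"
proof -
  note comm = nilpotent_coprime_commute[OF assms(2)]
  have six: "card (max_cyclic G) = 6"
    using lambda_cov_eq_card_max_cyclic assms by simp
  then have "\<not> cyclic_group G"
    using card_max_cyclic_eq_1_iff assms(1) by fastforce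
  then obtain p P where p: "Factorial_Ring.prime p" "sylow_subgroup p P G"
    and nc: "\<not> cyclic_group (G\<lparr>carrier := P\<rparr>)"
    using ex_noncyclic_sylow[OF assms(1) _ comm] by blast
  have P: "subgroup P G" "card P = p ^ multiplicity p (order G)"
    using p unfolding sylow_subgroup_def by auto
  have pos: "order G \<noteq> 0"
    using assms(1) order_gt_0_iff_finite by auto
  then obtain n where n: "order G = p ^ multiplicity p (order G) * n" "\<not> p dvd n"
    using multiplicity_decompose'[of "order G" p] p not_prime_unit by blast
  have cop: "coprime (card P) n"
    using n p P by (simp add: prime_imp_coprime)
  then obtain Q where Q: "subgroup Q G" "card Q = n"
    using ex_subgroup_of_unitary_divisor[OF assms(1) comm, of n "card P"] n P
    by (auto simp: coprime_commute mult.commute)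
  have copPQ: "coprime (card P) (card Q)"
    using cop Q by simp
  note prod = commuting_set_mult[OF P(1) Q(1) coprime_card_Int[OF P(1) Q(1) copPQ]
      coprime_subgroups_commute[OF comm P(1) Q(1) copPQ]]
  have "card (P <#> Q) = order G"
    using prod(2) Q P n by simp
  then have PQ: "P <#> Q = carrier G"
    using prod(1) assms(1) by (simp add: card_subset_eq order_def subgroup.subset)
  interpret P: group "G\<lparr>carrier := P\<rparr>"
    using P(1) by (rule subgroup_imp_group)
  interpret Q: group "G\<lparr>carrier := Q\<rparr>"
    using Q(1) by (rule subgroup_imp_group)
  have fin: "finite P" "finite Q"
    using P Q assms(1) finite_subset subgroup.subset by metis+
  have iso: "G\<lparr>carrier := P\<rparr> \<times>\<times> G\<lparr>carrier := Q\<rparr> \<cong> G"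
    using prod(3) PQ by (auto simp: is_iso_def)
  have "card (max_cyclic (G\<lparr>carrier := P\<rparr>)) * card (max_cyclic (G\<lparr>carrier := Q\<rparr>)) = 6"
    using card_max_cyclic_DirProd_coprime[OF P.is_group Q.is_group] fin copPQ
      card_max_cyclic_iso[OF iso DirProd_group[OF P.is_group Q.is_group] is_group] six
    by (simp add: order_def DirProd_def)
  \<comment> \<open>A noncyclic factor contributes at least 3 to the product 6. Two of them would
    give at least 9, so the complement \<open>Q\<close> is cyclic and \<open>P\<close> carries the
    whole 6.\<close>
  moreover have P3: "3 \<le> card (max_cyclic (G\<lparr>carrier := P\<rparr>))"
    using P.card_max_cyclic_noncyclic nc fin by simp
  ultimately have "card (max_cyclic (G\<lparr>carrier := Q\<rparr>)) < 3"
    using mult_le_mono[OF P3, of 3 "card (max_cyclic (G\<lparr>carrier := Q\<rparr>))"] by linarith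
  then have Qc: "cyclic_group (G\<lparr>carrier := Q\<rparr>)"
    using Q.card_max_cyclic_noncyclic fin by fastforce
  then have "card (max_cyclic (G\<lparr>carrier := Q\<rparr>)) = 1"
    using Q.card_max_cyclic_eq_1_iff fin by simp
  then have "card (max_cyclic (G\<lparr>carrier := P\<rparr>)) = 6"
    using \<open>card (max_cyclic (G\<lparr>carrier := P\<rparr>)) * _ = 6\<close> by simp
  moreover have "G\<lparr>carrier := Q\<rparr> \<cong> integer_mod_group n"
    using Q.cyclic_iso_integer_mod_group[OF _ Qc] fin Q by (simp add: order_def)
  then have "G\<lparr>carrier := P\<rparr> \<times>\<times> G\<lparr>carrier := Q\<rparr> \<cong> G\<lparr>carrier := P\<rparr> \<times>\<times> integer_mod_group n"
    by (rule P.DirProd_iso_trans[OF iso_refl])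
  then have "G \<cong> G\<lparr>carrier := P\<rparr> \<times>\<times> integer_mod_group n"
    by (rule iso_trans[OF group.iso_sym[OF DirProd_group[OF P.is_group Q.is_group] iso]])
  moreover have "0 < n"
    using n pos by (cases n) auto
  ultimately show ?thesis
    using p n nc by blast
qed

end

section \<open>Normal subgroups of prime index\<close>

lemma (in group) nat_pow_mod:
  assumes "x \<in> carrier G" "x [^] (m::nat) = \<one>"
  shows "x [^] (k::nat) = x [^] (k mod m)"
proof -
  have "x [^] (m * (k div m)) \<otimes> x [^] (k mod m) = x [^] k"
    using nat_pow_mult[OF assms(1), of "m * (k div m)" "k mod m"] by simp
  moreover have "x [^] (m * (k div m)) = \<one>"
    using nat_pow_pow[OF assms(1), of m "k div m"] assms(2) by simp
  ultimately show ?thesis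
    using assms(1) by simp
qed

text \<open>A quotient of prime order is abelian and generated by any of its nontrivial elements.
  The conclusions pull this back to memberships in \<open>H\<close>, so that it can be applied to
  elements of \<open>G\<close>.\<close>

lemma (in normal) prime_index:
  assumes "Factorial_Ring.prime p" "order (G Mod H) = p"
  shows pow_prime_index: "x \<in> carrier G \<Longrightarrow> x [^] p \<in> H"
    and commutator_prime_index:
      "x \<in> carrier G \<Longrightarrow> y \<in> carrier G \<Longrightarrow> x \<otimes> y \<otimes> inv x \<otimes> inv y \<in> H"
    and coset_pow_prime_index: "x \<in> carrier G \<Longrightarrow> x \<notin> H \<Longrightarrow> y \<in> carrier G \<Longrightarrow>
      \<exists>i<p. inv (x [^] i) \<otimes> y \<in> H"
proof -
  interpret Q: group "G Mod H"
    by (rule factorgroup_is_group)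
  interpret q: group_hom G "G Mod H" "(#>) H"
    by (rule group_hom_r_coset)
  have p: "1 < p"
    using assms(1) prime_gt_1_nat by blast
  have fin: "finite (carrier (G Mod H))"
    using p assms(2) card.infinite[of "carrier (G Mod H)"] by (auto simp: order_def)
  have hom: "x [^] (n::nat) \<in> H \<longleftrightarrow> (H #> x) [^]\<^bsub>G Mod H\<^esub> n = \<one>\<^bsub>G Mod H\<^esub>"
    if "x \<in> carrier G" for x n
    using r_coset_eq_one_iff[of "x [^] n"] that by (simp add: q.hom_nat_pow)
  show "x [^] p \<in> H" if x: "x \<in> carrier G" for x
    using Q.pow_order_eq_1[of "H #> x"] x hom assms(2) q.hom_closed by blast
  have gen: "generate (G Mod H) {H #> x} = carrier (G Mod H)" if x: "x \<in> carrier G" "x \<notin> H" for x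
  proof -
    have c: "H #> x \<in> carrier (G Mod H)"
      using x by simp
    have "Q.ord (H #> x) \<noteq> 1"
      using Q.ord_eq_1[OF c] r_coset_eq_one_iff x by blast
    moreover have "Q.ord (H #> x) dvd p"
      using Q.ord_dvd_group_order[OF c] assms(2) by simp
    ultimately have "Q.ord (H #> x) = p"
      using assms(1) prime_nat_iff by blast
    then show ?thesis
      using card_subset_eq[OF fin Q.generate_singleton_subset[OF c]] Q.generate_pow_card[OF c]
        assms(2) by (simp add: order_def)
  qed
  show "x \<otimes> y \<otimes> inv x \<otimes> inv y \<in> H" if x: "x \<in> carrier G" and y: "y \<in> carrier G" for x y
  proof (cases "x \<in> H")
    case True
    then have "x \<otimes> (y \<otimes> inv x \<otimes> inv y) \<in> H"
      using inv_op_closed2[OF y, of "inv x"] by simp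
    then show ?thesis
      using x y by (simp add: m_assoc)
  next
    case False
    have c: "H #> x \<in> carrier (G Mod H)"
      using x by simp
    obtain k :: nat where "H #> y = (H #> x) [^]\<^bsub>G Mod H\<^esub> k"
      using Q.mem_generate_iff[OF fin c, of "H #> y"] gen[OF x False] y q.hom_closed by blast
    then have comm: "(H #> x) \<otimes>\<^bsub>G Mod H\<^esub> (H #> y) = (H #> y) \<otimes>\<^bsub>G Mod H\<^esub> (H #> x)"
      using Q.nat_pow_comm[OF c, of 1 k] c by (simp only: Q.nat_pow_eone)
    have "H #> (x \<otimes> y \<otimes> inv x \<otimes> inv y) = (H #> x) \<otimes>\<^bsub>G Mod H\<^esub> (H #> y)
        \<otimes>\<^bsub>G Mod H\<^esub> inv\<^bsub>G Mod H\<^esub> (H #> x) \<otimes>\<^bsub>G Mod H\<^esub> inv\<^bsub>G Mod H\<^esub> (H #> y)"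
      using x y q.hom_mult q.hom_inv by simp
    also have "\<dots> = (H #> y) \<otimes>\<^bsub>G Mod H\<^esub> (H #> x)
        \<otimes>\<^bsub>G Mod H\<^esub> inv\<^bsub>G Mod H\<^esub> (H #> x) \<otimes>\<^bsub>G Mod H\<^esub> inv\<^bsub>G Mod H\<^esub> (H #> y)"
      by (simp only: comm)
    also have "\<dots> = \<one>\<^bsub>G Mod H\<^esub>"
      using q.hom_closed[OF x] q.hom_closed[OF y] Q.inv_closed by (simp only: Q.m_assoc Q.r_inv Q.l_one Q.r_one Q.m_closed)
    finally show ?thesis
      using r_coset_eq_one_iff[of "x \<otimes> y \<otimes> inv x \<otimes> inv y"] x y by blast
  qed
  show "\<exists>i<p. inv (x [^] i) \<otimes> y \<in> H" if x: "x \<in> carrier G" "x \<notin> H" and y: "y \<in> carrier G" for x y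
  proof -
    have c: "H #> x \<in> carrier (G Mod H)"
      using x by simp
    obtain k :: nat where k: "H #> y = (H #> x) [^]\<^bsub>G Mod H\<^esub> k"
      using Q.mem_generate_iff[OF fin c, of "H #> y"] gen[OF x] y q.hom_closed by blast
    have "(H #> x) [^]\<^bsub>G Mod H\<^esub> p = \<one>\<^bsub>G Mod H\<^esub>"
      using Q.pow_order_eq_1[OF c] assms(2) by simp
    then have "(H #> x) [^]\<^bsub>G Mod H\<^esub> k = (H #> x) [^]\<^bsub>G Mod H\<^esub> (k mod p)"
      by (rule Q.nat_pow_mod[OF c])
    then have "H #> y = H #> (x [^] (k mod p))"
      using k x by (simp add: q.hom_nat_pow)
    then have "H #> (inv (x [^] (k mod p)) \<otimes> y) = \<one>\<^bsub>G Mod H\<^esub>"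
      using x y q.hom_mult q.hom_inv Q.l_inv q.hom_closed by (metis inv_closed nat_pow_closed)
    then have "inv (x [^] (k mod p)) \<otimes> y \<in> H"
      using r_coset_eq_one_iff[of "inv (x [^] (k mod p)) \<otimes> y"] x y by blast
    moreover have "k mod p < p"
      using p by simp
    ultimately show ?thesis
      by blast
  qed
qed

section \<open>The normalizer condition and maximal subgroups\<close>

context group
begin

lemma subgroup_nat_pow_closed: "subgroup H G \<Longrightarrow> x \<in> H \<Longrightarrow> x [^] (k::nat) \<in> H"
  by (induction k) (auto simp: subgroup.one_closed subgroup.m_closed)

text \<open>The classical property that normalizers grow. Asking for both conjugations makes the
  normalizer closed under inverses without a counting argument.\<close>

definition normalizer_condition :: bool
  where "normalizer_condition \<longleftrightarrow> (\<forall>H. subgroup H G \<and> H \<noteq> carrier G \<longrightarrow>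
    (\<exists>x\<in>carrier G - H. \<forall>h\<in>H. x \<otimes> h \<otimes> inv x \<in> H \<and> inv x \<otimes> h \<otimes> x \<in> H))"

text \<open>In the lower central series of \<open>G\<close>, find a term whose trace on
  \<open>P\<close> is not inside \<open>H\<close> while the trace of the next term is. For
  \<open>x\<close> in the first trace and outside \<open>H\<close>, commutators with elements of
  \<open>H\<close> fall into the second trace, hence into \<open>H\<close>, so \<open>x\<close>
  normalizes \<open>H\<close>. Using the series of \<open>G\<close> avoids discussing that of
  \<open>P\<close>.\<close>

lemma nilpotent_normalizer_condition:
  assumes "nilpotent G" "subgroup P G"
  shows "group.normalizer_condition (G\<lparr>carrier := P\<rparr>)"
proof -
  interpret P: group "G\<lparr>carrier := P\<rparr>"
    using assms(2) by (rule subgroup_imp_group)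
  have subP: "P \<subseteq> carrier G"
    using assms(2) subgroup.subset by blast
  have *: "\<exists>x\<in>P - H. \<forall>h\<in>H. x \<otimes> h \<otimes> inv x \<in> H \<and> inv x \<otimes> h \<otimes> x \<in> H"
    if H: "subgroup H G" "H \<subseteq> P" "H \<noteq> P" for H
  proof -
    obtain k where k: "lower_central G k = {\<one>}"
      using assms(1) unfolding nilpotent_def by blast
    have "lower_central G k \<inter> P \<subseteq> H"
      using k H subgroup.one_closed by auto
    moreover have "\<not> lower_central G 0 \<inter> P \<subseteq> H"
      using H subP by auto
    ultimately obtain i where i: "\<not> lower_central G i \<inter> P \<subseteq> H" "lower_central G (Suc i) \<inter> P \<subseteq> H"
      by (induction k) blast+
    then obtain x where x: "x \<in> lower_central G i" "x \<in> P" "x \<notin> H"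
      by blast
    have *: "y \<otimes> h \<otimes> inv y \<in> H" if "y \<in> lower_central G i" "y \<in> P" "h \<in> H" for y h
    proof -
      have c: "y \<in> carrier G" "h \<in> carrier G" "h \<in> P"
        using that H subP by auto
      have "y \<otimes> h \<otimes> inv y \<otimes> inv h \<in> lower_central G (Suc i)"
        using commutator_lower_central that c by blast
      moreover have "y \<otimes> h \<otimes> inv y \<otimes> inv h \<in> P"
        using assms(2) that c by (simp add: subgroup.m_closed subgroup.m_inv_closed)
      ultimately have "y \<otimes> h \<otimes> inv y \<otimes> inv h \<in> H"
        using i by blast
      then show ?thesis
        using subgroup_mult_right_iff[OF H(1) _ subgroup.m_inv_closed[OF H(1) that(3)]] c by auto
    qed
    have "inv x \<in> lower_central G i" "inv x \<in> P"
      using x assms(2) subgroup.m_inv_closed normal_imp_subgroup[OF lower_central_normal] by metis+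
    moreover have "inv (inv x) = x"
      using x subP by auto
    ultimately show ?thesis
      using x * *[of "inv x"] by auto
  qed
  show ?thesis
    unfolding P.normalizer_condition_def
  proof (intro allI impI)
    fix H assume "subgroup H (G\<lparr>carrier := P\<rparr>) \<and> H \<noteq> carrier (G\<lparr>carrier := P\<rparr>)"
    then have H: "subgroup H G" "H \<subseteq> P" "H \<noteq> P"
      using assms(2) incl_subgroup subgroup.subset[of H "G\<lparr>carrier := P\<rparr>"] by auto
    obtain x where "x \<in> P - H" "\<forall>h\<in>H. x \<otimes> h \<otimes> inv x \<in> H \<and> inv x \<otimes> h \<otimes> x \<in> H"
      using *[OF H] by blast
    moreover have "inv\<^bsub>G\<lparr>carrier := P\<rparr>\<^esub> x = inv x" if "x \<in> P"
      using m_inv_consistent[OF assms(2) that] .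
    ultimately show "\<exists>x\<in>carrier (G\<lparr>carrier := P\<rparr>) - H. \<forall>h\<in>H.
        x \<otimes>\<^bsub>G\<lparr>carrier := P\<rparr>\<^esub> h \<otimes>\<^bsub>G\<lparr>carrier := P\<rparr>\<^esub> inv\<^bsub>G\<lparr>carrier := P\<rparr>\<^esub> x \<in> H \<and>
        inv\<^bsub>G\<lparr>carrier := P\<rparr>\<^esub> x \<otimes>\<^bsub>G\<lparr>carrier := P\<rparr>\<^esub> h \<otimes>\<^bsub>G\<lparr>carrier := P\<rparr>\<^esub> x \<in> H"
      by (intro bexI[of _ x]) auto
  qed
qed

definition maximal_subgroup :: "'a set \<Rightarrow> bool"
  where "maximal_subgroup M \<longleftrightarrow> subgroup M G \<and> M \<noteq> carrier G \<and>
    (\<forall>H. subgroup H G \<and> M \<subseteq> H \<longrightarrow> H = M \<or> H = carrier G)"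

lemma ex_maximal_subgroup:
  assumes "finite (carrier G)" "subgroup H G" "H \<noteq> carrier G"
  shows "\<exists>M. maximal_subgroup M \<and> H \<subseteq> M"
proof -
  let ?S = "{K. subgroup K G \<and> K \<noteq> carrier G \<and> H \<subseteq> K}"
  have "?S \<subseteq> Pow (carrier G)"
    using subgroup.subset by auto
  then have fin: "finite ?S"
    using assms(1) finite_subset by blast
  have "H \<in> ?S"
    using assms by blast
  then obtain M where M: "M \<in> ?S" "H \<subseteq> M" "\<forall>K\<in>?S. M \<subseteq> K \<longrightarrow> M = K"
    by (rule finite_has_maximal2[OF fin, THEN bexE]) blast
  have "K = M \<or> K = carrier G" if "subgroup K G" "M \<subseteq> K" for K
  proof (cases "K = carrier G")
    case False
    then have "K \<in> ?S"
      using that M(2) by simp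
    then show ?thesis
      using M(3) that(2) by auto
  qed simp
  then show ?thesis
    using M(1,2) unfolding maximal_subgroup_def by (intro exI[of _ M]) simp
qed

text \<open>The normalizer of \<open>M\<close>, here \<open>S\<close>, is a subgroup strictly above
  \<open>M\<close>, so maximality makes it the whole group.\<close>

lemma maximal_subgroup_normal:
  assumes normalizer_condition "maximal_subgroup M"
  shows "M \<lhd> G"
proof -
  define S where "S = {x \<in> carrier G. \<forall>h\<in>M. x \<otimes> h \<otimes> inv x \<in> M \<and> inv x \<otimes> h \<otimes> x \<in> M}"
  have M: "subgroup M G" "M \<noteq> carrier G"
    using assms(2) unfolding maximal_subgroup_def by auto
  have c: "h \<in> carrier G" if "h \<in> M" for h
    using that M subgroup.subset by blast
  have "subgroup S G"
  proof (rule subgroupI)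
    show "S \<subseteq> carrier G" "S \<noteq> {}"
      unfolding S_def using c by (auto intro!: exI[of _ \<one>])
    show "inv a \<in> S" if "a \<in> S" for a
      using that unfolding S_def by auto
    show "a \<otimes> b \<in> S" if "a \<in> S" "b \<in> S" for a b
    proof -
      have ab: "a \<in> carrier G" "b \<in> carrier G"
        using that unfolding S_def by auto
      have "(a \<otimes> b) \<otimes> h \<otimes> inv (a \<otimes> b) = a \<otimes> (b \<otimes> h \<otimes> inv b) \<otimes> inv a"
        "inv (a \<otimes> b) \<otimes> h \<otimes> (a \<otimes> b) = inv b \<otimes> (inv a \<otimes> h \<otimes> a) \<otimes> b" if "h \<in> M" for h
        using ab c[OF that] by (simp_all add: inv_mult_group m_assoc)
      then show ?thesis
        using that ab unfolding S_def by simp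
    qed
  qed
  moreover have "M \<subseteq> S"
    unfolding S_def using M c by (auto intro!: subgroup.m_closed subgroup.m_inv_closed)
  moreover have "S \<noteq> M"
    using assms(1) M unfolding normalizer_condition_def S_def by blast
  ultimately have "S = carrier G"
    using assms(2) unfolding maximal_subgroup_def by blast
  then show ?thesis
    using M unfolding S_def by (intro normal_invI) auto
qed

text \<open>The quotient is a nontrivial \<open>p\<close>-group and has a subgroup \<open>R\<close>
  of order \<open>p\<close>. The preimage of \<open>R\<close> lies strictly above \<open>M\<close>,
  hence is \<open>G\<close>, so \<open>R\<close> is the whole quotient.\<close>

lemma maximal_subgroup_index:
  assumes "finite (carrier G)" "Factorial_Ring.prime p" "order G = p ^ r"
    and "maximal_subgroup M" "M \<lhd> G"
  shows "order (G Mod M) = p"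
proof -
  interpret normal M G by fact
  interpret Q: group "G Mod M"
    by (rule factorgroup_is_group)
  interpret q: group_hom G "G Mod M" "(#>) M"
    by (rule group_hom_r_coset)
  have ne: "M \<noteq> carrier G"
    using assms(4) unfolding maximal_subgroup_def by blast
  have ord: "order (G Mod M) * card M = p ^ r"
    unfolding assms(3)[symmetric] by (simp add: FactGroup_def lagrange order_def subgroup_axioms)
  have fin: "finite (carrier (G Mod M))"
    using ord assms(2) card.infinite[of "carrier (G Mod M)"] prime_gt_0_nat
    by (fastforce simp: order_def)
  obtain s where s: "order (G Mod M) = p ^ s"
    using ord divides_primepow_nat[OF assms(2)] by (metis dvd_triv_left)
  have "s \<noteq> 0"
  proof
    assume "s = 0"
    then have "card M = order G"
      using s ord assms(3) by simp
    then show False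
      using ne assms(1) card_subset_eq subset unfolding order_def by blast
  qed
  then have "order (G Mod M) = p ^ 1 * p ^ (s - 1)"
    using s by (cases s) auto
  then obtain R where R: "subgroup R (G Mod M)" "card R = p"
    using sylow_thm[OF assms(2) Q.is_group _ fin] by (metis power_one_right)
  define S where "S = {x \<in> carrier G. M #> x \<in> R}"
  have "subgroup S G"
  proof (rule subgroupI)
    show "S \<subseteq> carrier G" "S \<noteq> {}"
      unfolding S_def using subgroup.one_closed[OF R(1)] q.hom_one by (auto intro!: exI[of _ \<one>])
    show "inv a \<in> S" if "a \<in> S" for a
      using that subgroup.m_inv_closed[OF R(1)] q.hom_inv unfolding S_def by auto
    show "a \<otimes> b \<in> S" if "a \<in> S" "b \<in> S" for a b
      using that subgroup.m_closed[OF R(1)] q.hom_mult unfolding S_def by auto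
  qed
  moreover have "M \<subseteq> S"
  proof
    fix a assume "a \<in> M"
    then have a: "a \<in> carrier G" "M #> a = \<one>\<^bsub>G Mod M\<^esub>"
      using r_coset_eq_one_iff subset by auto
    then show "a \<in> S"
      unfolding S_def using subgroup.one_closed[OF R(1)] by (simp only: mem_Collect_eq a)
  qed
  moreover have "S \<noteq> M"
  proof
    assume "S = M"
    have "R \<subseteq> {\<one>\<^bsub>G Mod M\<^esub>}"
    proof
      fix y assume y: "y \<in> R"
      then have "y \<in> carrier (G Mod M)"
        using R(1) subgroup.subset by blast
      then obtain x where "x \<in> carrier G" "y = M #> x"
        unfolding FactGroup_def RCOSETS_def by auto
      then show "y \<in> {\<one>\<^bsub>G Mod M\<^esub>}"
        using y \<open>S = M\<close> r_coset_eq_one_iff unfolding S_def by auto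
    qed
    then have "card R \<le> 1"
      using card_mono[of "{\<one>\<^bsub>G Mod M\<^esub>}" R] by simp
    then show False
      using R(2) prime_gt_1_nat[OF assms(2)] by simp
  qed
  ultimately have "S = carrier G"
    using assms(4) unfolding maximal_subgroup_def by blast
  have "carrier (G Mod M) \<subseteq> R"
    using \<open>S = carrier G\<close> unfolding S_def FactGroup_def RCOSETS_def by auto
  then have "carrier (G Mod M) = R"
    using R(1) subgroup.subset by blast
  then show ?thesis
    using R(2) by (simp add: order_def)
qed

end

section \<open>Noncyclic groups of prime power order\<close>

text \<open>\<open>G Mod N\<close> is a plane over the field with \<open>p\<close> elements. Its
  exponent and commutativity are recorded as memberships in \<open>N\<close>, the form in which all
  later computations use them.\<close>

locale p_group_over = group G for G (structure) +
  fixes p n :: nat and N :: "'a set"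
  assumes prime: "Factorial_Ring.prime p"
    and order_G: "order G = p ^ (n + 2)"
    and N_normal: "N \<lhd> G"
    and card_N: "card N = p ^ n"
    and pow_mem_N: "x \<in> carrier G \<Longrightarrow> x [^] p \<in> N"
    and commutator_mem_N: "x \<in> carrier G \<Longrightarrow> y \<in> carrier G \<Longrightarrow> x \<otimes> y \<otimes> inv x \<otimes> inv y \<in> N"

text \<open>\<open>N\<close> is the intersection of two maximal subgroups. The second exists because
  the group is not cyclic: an element \<open>x\<close> outside \<open>M1\<close> generates a proper
  subgroup, which lies in some maximal \<open>M2\<close>, and \<open>M2\<close> differs from
  \<open>M1\<close> because of \<open>x\<close>.\<close>

lemma (in group) ex_p_group_over:
  assumes fin: "finite (carrier G)" and p: "Factorial_Ring.prime p" and r: "order G = p ^ r"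
    and nc: normalizer_condition and "\<not> cyclic_group G"
  shows "\<exists>n N. p_group_over G p n N"
proof -
  have "carrier G \<noteq> {\<one>}"
    using assms(5) cyclic_group_iff_generate generate_one by auto
  then obtain M1 where M1: "maximal_subgroup M1"
    using ex_maximal_subgroup[OF fin triv_subgroup] by blast
  then obtain x where x: "x \<in> carrier G" "x \<notin> M1"
    unfolding maximal_subgroup_def using subgroup.subset by blast
  have "subgroup (generate G {x}) G" "generate G {x} \<noteq> carrier G"
    using x generate_is_subgroup assms(5) cyclic_group_iff_generate by auto
  then obtain M2 where M2: "maximal_subgroup M2" "generate G {x} \<subseteq> M2"
    using ex_maximal_subgroup[OF fin] by blast
  then have "x \<in> M2"
    using generate_singleton_mem by blast
  note norm = maximal_subgroup_normal[OF nc M1] maximal_subgroup_normal[OF nc M2(1)]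
  note ind = maximal_subgroup_index[OF fin p r M1 norm(1)] maximal_subgroup_index[OF fin p r M2(1) norm(2)]
  interpret M1: normal M1 G by (rule norm)
  interpret M2: normal M2 G by (rule norm)
  have card: "p * card M1 = p ^ r" "p * card M2 = p ^ r"
    using ind r by (metis FactGroup_def M1.subgroup_axioms lagrange order_def partial_object.simps(1))
      (use ind r in \<open>metis FactGroup_def M2.subgroup_axioms lagrange order_def partial_object.simps(1)\<close>)
  define N where "N = M1 \<inter> M2"
  have N: "N \<lhd> G"
    unfolding N_def
    using subgroups_Inter_pair M1.subgroup_axioms M2.subgroup_axioms M1.inv_op_closed2 M2.inv_op_closed2
    by (intro normal_invI) auto
  have Ns: "subgroup N G"
    using N normal_imp_subgroup by blast
  have finM: "finite M1" "finite M2" "finite N"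
    using fin M1.subset M2.subset finite_subset unfolding N_def by blast+
  have "p * card M1 = p * card M2"
    using card by simp
  then have "card M1 = card M2"
    using prime_gt_0_nat[OF p] by simp
  then have "\<not> M1 \<subseteq> M2"
    using card_subset_eq[OF finM(2), of M1] x(2) \<open>x \<in> M2\<close> by auto
  then obtain y where y: "y \<in> M1" "y \<notin> M2"
    by blast
  have yc: "y \<in> carrier G"
    using y M1.subset by blast
  \<comment> \<open>The powers of \<open>y\<close> with exponent below \<open>p\<close> represent
    \<open>M1\<close> modulo \<open>N\<close>, so \<open>card M1 \<le> p * card N\<close>. As
    \<open>N\<close> is properly contained in \<open>M1\<close>, its index there is exactly
    \<open>p\<close>.\<close>
  have "M1 \<subseteq> (\<lambda>(i, u). y [^] i \<otimes> u) ` ({..<p} \<times> N)"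
  proof
    fix g assume g: "g \<in> M1"
    then have gc: "g \<in> carrier G"
      using M1.subset by blast
    obtain i where i: "i < p" "inv (y [^] i) \<otimes> g \<in> M2"
      using M2.coset_pow_prime_index[OF p ind(2) yc y(2) gc] by blast
    have "inv (y [^] i) \<otimes> g \<in> M1"
      using y g M1.subgroup_axioms
      by (simp add: subgroup.m_closed subgroup.m_inv_closed subgroup_nat_pow_closed)
    moreover have "g = y [^] i \<otimes> (inv (y [^] i) \<otimes> g)"
      using yc gc by (simp flip: m_assoc)
    ultimately show "g \<in> (\<lambda>(i, u). y [^] i \<otimes> u) ` ({..<p} \<times> N)"
      using i unfolding N_def by (intro image_eqI[of _ _ "(i, inv (y [^] i) \<otimes> g)"]) auto
  qed
  then have "card M1 \<le> card ({..<p} \<times> N)"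
    using finM by (intro surj_card_le) auto
  then have le: "card M1 \<le> p * card N"
    by (simp add: card_cartesian_product)
  obtain k where k: "card N = p ^ k"
    using lagrange[OF Ns] r divides_primepow_nat[OF p] by (metis dvd_triv_right)
  have "r \<noteq> 0"
    using card(1) prime_gt_1_nat[OF p] by (cases r) auto
  then obtain r' where r': "r = Suc r'"
    by (cases r) auto
  have c1: "card M1 = p ^ r'"
    using card(1) r' prime_gt_0_nat[OF p] by auto
  have "N \<subset> M1"
    using y unfolding N_def by blast
  then have "card N < card M1"
    using finM by (intro psubset_card_mono)
  then have "k < r'"
    using c1 k prime_gt_1_nat[OF p] by simp
  moreover have "r' \<le> Suc k"
    using le c1 k prime_gt_1_nat[OF p] by (metis power_Suc power_le_imp_le_exp)
  ultimately have "r = k + 2"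
    using r' by simp
  then have "p_group_over G p k N"
    unfolding p_group_over_def p_group_over_axioms_def
    using p r N k is_group M1.pow_prime_index[OF p ind(1)] M2.pow_prime_index[OF p ind(2)]
      M1.commutator_prime_index[OF p ind(1)] M2.commutator_prime_index[OF p ind(2)]
    unfolding N_def by auto
  then show ?thesis
    by blast
qed

section \<open>Counting cyclic subgroups outside N\<close>

context p_group_over
begin

lemma finite_G: "finite (carrier G)"
  using order_G prime_gt_0_nat[OF prime] order_gt_0_iff_finite by simp

lemma N_subgroup: "subgroup N G"
  using N_normal normal_imp_subgroup by blast

lemma N_subset: "N \<subseteq> carrier G"
  using N_subgroup subgroup.subset by blast

lemma finite_subgroup: "subgroup H G \<Longrightarrow> finite H"
  using finite_G subgroup.subset finite_subset by blast

lemma card_subgroup: "subgroup H G \<Longrightarrow> \<exists>k. card H = p ^ k"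
  using lagrange[of H] divides_primepow_nat[OF prime] unfolding order_G by (metis dvd_triv_right)

lemma ord_prime_power: "x \<in> carrier G \<Longrightarrow> \<exists>k. ord x = p ^ k"
  using card_subgroup[OF generate_is_subgroup[of "{x}"]] generate_pow_card[of x] by simp

text \<open>An exponent not divisible by \<open>p\<close> is invertible modulo \<open>p\<close> by
  Bezout, so \<open>x [^] k \<in> N\<close> would pull \<open>x\<close> itself into
  \<open>N\<close>.\<close>

lemma pow_mem_N_iff:
  assumes x: "x \<in> carrier G" "x \<notin> N"
  shows "x [^] (k::nat) \<in> N \<longleftrightarrow> p dvd k"
proof
  assume "p dvd k"
  then obtain j where "k = p * j" ..
  then show "x [^] k \<in> N"
    using x(1) pow_mem_N subgroup_nat_pow_closed[OF N_subgroup]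
    by (simp flip: nat_pow_pow)
next
  assume k: "x [^] k \<in> N"
  show "p dvd k"
  proof (rule ccontr)
    assume "\<not> p dvd k"
    then have "gcd k p = 1"
      using prime prime_imp_coprime[of p k] by (simp add: coprime_iff_gcd_eq_1 gcd.commute)
    moreover have "k \<noteq> 0"
      using \<open>\<not> p dvd k\<close> by (metis dvd_0_right)
    ultimately
    obtain a b where "k * a = p * b + 1"
      using bezout_nat[of k p] by auto
    then have "(x [^] k) [^] a = (x [^] p) [^] b \<otimes> x"
      using x by (simp add: nat_pow_pow)
    moreover have "(x [^] k) [^] a \<in> N" "(x [^] p) [^] b \<in> N"
      using subgroup_nat_pow_closed[OF N_subgroup] k pow_mem_N[OF x(1)] by blast+
    ultimately show False
      using subgroup_mult_left_iff[OF N_subgroup _ x(1)] x(2) by metis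
  qed
qed

text \<open>If \<open>y = x [^] k\<close> avoids \<open>N\<close>, then \<open>p\<close> does not
  divide \<open>k\<close>, so \<open>k\<close> is a unit modulo the prime power
  \<open>ord x\<close>. Two consequences carry the counting: elements outside \<open>N\<close>
  generate maximal cyclic subgroups, and distinct subgroups of this kind meet only inside
  \<open>N\<close>.\<close>

lemma generate_eq_if_not_mem_N:
  assumes "x \<in> carrier G" "y \<in> generate G {x}" "y \<notin> N"
  shows "generate G {y} = generate G {x}"
proof -
  obtain k :: nat where k: "y = x [^] k"
    using assms mem_generate_iff[OF finite_G] by blast
  then have "x \<notin> N"
    using assms subgroup_nat_pow_closed[OF N_subgroup] by blast
  then have "\<not> p dvd k"
    using assms k pow_mem_N_iff by blast
  moreover obtain a where "ord x = p ^ a"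
    using ord_prime_power assms by blast
  ultimately have "coprime k (ord x)"
    using prime_imp_coprime[OF prime, of k] by (simp add: coprime_commute)
  then have "ord y = ord x"
    using pow_ord_eq_ord_iff[OF finite_G assms(1)] k by simp
  moreover have y: "y \<in> carrier G"
    using k assms by simp
  ultimately have "card (generate G {y}) = card (generate G {x})"
    using generate_pow_card assms(1) by metis
  moreover have "generate G {y} \<subseteq> generate G {x}"
    using generate_singleton_le_iff y assms by blast
  moreover have "finite (generate G {x})"
    using finite_subgroup generate_is_subgroup assms by blast
  ultimately show ?thesis
    using card_subset_eq by blast
qed

lemma max_cyclic_if_not_mem_N:
  assumes "x \<in> carrier G" "x \<notin> N"
  shows "generate G {x} \<in> max_cyclic G"
  using assms generate_eq_if_not_mem_N generate_singleton_mem unfolding max_cyclic_def by blast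

text \<open>The preimages of the \<open>p + 1\<close> lines of the plane \<open>G Mod N\<close>;
  prescribing the order replaces a maximality condition.\<close>

definition maxes :: "'a set set"
  where "maxes = {M. subgroup M G \<and> N \<subseteq> M \<and> card M = p ^ (n + 1)}"

lemma maxesD:
  assumes "M \<in> maxes"
  shows "subgroup M G" "N \<subseteq> M" "card M = p ^ (n + 1)" "M \<subseteq> carrier G" "finite M"
  using assms finite_subgroup subgroup.subset unfolding maxes_def by blast+

lemma finite_maxes: "finite maxes"
proof -
  have "maxes \<subseteq> Pow (carrier G)"
    using maxesD(4) by blast
  then show ?thesis
    using finite_G finite_subset by blast
qed

text \<open>Orders are powers of \<open>p\<close>, and none lies strictly between
  \<open>p ^ n\<close> and \<open>p ^ (n + 1)\<close>.\<close>

lemma card_eq_if_N_psubset: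
  assumes "subgroup H G" "N \<subset> H" "card H \<le> p ^ (n + 1)"
  shows "card H = p ^ (n + 1)"
proof -
  obtain k where k: "card H = p ^ k"
    using card_subgroup assms by blast
  have "card N < card H"
    using assms finite_subgroup psubset_card_mono by blast
  then have "n < k"
    using k card_N prime_gt_1_nat[OF prime] by simp
  moreover have "k \<le> n + 1"
    using assms(3) k prime_gt_1_nat[OF prime] power_le_imp_le_exp by metis
  ultimately have "k = n + 1"
    by linarith
  then show ?thesis
    using k by simp
qed

lemma ex_maxes:
  assumes x: "x \<in> carrier G" "x \<notin> N"
  shows "\<exists>M\<in>maxes. x \<in> M"
proof -
  let ?S = "N <#> generate G {x}"
  have S: "subgroup ?S G"
    using mult_norm_subgroup[OF N_normal generate_is_subgroup] x by simp
  have "x \<in> ?S"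
    using generate_singleton_mem[of x] subgroup.one_closed[OF N_subgroup] x l_one
    unfolding set_mult_def by fastforce
  have sub: "N \<subseteq> ?S"
  proof
    fix a assume "a \<in> N"
    moreover have "a \<otimes> \<one> = a"
      using \<open>a \<in> N\<close> N_subset by auto
    ultimately show "a \<in> ?S"
      using generate.one[of G "{x}"] unfolding set_mult_def by force
  qed
  \<comment> \<open>Since \<open>x [^] p \<in> N\<close>, exponents of \<open>x\<close> reduce
    modulo \<open>p\<close>, which bounds the order of \<open>N <#> generate G {x}\<close> by
    \<open>p * p ^ n\<close>.\<close>
  have "?S \<subseteq> (\<lambda>(i, a). a \<otimes> x [^] i) ` ({..<p} \<times> N)"
  proof
    fix g assume "g \<in> ?S"
    then obtain a y where a: "a \<in> N" "y \<in> generate G {x}" "g = a \<otimes> y"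
      unfolding set_mult_def by blast
    then obtain k :: nat where k: "y = x [^] k"
      using mem_generate_iff[OF finite_G x(1)] by blast
    have "x [^] k = x [^] (p * (k div p)) \<otimes> x [^] (k mod p)"
      using nat_pow_mult[OF x(1), of "p * (k div p)" "k mod p"] by simp
    moreover have "x [^] (p * (k div p)) \<in> N"
      using pow_mem_N_iff[OF x] by simp
    moreover have "a \<in> carrier G"
      using a N_subset by blast
    ultimately have "g = (a \<otimes> x [^] (p * (k div p))) \<otimes> x [^] (k mod p)"
      "a \<otimes> x [^] (p * (k div p)) \<in> N"
      using a k x subgroup.m_closed[OF N_subgroup] by (simp_all add: m_assoc)
    then show "g \<in> (\<lambda>(i, a). a \<otimes> x [^] i) ` ({..<p} \<times> N)"
      using prime_gt_0_nat[OF prime]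
      by (intro image_eqI[of _ _ "(k mod p, a \<otimes> x [^] (p * (k div p)))"]) auto
  qed
  then have "card ?S \<le> card ({..<p} \<times> N)"
    using finite_subgroup[OF N_subgroup] by (intro surj_card_le) auto
  then have "card ?S \<le> p ^ (n + 1)"
    by (simp add: card_cartesian_product card_N)
  then have "card ?S = p ^ (n + 1)"
    using card_eq_if_N_psubset[OF S] sub \<open>x \<in> ?S\<close> x(2) by blast
  then show ?thesis
    using S sub \<open>x \<in> ?S\<close> unfolding maxes_def by blast
qed

text \<open>\<open>M \<inter> M'\<close> contains \<open>N\<close> properly, as witnessed by
  \<open>x\<close>, and therefore has the order of both groups.\<close>

lemma maxes_unique:
  assumes "M \<in> maxes" "M' \<in> maxes" "x \<in> M" "x \<in> M'" "x \<notin> N"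
  shows "M = M'"
proof -
  have "subgroup (M \<inter> M') G"
    using subgroups_Inter_pair maxesD assms by blast
  moreover have "N \<subset> M \<inter> M'"
    using assms maxesD(2) by blast
  moreover have "card (M \<inter> M') \<le> card M"
    using card_mono[OF maxesD(5)[OF assms(1)]] by blast
  ultimately have "card (M \<inter> M') = p ^ (n + 1)"
    using card_eq_if_N_psubset maxesD(3)[OF assms(1)] by simp
  then have "card (M \<inter> M') = card M" "card (M \<inter> M') = card M'"
    using maxesD(3) assms by auto
  then have "M \<inter> M' = M" "M \<inter> M' = M'"
    using card_subset_eq[OF maxesD(5)[OF assms(1)] Int_lower1]
      card_subset_eq[OF maxesD(5)[OF assms(2)] Int_lower2] by blast+
  then show ?thesis
    by blast
qed

text \<open>By existence and uniqueness the sets \<open>M - N\<close> partition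
  \<open>carrier G - N\<close>. Each has \<open>p ^ (n + 1) - p ^ n\<close> elements, and division
  gives \<open>p + 1\<close>.\<close>

lemma card_maxes: "card maxes = p + 1"
proof -
  let ?q = "p ^ (n + 1) - p ^ n"
  have "?q * card maxes = (\<Sum>M\<in>maxes. card (M - N))"
    using maxesD card_N finite_subgroup[OF N_subgroup] by (simp add: card_Diff_subset)
  also have "\<dots> = card (\<Union>M\<in>maxes. M - N)"
  proof (intro card_UN_disjoint[symmetric] ballI impI)
    show "(M - N) \<inter> (M' - N) = {}" if "M \<in> maxes" "M' \<in> maxes" "M \<noteq> M'" for M M'
      using maxes_unique that by blast
  qed (use finite_maxes maxesD(5) in auto)
  also have "(\<Union>M\<in>maxes. M - N) = carrier G - N"
    using ex_maxes maxesD(4) by blast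
  also have "card (carrier G - N) = p ^ (n + 2) - p ^ n"
    using N_subset card_N order_G finite_subgroup[OF N_subgroup]
    by (simp add: card_Diff_subset order_def)
  finally have eq: "?q * card maxes = p ^ (n + 2) - p ^ n" .
  have "?q * (p + 1) = p ^ (n + 2) - p ^ n"
    by (simp add: algebra_simps)
  then have "?q * card maxes = ?q * (p + 1)"
    using eq by simp
  moreover have "?q \<noteq> 0"
    using prime_gt_1_nat[OF prime] by simp
  ultimately show ?thesis
    by (metis mult_cancel1)
qed

definition cycs :: "'a set \<Rightarrow> 'a set set"
  where "cycs M = (\<lambda>x. generate G {x}) ` (M - N)"

lemma cycsE:
  assumes "C \<in> cycs M" "M \<in> maxes"
  obtains x where "x \<in> M" "x \<notin> N" "x \<in> carrier G" "C = generate G {x}" "x \<in> C"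
  using assms maxesD(4) generate_singleton_mem unfolding cycs_def by blast

lemma finite_cycs: "M \<in> maxes \<Longrightarrow> finite (cycs M)"
  using maxesD(5) unfolding cycs_def by blast

lemma cycs_subset: "M \<in> maxes \<Longrightarrow> C \<in> cycs M \<Longrightarrow> C \<subseteq> M"
  using generate_subgroup_incl maxesD(1) unfolding cycs_def by blast

lemma cycs_max_cyclic: "M \<in> maxes \<Longrightarrow> C \<in> cycs M \<Longrightarrow> C \<in> max_cyclic G"
  using max_cyclic_if_not_mem_N cycsE by metis

lemma maxes_diff_nonempty: "M \<in> maxes \<Longrightarrow> M - N \<noteq> {}"
proof -
  assume "M \<in> maxes"
  moreover have "p ^ n < p ^ (n + 1)"
    using prime_gt_1_nat[OF prime] by simp
  ultimately show ?thesis
    using maxesD(3) card_N finite_subgroup[OF N_subgroup] card_mono[of N M] by fastforce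
qed

lemma cycs_nonempty: "M \<in> maxes \<Longrightarrow> cycs M \<noteq> {}"
  using maxes_diff_nonempty unfolding cycs_def by blast

lemma card_cycs_pos: "M \<in> maxes \<Longrightarrow> 1 \<le> card (cycs M)"
  using cycs_nonempty finite_cycs by (simp add: Suc_leI card_gt_0_iff)

lemma card_cycs_member:
  assumes "M \<in> maxes" "C \<in> cycs M"
  shows "\<exists>k\<ge>1. card C = p ^ k"
proof -
  obtain x where x: "x \<in> carrier G" "x \<notin> N" "C = generate G {x}"
    using cycsE assms by metis
  then obtain k where k: "ord x = p ^ k"
    using ord_prime_power by blast
  have "x \<noteq> \<one>"
    using x subgroup.one_closed[OF N_subgroup] by blast
  then have "k \<noteq> 0"
    using ord_eq_1[OF x(1)] k by auto
  then show ?thesis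
    using k x generate_pow_card[OF x(1)] by (intro exI[of _ k]) auto
qed

text \<open>By \<open>pow_mem_N_iff\<close> the powers of \<open>x\<close> in \<open>N\<close> are
  those with exponent divisible by \<open>p\<close>.\<close>

lemma card_generate_Int_N:
  assumes x: "x \<in> carrier G" "x \<notin> N"
  shows "generate G {x} \<inter> N = generate G {x [^] p}" "ord x = p * card (generate G {x} \<inter> N)"
proof -
  have "y \<in> generate G {x} \<inter> N \<longleftrightarrow> y \<in> generate G {x [^] p}" for y
  proof
    assume "y \<in> generate G {x} \<inter> N"
    then obtain k :: nat where k: "y = x [^] k" "p dvd k"
      using mem_generate_iff[OF finite_G x(1)] pow_mem_N_iff[OF x] by auto
    then obtain j where "k = p * j"
      by blast
    then show "y \<in> generate G {x [^] p}"
      using k x pow_mem_generate[of "x [^] p" j] by (simp add: nat_pow_pow)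
  next
    assume "y \<in> generate G {x [^] p}"
    then obtain j :: nat where "y = x [^] (p * j)"
      using mem_generate_iff[OF finite_G, of "x [^] p"] x by (auto simp: nat_pow_pow)
    then show "y \<in> generate G {x} \<inter> N"
      using pow_mem_generate[OF x(1)] pow_mem_N_iff[OF x] by simp
  qed
  then show eq: "generate G {x} \<inter> N = generate G {x [^] p}"
    by blast
  have "p dvd ord x"
    using pow_mem_N_iff[OF x, of "ord x"] x(1) subgroup.one_closed[OF N_subgroup] by simp
  moreover have "p \<noteq> 0"
    using prime by auto
  ultimately have "ord (x [^] p) = ord x div p"
    using ord_pow x(1) by blast
  then show "ord x = p * card (generate G {x} \<inter> N)"
    unfolding eq using generate_pow_card[of "x [^] p"] x \<open>p dvd ord x\<close> by simp
qed

text \<open>Every cyclic group meeting \<open>M - N\<close> has the same proportion \<open>(p - 1) / p\<close> of its elements there.\<close>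

lemma sum_card_cycs:
  assumes M: "M \<in> maxes"
  shows "(\<Sum>C\<in>cycs M. card C) = p ^ (n + 1)"
proof -
  have one: "card C = p * card (C \<inter> N)" and fin: "finite C" if "C \<in> cycs M" for C
    using that M card_generate_Int_N generate_pow_card finite_subset[OF cycs_subset[OF M that] maxesD(5)[OF M]]
    by (metis cycsE)+
  have diff: "card (C - N) = (p - 1) * card (C \<inter> N)" if "C \<in> cycs M" for C
  proof -
    have "card (C - N) = card C - card (C \<inter> N)"
      using fin[OF that] by (simp add: card_Diff_subset_Int)
    then show ?thesis
      using one[OF that] by (simp add: diff_mult_distrib)
  qed
  \<comment> \<open>An element outside \<open>N\<close> generates every member containing it, so
    distinct members can meet only inside \<open>N\<close>.\<close>
  have disj: "(C - N) \<inter> (D - N) = {}" if "C \<in> cycs M" "D \<in> cycs M" "C \<noteq> D" for C D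
  proof (rule ccontr)
    assume "(C - N) \<inter> (D - N) \<noteq> {}"
    then obtain y where "y \<in> C" "y \<in> D" "y \<notin> N"
      by blast
    then show False
      using generate_eq_if_not_mem_N that M by (metis cycsE)
  qed
  have "(\<Union>C\<in>cycs M. C - N) = M - N"
    using cycs_subset[OF M] generate_singleton_mem unfolding cycs_def by fastforce
  then have "(\<Sum>C\<in>cycs M. card (C - N)) = card (M - N)"
    using card_UN_disjoint[OF finite_cycs[OF M], of "\<lambda>C. C - N"] fin disj by simp
  also have "\<dots> = (p - 1) * p ^ n"
    using maxesD[OF M] card_N finite_subgroup[OF N_subgroup]
    by (simp add: card_Diff_subset diff_mult_distrib)
  finally have "(p - 1) * (\<Sum>C\<in>cycs M. card (C \<inter> N)) = (p - 1) * p ^ n"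
    using diff by (simp add: sum_distrib_left)
  then have "(\<Sum>C\<in>cycs M. card (C \<inter> N)) = p ^ n"
    using prime_gt_1_nat[OF prime] by simp
  then show ?thesis
    using one by (simp flip: sum_distrib_left)
qed

text \<open>If \<open>cycs M\<close> has only one member, the sum formula gives that member the
  order of \<open>M\<close>.\<close>

lemma cyclic_maxes:
  assumes "M \<in> maxes" "card (cycs M) = 1" "x \<in> M" "x \<notin> N"
  shows "generate G {x} = M" "ord x = p ^ (n + 1)"
proof -
  obtain C where C: "cycs M = {C}"
    using assms(2) card_1_singletonE by blast
  moreover have "generate G {x} \<in> cycs M"
    using assms unfolding cycs_def by blast
  ultimately have c: "card (generate G {x}) = p ^ (n + 1)"
    using sum_card_cycs[OF assms(1)] by auto
  then show "generate G {x} = M"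
    using card_subset_eq[OF maxesD(5)[OF assms(1)]] cycs_subset[OF assms(1)] maxesD(3)[OF assms(1)]
      \<open>generate G {x} \<in> cycs M\<close> by metis
  show "ord x = p ^ (n + 1)"
    using c generate_pow_card assms maxesD(4) by (metis subsetD)
qed

text \<open>Different \<open>M\<close> give disjoint families, because a generator outside
  \<open>N\<close> belongs to only one \<open>M\<close>.\<close>

lemma card_Union_cycs:
  "card (\<Union>M\<in>maxes. cycs M) = (\<Sum>M\<in>maxes. card (cycs M))"
proof (intro card_UN_disjoint ballI impI)
  fix M M' assume M: "M \<in> maxes" "M' \<in> maxes" "M \<noteq> M'"
  show "cycs M \<inter> cycs M' = {}"
  proof (rule ccontr)
    assume "cycs M \<inter> cycs M' \<noteq> {}"
    then obtain C where C: "C \<in> cycs M" "C \<in> cycs M'"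
      by blast
    obtain x where "x \<in> M" "x \<notin> N" "x \<in> C"
      using cycsE[OF C(1) M(1)] by metis
    then show False
      using maxes_unique[OF M(1,2)] cycs_subset[OF M(2) C(2)] M(3) by blast
  qed
qed (use finite_maxes finite_cycs in auto)

lemma Union_cycs_subset: "(\<Union>M\<in>maxes. cycs M) \<subseteq> max_cyclic G"
  using cycs_max_cyclic by blast

lemma sum_card_cycs_le: "(\<Sum>M\<in>maxes. card (cycs M)) \<le> card (max_cyclic G)"
  unfolding card_Union_cycs[symmetric]
  by (intro card_mono finite_max_cyclic[OF finite_G] Union_cycs_subset)

lemma Union_cycs_eq_if_sum_eq:
  assumes "(\<Sum>M\<in>maxes. card (cycs M)) = card (max_cyclic G)"
  shows "(\<Union>M\<in>maxes. cycs M) = max_cyclic G"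
  using assms unfolding card_Union_cycs[symmetric]
  by (intro card_subset_eq finite_max_cyclic[OF finite_G] Union_cycs_subset)

text \<open>Let \<open>a\<close> outside \<open>N\<close> generate the cyclic group
  \<open>M\<close>. An element \<open>x\<close> of \<open>N\<close> lies in
  \<open>generate G {a}\<close>, while \<open>a\<close> is not in
  \<open>generate G {x} \<subseteq> N\<close>; so \<open>x\<close> generates no maximal cyclic
  subgroup, and the groups counted outside \<open>N\<close> are all there are.\<close>

lemma sum_card_cycs_eq:
  assumes "M \<in> maxes" "card (cycs M) = 1"
  shows "(\<Sum>M\<in>maxes. card (cycs M)) = card (max_cyclic G)"
proof -
  obtain a where a: "a \<in> M" "a \<notin> N"
    using maxes_diff_nonempty assms by blast
  have gen: "generate G {a} = M"
    using cyclic_maxes assms a by blast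
  have "C \<in> (\<Union>M\<in>maxes. cycs M)" if C: "C \<in> max_cyclic G" for C
  proof -
    obtain x where x: "x \<in> carrier G" "C = generate G {x}"
      "\<forall>y\<in>carrier G. x \<in> generate G {y} \<longrightarrow> y \<in> generate G {x}"
      using C unfolding max_cyclic_def by blast
    have "x \<notin> N"
    proof
      assume "x \<in> N"
      then have "generate G {x} \<subseteq> N"
        using generate_subgroup_incl N_subgroup by simp
      moreover have "x \<in> generate G {a}"
        using \<open>x \<in> N\<close> gen maxesD(2) assms by blast
      ultimately show False
        using x a maxesD(4)[OF assms(1)] by blast
    qed
    then show ?thesis
      using x ex_maxes unfolding cycs_def by blast
  qed
  then have "(\<Union>M\<in>maxes. cycs M) = max_cyclic G"
    using Union_cycs_subset by blast
  then show ?thesis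
    using card_Union_cycs by simp
qed

end

section \<open>Odd primes\<close>

context group
begin

text \<open>Trivial intersection and the order make \<open>G\<close> the product of two cyclic
  subgroups, and the last equation says that \<open>c\<close> conjugates \<open>a\<close> to
  \<open>a [^] r\<close>. All six candidates for the Sylow subgroup have this shape, with
  \<open>r = 1\<close> for the abelian ones.\<close>

definition split_metacyclic :: "nat \<Rightarrow> nat \<Rightarrow> nat \<Rightarrow> bool"
  where "split_metacyclic m k r \<longleftrightarrow> (\<exists>a\<in>carrier G. \<exists>c\<in>carrier G. ord a = m \<and> ord c = k \<and>
    generate G {a} \<inter> generate G {c} = {\<one>} \<and> order G = m * k \<and> a \<otimes> c = c \<otimes> a [^] r)"

lemma ord_eq_prime:
  fixes p :: nat
  assumes "x \<in> carrier G" "x \<noteq> \<one>" "x [^] p = \<one>" "Factorial_Ring.prime p"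
  shows "ord x = p"
  using assms ord_eq_1 pow_eq_id prime_nat_iff by metis

text \<open>A subgroup of prime order is generated by any of its nontrivial elements, so it meets
  \<open>H\<close> trivially or lies in \<open>H\<close>.\<close>

lemma generate_Int_prime_ord:
  fixes p :: nat
  assumes "subgroup H G" "c \<in> carrier G" "c \<notin> H" "c [^] p = \<one>" "Factorial_Ring.prime p"
    and fin: "finite (carrier G)"
  shows "H \<inter> generate G {c} = {\<one>}"
proof -
  have one: "\<one> \<in> H" "\<one> \<in> generate G {c}"
    using subgroup.one_closed[OF assms(1)] generate.one by auto
  then have ord: "ord c = p"
    using assms by (intro ord_eq_prime) auto
  have "y = \<one>" if y: "y \<in> H" "y \<in> generate G {c}" for y
  proof (rule ccontr)
    assume ne: "y \<noteq> \<one>"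
    have yc: "y \<in> carrier G"
      using y generate_singleton_subset assms(2) by blast
    have "ord y dvd p"
      using subgroup_ord_dvd_card[OF generate_is_subgroup[of "{c}"] y(2)] assms(2)
        generate_pow_card[OF assms(2)] ord by simp
    then have "ord y = p"
      using ne ord_eq_1[OF yc] assms(5) prime_nat_iff by blast
    then have "card (generate G {y}) = card (generate G {c})"
      using generate_pow_card assms(2) yc ord by metis
    moreover have "generate G {y} \<subseteq> generate G {c}"
      using generate_singleton_le_iff yc assms(2) y by blast
    moreover have "finite (generate G {c})"
      using fin generate_singleton_subset[OF assms(2)] finite_subset by blast
    ultimately have "generate G {y} = generate G {c}"
      using card_subset_eq by blast
    then have "c \<in> generate G {y}"
      using generate_singleton_mem by simp
    then show False
      using generate_subgroup_incl[of "{y}" H] y assms(1,3) by blast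
  qed
  then show ?thesis
    using one by blast
qed

lemma split_metacyclicI:
  assumes "finite (carrier G)" "Factorial_Ring.prime p" "a \<in> carrier G" "c \<in> carrier G" "ord a = m"
    and "c \<notin> generate G {a}" "c [^] p = \<one>" "order G = m * p" "a \<otimes> c = c \<otimes> a [^] r"
  shows "split_metacyclic m p r"
proof -
  have "generate G {a} \<inter> generate G {c} = {\<one>}"
    using assms generate_is_subgroup[of "{a}"] by (intro generate_Int_prime_ord) auto
  moreover have "c \<noteq> \<one>"
    using assms(6) generate.one by blast
  then have "ord c = p"
    using assms ord_eq_prime by blast
  ultimately show ?thesis
    unfolding split_metacyclic_def using assms by blast
qed

section \<open>Powers of products with a central commutator\<close>

lemma nat_pow_commute:
  assumes "x \<in> carrier G" "y \<in> carrier G" "x \<otimes> y = y \<otimes> x"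
  shows "x [^] (k::nat) \<otimes> y = y \<otimes> x [^] k"
proof (induction k)
  case (Suc k)
  have "x [^] Suc k \<otimes> y = x [^] k \<otimes> y \<otimes> x"
    using assms by (simp add: m_assoc)
  also have "\<dots> = y \<otimes> x [^] Suc k"
    using assms by (simp add: Suc m_assoc)
  finally show ?case .
qed (use assms in simp)

lemma pow_mult_commutator:
  assumes c: "a \<in> carrier G" "b \<in> carrier G" "d \<in> carrier G" and ab: "a \<otimes> b = b \<otimes> a \<otimes> d"
    and ad: "a \<otimes> d = d \<otimes> a"
  shows "a [^] (j::nat) \<otimes> b = b \<otimes> a [^] j \<otimes> d [^] j"
proof (induction j)
  case (Suc j)
  have "a [^] Suc j \<otimes> b = a [^] j \<otimes> (a \<otimes> b)"
    using c by (simp add: m_assoc)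
  also have "\<dots> = (a [^] j \<otimes> b) \<otimes> (a \<otimes> d)"
    using c by (simp add: ab m_assoc)
  also have "\<dots> = b \<otimes> a [^] j \<otimes> (d [^] j \<otimes> a) \<otimes> d"
    using c by (simp add: Suc m_assoc)
  also have "d [^] j \<otimes> a = a \<otimes> d [^] j"
    using c ad by (intro nat_pow_commute) simp_all
  finally show ?case
    using c by (simp add: m_assoc)
qed (use c in simp)

text \<open>Replacing \<open>b\<close> by \<open>b \<otimes> a [^] j\<close> keeps the commutator
  with \<open>a\<close>, so \<open>b\<close> may be corrected by powers of \<open>a\<close> at no
  cost.\<close>

lemma mult_pow_shift:
  assumes c: "a \<in> carrier G" "b \<in> carrier G" "d \<in> carrier G" and ab: "a \<otimes> b = b \<otimes> a \<otimes> d"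
    and ad: "a \<otimes> d = d \<otimes> a"
  shows "a \<otimes> (b \<otimes> a [^] (j::nat)) = (b \<otimes> a [^] j) \<otimes> a \<otimes> d"
proof -
  have "a \<otimes> (b \<otimes> a [^] j) = b \<otimes> a \<otimes> (d \<otimes> a [^] j)"
    using c ab by (simp flip: m_assoc)
  also have "d \<otimes> a [^] j = a [^] j \<otimes> d"
    using nat_pow_commute[OF c(1,3) ad, of j] by simp
  also have "b \<otimes> a \<otimes> (a [^] j \<otimes> d) = b \<otimes> (a \<otimes> a [^] j) \<otimes> d"
    using c by (simp add: m_assoc)
  also have "a \<otimes> a [^] j = a [^] j \<otimes> a"
    using c nat_pow_commute[of a a] by simp
  finally show ?thesis
    using c by (simp add: m_assoc)
qed

lemma mult_pow_commutator:
  assumes c: "a \<in> carrier G" "b \<in> carrier G" "d \<in> carrier G" and ab: "a \<otimes> b = b \<otimes> a \<otimes> d"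
    and bd: "b \<otimes> d = d \<otimes> b"
  shows "a \<otimes> b [^] (j::nat) = b [^] j \<otimes> a \<otimes> d [^] j"
proof (induction j)
  case (Suc j)
  have "a \<otimes> b [^] Suc j = (a \<otimes> b [^] j) \<otimes> b"
    using c by (simp add: m_assoc)
  also have "\<dots> = b [^] j \<otimes> a \<otimes> (d [^] j \<otimes> b)"
    using c by (simp add: Suc m_assoc)
  also have "d [^] j \<otimes> b = b \<otimes> d [^] j"
    using c bd by (intro nat_pow_commute) simp_all
  also have "b [^] j \<otimes> a \<otimes> (b \<otimes> d [^] j) = b [^] j \<otimes> (a \<otimes> b) \<otimes> d [^] j"
    using c by (simp add: m_assoc)
  also have "\<dots> = b [^] Suc j \<otimes> a \<otimes> (d \<otimes> d [^] j)"
    using c by (simp add: ab m_assoc)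
  also have "d \<otimes> d [^] j = d [^] Suc j"
    using c nat_pow_Suc2 by simp
  finally show ?case .
qed (use c in simp)

text \<open>The binomial exponent counts how often some \<open>a\<close> moves past some
  \<open>b\<close>. If \<open>d [^] p = \<one>\<close> and \<open>k = p\<close>, the last factor
  vanishes for odd \<open>p\<close>, but for \<open>p = 2\<close> it is \<open>d\<close> itself.
  This is the difference between odd primes and 2.\<close>

lemma pow_mult_class_two:
  assumes c: "a \<in> carrier G" "b \<in> carrier G" "d \<in> carrier G" and ab: "a \<otimes> b = b \<otimes> a \<otimes> d"
    and ad: "a \<otimes> d = d \<otimes> a" and bd: "b \<otimes> d = d \<otimes> b"
  shows "(b \<otimes> a) [^] (k::nat) = b [^] k \<otimes> a [^] k \<otimes> d [^] (k choose 2)"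
proof (induction k)
  case (Suc k)
  have comm: "d [^] i \<otimes> a = a \<otimes> d [^] i" "d [^] i \<otimes> b = b \<otimes> d [^] i" for i :: nat
    using c ad bd by (auto intro!: nat_pow_commute)
  have "(b \<otimes> a) [^] Suc k = b [^] k \<otimes> a [^] k \<otimes> (d [^] (k choose 2) \<otimes> b) \<otimes> a"
    using c by (simp add: Suc m_assoc)
  also have "\<dots> = b [^] k \<otimes> (a [^] k \<otimes> b) \<otimes> (d [^] (k choose 2) \<otimes> a)"
    using c by (simp add: comm m_assoc)
  also have "\<dots> = b [^] k \<otimes> (b \<otimes> a [^] k \<otimes> d [^] k) \<otimes> (a \<otimes> d [^] (k choose 2))"
    using pow_mult_commutator[OF c ab ad] by (simp only: comm)
  also have "\<dots> = b [^] k \<otimes> b \<otimes> a [^] k \<otimes> (d [^] k \<otimes> a) \<otimes> d [^] (k choose 2)"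
    using c by (simp add: m_assoc)
  also have "\<dots> = b [^] Suc k \<otimes> a [^] Suc k \<otimes> (d [^] k \<otimes> d [^] (k choose 2))"
    using c by (simp add: comm m_assoc)
  also have "d [^] k \<otimes> d [^] (k choose 2) = d [^] (Suc k choose 2)"
    using c by (simp add: nat_pow_mult numeral_2_eq_2)
  finally show ?case .
qed (use c in \<open>simp add: numeral_2_eq_2\<close>)

end

section \<open>Groups with two cyclic maximal subgroups above \<open>N\<close>; odd primes\<close>

context p_group_over
begin

lemma conj_mem_maxes:
  assumes "M \<in> maxes" "x \<in> M" "g \<in> carrier G"
  shows "g \<otimes> x \<otimes> inv g \<in> M"
proof -
  have x: "x \<in> carrier G"
    using assms maxesD(4) by blast
  have "g \<otimes> x \<otimes> inv g \<otimes> inv x \<in> M"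
    using commutator_mem_N[OF assms(3) x] maxesD(2)[OF assms(1)] by blast
  then show ?thesis
    using subgroup_mult_right_iff[OF maxesD(1)[OF assms(1)] _ subgroup.m_inv_closed[OF maxesD(1)[OF assms(1)] assms(2)]]
      x assms(3) by simp
qed

lemma maxes_normal: "M \<in> maxes \<Longrightarrow> M \<lhd> G"
  using conj_mem_maxes maxesD(1) by (intro normal_invI) auto

lemma maxes_index:
  assumes "M \<in> maxes"
  shows "order (G Mod M) = p"
proof -
  have "order (G Mod M) * p ^ (n + 1) = p * p ^ (n + 1)"
    using lagrange[OF maxesD(1)[OF assms]] maxesD(3)[OF assms] order_G
    by (simp add: FactGroup_def order_def)
  then show ?thesis
    using prime_gt_0_nat[OF prime] by (simp only: mult_cancel2) simp
qed

text \<open>Each group in \<open>cycs M\<close> has index at least \<open>p\<close> unless it is \<open>M\<close>, and their orders add up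
  to that of \<open>M\<close>.\<close>

lemma card_cycs_ne_1:
  assumes M: "M \<in> maxes" and "card (cycs M) \<noteq> 1"
  shows "C \<in> cycs M \<Longrightarrow> p * card C \<le> p ^ (n + 1)"
    and "p \<le> card (cycs M)"
    and "card (cycs M) = p \<Longrightarrow> C \<in> cycs M \<Longrightarrow> card C = p ^ n"
proof -
  show le: "p * card C \<le> p ^ (n + 1)" if C: "C \<in> cycs M" for C
  proof -
    have "C \<noteq> M"
    proof
      assume "C = M"
      have "D = C" if D: "D \<in> cycs M" for D
        using max_cyclic_antichain[OF cycs_max_cyclic[OF M D] cycs_max_cyclic[OF M C]]
          cycs_subset[OF M D] \<open>C = M\<close> by blast
      then have "cycs M = {C}"
        using C by blast
      then show False
        using assms(2) by simp
    qed
    then have "card C < p ^ (n + 1)"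
      using psubset_card_mono[OF maxesD(5)[OF M]] cycs_subset[OF M C] maxesD(3)[OF M] by (metis psubsetI)
    moreover obtain k where k: "card C = p ^ k"
      using card_cycs_member[OF M C] by blast
    ultimately have "Suc k \<le> n + 1"
      using prime_gt_1_nat[OF prime] by (metis Suc_leI power_less_imp_less_exp)
    then have "p ^ Suc k \<le> p ^ (n + 1)"
      using prime_gt_0_nat[OF prime] by (intro power_increasing) auto
    then show ?thesis
      using k by simp
  qed
  have sum: "(\<Sum>C\<in>cycs M. p * card C) = p * p ^ (n + 1)"
    using sum_card_cycs[OF M] by (simp flip: sum_distrib_left)
  have "(\<Sum>C\<in>cycs M. p * card C) \<le> card (cycs M) * p ^ (n + 1)"
    using sum_bounded_above[of "cycs M" "\<lambda>C. p * card C" "p ^ (n + 1)"] le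
    by (simp only: of_nat_id)
  then show "p \<le> card (cycs M)"
    using sum prime_gt_0_nat[OF prime] by simp
  show "card C = p ^ n" if C: "C \<in> cycs M" and eq: "card (cycs M) = p"
  proof -
    have "(\<Sum>D\<in>cycs M. p ^ (n + 1) - p * card D) = 0"
      using sum le eq by (simp add: sum_subtractf_nat)
    then have "p ^ (n + 1) - p * card C = 0"
      using C finite_cycs[OF M] by simp
    then have "p * card C = p * p ^ n"
      using le[OF C] by (simp only: diff_is_0_eq power_Suc Suc_eq_plus1[symmetric] le_antisym)
    then show ?thesis
      using prime_gt_0_nat[OF prime] by simp
  qed
qed

text \<open>Let \<open>a\<close> and \<open>b\<close> generate the two cyclic groups. Both groups
  contain \<open>N\<close>, so \<open>N\<close> commutes with \<open>a\<close> and \<open>b\<close>.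
  The commutator \<open>d\<close> lies in \<open>N\<close>; as \<open>a\<close> commutes with
  \<open>b [^] p \<in> N\<close>, it satisfies \<open>d [^] p = \<one>\<close>. Finally
  \<open>b [^] p\<close> lies in the group of \<open>a [^] p\<close>, and \<open>j\<close> is the
  correction for which the \<open>p\<close>-th power of \<open>b \<otimes> a [^] j\<close> is
  trivial up to a power of \<open>d\<close>.\<close>

lemma two_cyclic_maxes:
  assumes M: "M1 \<in> maxes" "M2 \<in> maxes" "M1 \<noteq> M2" and k: "card (cycs M1) = 1" "card (cycs M2) = 1"
  obtains a b d j where "a \<in> carrier G" "b \<in> carrier G" "d \<in> carrier G" "a \<notin> N"
    "generate G {a} = M1" "ord a = p ^ (n + 1)" "b \<notin> M1"
    "d \<in> N" "d [^] p = \<one>" "a \<otimes> b = b \<otimes> a \<otimes> d"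
    "\<And>y. y \<in> N \<Longrightarrow> a \<otimes> y = y \<otimes> a" "\<And>y. y \<in> N \<Longrightarrow> b \<otimes> y = y \<otimes> b"
    "b [^] p \<otimes> a [^] (j * p) = \<one>"
proof -
  obtain a where a: "a \<in> M1" "a \<notin> N"
    using maxes_diff_nonempty M by blast
  obtain b where b: "b \<in> M2" "b \<notin> N"
    using maxes_diff_nonempty M by blast
  have c: "a \<in> carrier G" "b \<in> carrier G"
    using a b maxesD(4) M by auto
  note ga = cyclic_maxes[OF M(1) k(1) a]
  note gb = cyclic_maxes[OF M(2) k(2) b]
  have comm_gen: "x \<otimes> y = y \<otimes> x" if "x \<in> carrier G" "y \<in> generate G {x}" for x y
    using that mem_generate_iff[OF finite_G that(1)] nat_pow_commute[of x x] by metis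
  have Na: "a \<otimes> y = y \<otimes> a" if "y \<in> N" for y
    using comm_gen[OF c(1)] ga(1) maxesD(2)[OF M(1)] that by blast
  have Nb: "b \<otimes> y = y \<otimes> b" if "y \<in> N" for y
    using comm_gen[OF c(2)] gb(1) maxesD(2)[OF M(2)] that by blast
  define d where "d = inv a \<otimes> inv b \<otimes> a \<otimes> b"
  have d: "d \<in> carrier G" "d \<in> N"
    using commutator_mem_N[of "inv a" "inv b"] c unfolding d_def by simp_all
  have ab: "a \<otimes> b = b \<otimes> a \<otimes> d"
  proof -
    have "b \<otimes> a \<otimes> d = b \<otimes> (a \<otimes> inv a) \<otimes> inv b \<otimes> a \<otimes> b"
      unfolding d_def using c by (simp only: m_assoc m_closed inv_closed)
    then show ?thesis
      using c by simp
  qed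
  have bp: "b [^] p \<in> N" "b [^] p \<in> carrier G"
    using pow_mem_N c by auto
  have "a \<otimes> b [^] p = b [^] p \<otimes> a \<otimes> d [^] p"
    using mult_pow_commutator[OF c d(1) ab Nb[OF d(2)]] .
  moreover have "a \<otimes> b [^] p = b [^] p \<otimes> a"
    using Na bp by blast
  ultimately have "b [^] p \<otimes> a = b [^] p \<otimes> a \<otimes> d [^] p"
    by simp
  then have dp: "d [^] p = \<one>"
    using c(1) d(1) bp(2) r_cancel_one'[of "b [^] p \<otimes> a" "d [^] p"] by simp
  have "b \<notin> M1"
    using maxes_unique[OF M(1,2)] b M(3) by blast
  have "inv (b [^] p) \<in> N"
    using bp subgroup.m_inv_closed[OF N_subgroup] by blast
  then have "inv (b [^] p) \<in> generate G {a} \<inter> N"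
    using ga(1) maxesD(2)[OF M(1)] by blast
  then have "inv (b [^] p) \<in> generate G {a [^] p}"
    using card_generate_Int_N(1)[OF c(1) a(2)] by blast
  then obtain j :: nat where "inv (b [^] p) = (a [^] p) [^] j"
    using mem_generate_iff[OF finite_G, of "a [^] p"] c by auto
  then have "a [^] (j * p) = inv (b [^] p)"
    using c by (simp add: nat_pow_pow mult.commute)
  then have "b [^] p \<otimes> a [^] (j * p) = \<one>"
    using bp by simp
  then show thesis
    using that c d a(2) ga \<open>b \<notin> M1\<close> dp ab Na Nb by blast
qed

text \<open>The element is \<open>c = b \<otimes> a [^] j\<close>. Its \<open>p\<close>-th power is
  \<open>b [^] p \<otimes> a [^] (j * p) = \<one>\<close> times a power of \<open>d\<close> whose
  exponent is a multiple of \<open>p choose 2\<close>, and for odd \<open>p\<close> this is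
  divisible by \<open>p\<close>.\<close>

lemma two_cyclic_maxes_odd:
  assumes M: "M1 \<in> maxes" "M2 \<in> maxes" "M1 \<noteq> M2" and k: "card (cycs M1) = 1" "card (cycs M2) = 1"
    and p: "2 < p"
  obtains a c d where "a \<in> carrier G" "c \<in> carrier G" "d \<in> carrier G" "a \<notin> N"
    "generate G {a} = M1" "ord a = p ^ (n + 1)" "c \<notin> M1" "c [^] p = \<one>"
    "d \<in> N" "a \<otimes> c = c \<otimes> a \<otimes> d" "c \<otimes> d = d \<otimes> c"
proof -
  obtain a b d j where c: "a \<in> carrier G" "b \<in> carrier G" "d \<in> carrier G" and "a \<notin> N"
    and ga: "generate G {a} = M1" "ord a = p ^ (n + 1)" and b: "b \<notin> M1"
    and d: "d \<in> N" "d [^] p = \<one>" and ab: "a \<otimes> b = b \<otimes> a \<otimes> d"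
    and Na: "\<And>y. y \<in> N \<Longrightarrow> a \<otimes> y = y \<otimes> a" and Nb: "\<And>y. y \<in> N \<Longrightarrow> b \<otimes> y = y \<otimes> b"
    and j: "b [^] p \<otimes> a [^] (j * p) = \<one>"
    using two_cyclic_maxes[OF M k] by blast
  let ?c = "b \<otimes> a [^] j"
  have ad: "a \<otimes> d = d \<otimes> a" "b \<otimes> d = d \<otimes> b"
    using Na Nb d by auto
  have dN: "d [^] j \<in> N"
    using d subgroup_nat_pow_closed[OF N_subgroup] by blast
  have aj: "a [^] j \<otimes> y = y \<otimes> a [^] j" if "y \<in> N" for y
    using nat_pow_commute[of a y j] c Na[OF that] that N_subset by auto
  have "?c [^] p = b [^] p \<otimes> (a [^] j) [^] p \<otimes> (d [^] j) [^] (p choose 2)"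
    using c pow_mult_commutator[OF c ab ad(1), of j] aj[OF dN] Nb[OF dN]
    by (intro pow_mult_class_two) auto
  moreover have "b [^] p \<otimes> (a [^] j) [^] p = \<one>"
    using j c by (simp add: nat_pow_pow)
  moreover have "(d [^] j) [^] (p choose 2) = \<one>"
  proof -
    have "p dvd p choose 2"
      using dvd_choose_prime[of 2 p] p prime by simp
    then obtain q where "p choose 2 = p * q" ..
    then have "(d [^] j) [^] (p choose 2) = (d [^] p) [^] (j * q)"
      using c by (simp add: nat_pow_pow ac_simps)
    then show ?thesis
      using d by simp
  qed
  ultimately have "?c [^] p = \<one>"
    by simp
  moreover have "a [^] j \<in> M1"
    using ga(1) pow_mem_generate[OF c(1)] by blast
  then have "?c \<notin> M1"
    using subgroup_mult_right_iff[OF maxesD(1)[OF M(1)] c(2)] b by blast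
  moreover have "a \<otimes> ?c = ?c \<otimes> a \<otimes> d"
    using mult_pow_shift[OF c ab ad(1)] .
  moreover have "?c \<otimes> d = d \<otimes> ?c"
  proof -
    have "?c \<otimes> d = (b \<otimes> d) \<otimes> a [^] j"
      using c aj[OF d(1)] by (simp add: m_assoc)
    then show ?thesis
      using c ad by (simp add: m_assoc)
  qed
  ultimately show thesis
    using that[of a ?c d] c \<open>a \<notin> N\<close> ga d by blast
qed

lemma sum_card_cycs_ge:
  fixes S defines "S \<equiv> {M\<in>maxes. card (cycs M) = 1}"
  shows "card S + p * (p + 1 - card S) \<le> (\<Sum>M\<in>maxes. card (cycs M))"
proof -
  have fin: "finite S" "S \<subseteq> maxes"
    using finite_maxes unfolding S_def by auto
  have "(\<Sum>M\<in>maxes. card (cycs M)) = (\<Sum>M\<in>maxes - S. card (cycs M)) + (\<Sum>M\<in>S. card (cycs M))"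
    by (rule sum.subset_diff[OF fin(2) finite_maxes])
  moreover have "(\<Sum>M\<in>S. card (cycs M)) = card S"
    unfolding S_def by simp
  moreover have "(\<Sum>M\<in>maxes - S. p) \<le> (\<Sum>M\<in>maxes - S. card (cycs M))"
    using card_cycs_ne_1(2) unfolding S_def by (intro sum_mono) auto
  moreover have "card (maxes - S) = p + 1 - card S"
    using card_Diff_subset[OF fin] card_maxes by simp
  ultimately show ?thesis
    by (simp add: mult.commute)
qed

lemma odd_classification:
  assumes six: "card (max_cyclic G) = 6" and p: "2 < p"
  shows "p = 5 \<and> split_metacyclic 5 5 1 \<or>
    p = 3 \<and> (split_metacyclic 9 3 1 \<or> split_metacyclic 9 3 4)"
proof -
  define S where "S = {M\<in>maxes. card (cycs M) = 1}"
  have S: "finite S" "S \<subseteq> maxes"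
    using finite_maxes unfolding S_def by auto
  have le: "card S + p * (p + 1 - card S) \<le> 6"
    using sum_card_cycs_ge sum_card_cycs_le six unfolding S_def by linarith
  have cS: "card S \<le> p + 1"
    using card_mono[OF finite_maxes S(2)] card_maxes by simp
  have p1: "p + 1 \<le> 6"
  proof -
    have "p + 1 = card S + (p + 1 - card S)"
      using cS by simp
    also have "\<dots> \<le> card S + p * (p + 1 - card S)"
      using p by simp
    finally show ?thesis
      using le by simp
  qed
  moreover have "p \<noteq> 4"
    using prime by auto
  ultimately have p35: "p = 3 \<or> p = 5"
    using p by auto
  \<comment> \<open>With \<open>s = card S\<close>, the bound
    \<open>s + p * (p + 1 - s) \<le> 6\<close> gives \<open>s \<ge> 3\<close> for
    \<open>p = 3\<close> and \<open>s = 6\<close> for \<open>p = 5\<close>.\<close>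
  then have S3: "3 \<le> card S" and S6: "p = 5 \<Longrightarrow> card S = 6"
    using le cS by auto
  obtain M1 M2 where M: "M1 \<in> S" "M2 \<in> S" "M1 \<noteq> M2"
  proof -
    have "\<not> card S \<le> Suc 0"
      using S3 by simp
    then show thesis
      using that card_le_Suc0_iff_eq[OF S(1)] by blast
  qed
  then have M': "M1 \<in> maxes" "M2 \<in> maxes" "card (cycs M1) = 1" "card (cycs M2) = 1"
    unfolding S_def by auto
  obtain a c d where c: "a \<in> carrier G" "c \<in> carrier G" "d \<in> carrier G" and a: "a \<notin> N"
    and ga: "generate G {a} = M1" "ord a = p ^ (n + 1)" and cM: "c \<notin> M1" and cp: "c [^] p = \<one>"
    and d: "d \<in> N" and ac: "a \<otimes> c = c \<otimes> a \<otimes> d" and cd: "c \<otimes> d = d \<otimes> c"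
    using two_cyclic_maxes_odd[OF M'(1,2) M(3) M'(3,4) p] by blast
  have sum: "(\<Sum>M\<in>maxes. card (cycs M)) = 6"
    using sum_card_cycs_eq[OF M'(1,3)] six by simp
  have cN: "c \<notin> N"
    using cM maxesD(2)[OF M'(1)] by blast
  then have oc: "ord c = p"
    using ord_eq_prime[OF c(2) _ cp prime] subgroup.one_closed[OF N_subgroup] by blast
  obtain M where Mc: "M \<in> maxes" "c \<in> M"
    using ex_maxes[OF c(2) cN] by blast
  \<comment> \<open>The group \<open>M\<close> containing \<open>c\<close> is decisive:
    \<open>c\<close> has order \<open>p\<close>, while in a cyclic \<open>M\<close> the elements
    outside \<open>N\<close> have order \<open>p ^ (n + 1)\<close>.\<close>
  have n0: "n = 0" if "card (cycs M) = 1"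
  proof -
    have "p ^ (n + 1) = p ^ 1"
      using cyclic_maxes(2)[OF Mc(1) that Mc(2) cN] oc by (simp only: power_one_right)
    then have "n + 1 = 1"
      using power_inject_exp[OF prime_gt_1_nat[OF prime]] by blast
    then show ?thesis
      by simp
  qed
  show ?thesis
  proof (cases "p = 5")
    case True
    \<comment> \<open>All six groups above \<open>N\<close> are cyclic, among them the one
      containing \<open>c\<close>, so \<open>n = 0\<close> and \<open>order G = 25\<close>.\<close>
    then have "S = maxes"
      using card_subset_eq[OF finite_maxes S(2)] S6 card_maxes by simp
    then have n: "n = 0"
      using n0 Mc unfolding S_def by blast
    then have "card N = 1"
      using card_N by simp
    then have "d = \<one>"
      using d subgroup.one_closed[OF N_subgroup] by (metis card_1_singletonE singletonD)
    then have "split_metacyclic 5 5 1"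
      using c ga cM cp ac order_G n True prime
      by (intro split_metacyclicI[OF finite_G, of 5 a c]) auto
    then show ?thesis
      using True by blast
  next
    case False
    then have p3: "p = 3"
      using p35 by blast
    \<comment> \<open>For \<open>n = 0\<close> the four groups would have prime order and be cyclic,
      and the total would be 4 instead of 6.\<close>
    have "n \<noteq> 0"
    proof
      assume n: "n = 0"
      have "card (cycs M) = 1" if L: "M \<in> maxes" for M
      proof (rule ccontr)
        assume ne: "card (cycs M) \<noteq> 1"
        obtain C where C: "C \<in> cycs M"
          using cycs_nonempty[OF L] by blast
        then obtain k where "k \<ge> 1" "card C = p ^ k"
          using card_cycs_member[OF L] by blast
        then have "p \<le> card C"
          using prime_gt_0_nat[OF prime] self_le_power[of p k] by simp
        then show False
          using card_cycs_ne_1(1)[OF L ne C] n p3 by simp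
      qed
      then show False
        using sum card_maxes p3 by simp
    qed
    then have "card (cycs M) \<noteq> 1"
      using n0 by blast
    \<comment> \<open>The other three groups use up at least 3 of the 6. Not being cyclic,
      \<open>M\<close> then has exactly three cyclic groups, each of order \<open>3 ^ n\<close>. One
      of them is generated by \<open>c\<close>, so \<open>n = 1\<close> and
      \<open>order G = 27\<close>.\<close>
    moreover have "card (cycs M) \<le> 3"
    proof -
      have "(\<Sum>L\<in>maxes - {M}. 1) \<le> (\<Sum>L\<in>maxes - {M}. card (cycs L))"
        using card_cycs_pos by (intro sum_mono) auto
      moreover have "card (maxes - {M}) = 3"
        using card_maxes p3 Mc finite_maxes by simp
      ultimately have "3 \<le> (\<Sum>L\<in>maxes - {M}. card (cycs L))"
        by simp
      then show ?thesis
        using sum sum.remove[OF finite_maxes Mc(1), of "\<lambda>L. card (cycs L)"] by simp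
    qed
    moreover have "p \<le> card (cycs M)"
      using card_cycs_ne_1(2)[OF Mc(1)] calculation(1) by blast
    ultimately have "card (generate G {c}) = p ^ n"
      using card_cycs_ne_1(3)[OF Mc(1)] Mc cN p3 unfolding cycs_def by simp
    then have "p ^ n = p ^ 1"
      using generate_pow_card[OF c(2)] oc by simp
    then have n: "n = 1"
      using power_inject_exp[OF prime_gt_1_nat[OF prime]] by blast
    have "d \<in> generate G {a [^] p}"
      using card_generate_Int_N(1)[OF c(1) a] d ga(1) maxesD(2)[OF M'(1)] by blast
    then obtain i :: nat where "d = (a [^] p) [^] i"
      using mem_generate_iff[OF finite_G, of "a [^] p"] c by auto
    then have di: "d = a [^] (3 * i)"
      using c p3 by (simp add: nat_pow_pow)
    have oa: "ord a = 9"
      using ga n p3 by simp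
    then have a9: "a [^] (9::nat) = \<one>"
      using c pow_ord_eq_1 by metis
    have i3: "a \<otimes> d = a [^] (1 + 3 * i)"
      using di c nat_pow_mult[OF c(1), of 1 "3 * i"] by simp
    \<comment> \<open>\<open>c\<close> conjugates \<open>a\<close> to its power with exponent 1, 4
      or 7 modulo 9. The last two describe the same group: \<open>7 * 7\<close> is 4 modulo 9, so in
      the third case \<open>c\<close> is replaced by its square.\<close>
    consider "i mod 3 = 0" | "i mod 3 = 1" | "i mod 3 = 2"
      by linarith
    then show ?thesis
    proof cases
      case 1
      then have "(1 + 3 * i) mod 9 = 1"
        by presburger
      then have "a \<otimes> c = c \<otimes> a [^] (1::nat)"
        using ac c i3 nat_pow_mod[OF c(1) a9, of "1 + 3 * i"] by (simp add: m_assoc)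
      then have "split_metacyclic 9 3 1"
        using c ga cM cp order_G n p3 prime oa
        by (intro split_metacyclicI[OF finite_G, of 3 a c]) auto
      then show ?thesis
        using p3 by blast
    next
      case 2
      then have "(1 + 3 * i) mod 9 = 4"
        by presburger
      then have "a \<otimes> c = c \<otimes> a [^] (4::nat)"
        using ac c i3 nat_pow_mod[OF c(1) a9, of "1 + 3 * i"] by (simp add: m_assoc)
      then have "split_metacyclic 9 3 4"
        using c ga cM cp order_G n p3 prime oa
        by (intro split_metacyclicI[OF finite_G, of 3 a c]) auto
      then show ?thesis
        using p3 by blast
    next
      case 3
      let ?e = "c [^] (2::nat)"
      have "(1 + 3 * i * 2) mod 9 = 4"
        using 3 by presburger
      moreover have "a \<otimes> ?e = ?e \<otimes> a \<otimes> d [^] (2::nat)"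
        using mult_pow_commutator[OF c ac cd] .
      moreover have "a \<otimes> d [^] (2::nat) = a [^] (1 + 3 * i * 2)"
        unfolding di using c nat_pow_mult[OF c(1), of 1 "3 * i * 2"] by (simp add: nat_pow_pow)
      ultimately have "a \<otimes> ?e = ?e \<otimes> a [^] (4::nat)"
        using c nat_pow_mod[OF c(1) a9, of "1 + 3 * i * 2"] by (simp add: m_assoc)
      moreover have "?e \<notin> M1"
      proof
        assume "?e \<in> M1"
        moreover have "?e \<otimes> c = \<one>"
          using cp p3 c by (simp add: numeral_3_eq_3 numeral_2_eq_2)
        ultimately show False
          using subgroup_mult_left_iff[OF maxesD(1)[OF M'(1)] _ c(2), of ?e] cM
            subgroup.one_closed[OF maxesD(1)[OF M'(1)]] by simp
      qed
      moreover have "?e [^] (3::nat) = \<one>"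
        using nat_pow_pow[OF c(2), of 2 3] nat_pow_pow[OF c(2), of 3 2] cp p3 by simp
      ultimately have "split_metacyclic 9 3 4"
        using c ga order_G n p3 prime oa
        by (intro split_metacyclicI[OF finite_G, of 3 a ?e]) auto
      then show ?thesis
        using p3 by blast
    qed
  qed
qed

end

section \<open>The prime two\<close>

lemma one_plus_power_two:
  assumes "1 + 2 ^ y = (2::nat) ^ m"
  shows "y = 0 \<and> m = 1"
proof (cases y)
  case 0
  then have "(2::nat) ^ m = 2 ^ 1"
    using assms by simp
  then show ?thesis
    using 0 power_inject_exp[of "2::nat" m 1] by simp
next
  case (Suc y')
  then have "odd ((2::nat) ^ m)"
    unfolding assms[symmetric] by simp
  then have "m = 0"
    by simp
  then show ?thesis
    using assms by simp
qed

text \<open>Repeated halving and parity; the solutions are \<open>4 + 2 + 2 = 8\<close> and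
  \<open>4 + 4 + 8 = 16\<close>. In the distribution 1, 1, 4 two of the four cyclic groups have
  order 2, and \<open>2 ^ x\<close> and \<open>2 ^ y\<close> are the orders of the other
  two.\<close>

lemma four_powers_of_two:
  assumes "4 + 2 ^ x + 2 ^ y = (2::nat) ^ (n + 1)" "1 \<le> x" "1 \<le> y"
  shows "n = 3 \<or> n = 2 \<and> x = 1 \<and> y = 1"
proof -
  obtain x' y' where xy: "x = Suc x'" "y = Suc y'"
    using assms by (metis One_nat_def Suc_le_D)
  have eq: "2 + 2 ^ x' + 2 ^ y' = (2::nat) ^ n"
    using assms(1) unfolding xy by simp
  then have "even ((2::nat) ^ n)"
    by (cases n) auto
  then have par: "even ((2::nat) ^ x') \<longleftrightarrow> even ((2::nat) ^ y')"
    using eq by (metis even_add even_numeral)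
  show ?thesis
  proof (cases x')
    case 0
    then have "y' = 0"
      using par by (cases y') auto
    then have "(2::nat) ^ n = 2 ^ 2"
      using eq 0 by simp
    then show ?thesis
      using 0 \<open>y' = 0\<close> xy power_inject_exp[of "2::nat" n 2] by simp
  next
    case (Suc u)
    then obtain v where v: "y' = Suc v"
      using par by (cases y') auto
    obtain m where m: "n = Suc m"
      using eq Suc by (cases n) auto
    have eq': "1 + 2 ^ u + 2 ^ v = (2::nat) ^ m"
      using eq unfolding Suc v m by simp
    have *: "n = 3" if st: "1 + 2 ^ s + 2 ^ t = (2::nat) ^ m" "s = 0" for s t
    proof -
      obtain t' where t': "t = Suc t'"
      proof (cases t)
        case 0
        then have "(3::nat) = 2 ^ m"
          using st 0 by simp
        moreover have "odd (3::nat)"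
          by simp
        ultimately have "odd ((2::nat) ^ m)"
          by metis
        then have "m = 0"
          by simp
        then show ?thesis
          using st(1) by simp
      qed
      obtain m' where m': "m = Suc m'"
        using st(1) by (cases m) auto
      have "1 + 2 ^ t' = (2::nat) ^ m'"
        using that unfolding t' m' by simp
      then show ?thesis
        using one_plus_power_two m m' by simp
    qed
    have "u = 0 \<or> v = 0"
    proof (rule ccontr)
      assume "\<not> (u = 0 \<or> v = 0)"
      then have "odd ((2::nat) ^ m)"
        unfolding eq'[symmetric] by simp
      then have "m = 0"
        by simp
      then show False
        using eq' by simp
    qed
    moreover have "1 + 2 ^ v + 2 ^ u = (2::nat) ^ m"
      using eq' by simp
    ultimately show ?thesis
      using *[OF eq'] *[of v u] by blast
  qed
qed

context p_group_over
begin

text \<open>For \<open>p = 2\<close> the corrected element \<open>b \<otimes> a [^] j\<close> has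
  square \<open>d [^] j\<close>, which need not be trivial. Once \<open>2 \<le> n\<close>,
  \<open>d\<close> is a power of \<open>a [^] 4\<close> and a further power of \<open>a\<close>
  removes it; this bound keeps the quaternion group out. The resulting involution lies in
  \<open>M3\<close>, and the orders of the four cyclic groups there force
  \<open>n = 3\<close>.\<close>

lemma two_classification_1_1_4:
  assumes p2: "p = 2" and M: "maxes = {M1, M2, M3}" "M1 \<noteq> M2"
    and k: "card (cycs M1) = 1" "card (cycs M2) = 1" "card (cycs M3) = 4"
  shows "split_metacyclic 16 2 1 \<or> split_metacyclic 16 2 9"
proof -
  have M': "M1 \<in> maxes" "M2 \<in> maxes" "M3 \<in> maxes"
    using M by auto
  obtain a b d and j :: nat where c: "a \<in> carrier G" "b \<in> carrier G" "d \<in> carrier G" and "a \<notin> N"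
    and ga: "generate G {a} = M1" and oa: "ord a = 2 ^ (n + 1)" and b: "b \<notin> M1"
    and d: "d \<in> N" "d [^] (2::nat) = \<one>" and ab: "a \<otimes> b = b \<otimes> a \<otimes> d"
    and Na: "\<And>y. y \<in> N \<Longrightarrow> a \<otimes> y = y \<otimes> a" and Nb: "\<And>y. y \<in> N \<Longrightarrow> b \<otimes> y = y \<otimes> b"
    and j: "b [^] (2::nat) \<otimes> a [^] (j * 2) = \<one>"
  proof (rule two_cyclic_maxes[OF M'(1,2) M(2) k(1,2), unfolded p2], goal_cases)
    case (1 a b d j)
    show ?case
      by (rule that) (fact 1)+
  qed
  have card2: "2 \<le> card C" if "C \<in> cycs M3" for C
    using card_cycs_member[OF M'(3) that] self_le_power[of "2::nat"] unfolding p2 by auto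
  \<comment> \<open>Four orders, each at least 2, add up to \<open>2 ^ (n + 1)\<close>, whence
    \<open>2 \<le> n\<close>.\<close>
  have "(\<Sum>C\<in>cycs M3. 2) \<le> (\<Sum>C\<in>cycs M3. card C)"
    using card2 by (intro sum_mono)
  then have "8 \<le> (2::nat) ^ (n + 1)"
    using sum_card_cycs[OF M'(3)] k(3) p2 by simp
  then have "2 \<le> n"
    by (cases "n = 0 \<or> n = 1") auto
  then obtain m where m: "n = Suc (Suc m)"
    using that[of "n - 2"] by simp
  obtain i :: nat where i: "d = a [^] i"
    using mem_generate_iff[OF finite_G c(1)] ga maxesD(2)[OF M'(1)] d(1) by blast
  \<comment> \<open>\<open>d\<close> has order at most 2 in a cyclic group of order
    \<open>2 ^ (n + 1)\<close>, so its exponent is a multiple of \<open>2 ^ n\<close>, in particular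
    of 4.\<close>
  have "a [^] (i * 2) = \<one>"
    using d(2) i c by (simp add: nat_pow_pow)
  then have "2 ^ (n + 1) dvd i * 2"
    using pow_eq_id[OF c(1)] oa by simp
  then have "2 ^ n dvd i"
    by simp
  then obtain h where h: "i = 2 ^ n * h" ..
  define e where "e = 2 ^ m * h"
  have i4: "i = 4 * e"
    using h m e_def by simp
  \<comment> \<open>The summand \<open>2 * e * j\<close> becomes \<open>4 * e * j = i * j\<close>
    under squaring and contributes \<open>d [^] j\<close>, which cancels the stray
    \<open>d [^] j\<close>. Being even, it does not alter the power of \<open>d\<close> in the
    class-two formula.\<close>
  define j' where "j' = j + 2 * e * j"
  define f where "f = b \<otimes> a [^] j'"
  have f: "f \<in> carrier G"
    using c f_def by simp
  have pow_d: "d [^] (2 * l) = \<one>" for l :: nat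
    using d(2) c nat_pow_pow[of d 2 l] by simp
  have aj: "a [^] l \<otimes> y = y \<otimes> a [^] l" if "y \<in> N" for y and l :: nat
    using nat_pow_commute[of a y l] c Na[OF that] that N_subset by auto
  have dN: "d [^] l \<in> N" for l :: nat
    using d subgroup_nat_pow_closed[OF N_subgroup] by blast
  have f2: "f [^] (2::nat) = \<one>"
  proof -
    have "f [^] (2::nat) = b [^] (2::nat) \<otimes> (a [^] j') [^] (2::nat) \<otimes> (d [^] j') [^] ((2::nat) choose 2)"
      unfolding f_def using c pow_mult_commutator[OF c ab Na[OF d(1)], of j'] aj[OF dN] Nb[OF dN]
      by (intro pow_mult_class_two) auto
    also have "(a [^] j') [^] (2::nat) = a [^] (j * 2) \<otimes> d [^] j"
    proof -
      have "j' * 2 = j * 2 + i * j"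
        unfolding i4 j'_def by simp
      then show ?thesis
        unfolding i using c by (simp add: nat_pow_pow nat_pow_mult)
    qed
    also have "(d [^] j') [^] ((2::nat) choose 2) = d [^] j"
    proof -
      have "d [^] j' = d [^] j \<otimes> d [^] (2 * (e * j))"
        using c by (simp add: nat_pow_mult j'_def mult.assoc)
      then show ?thesis
        using c pow_d by simp
    qed
    also have "b [^] (2::nat) \<otimes> (a [^] (j * 2) \<otimes> d [^] j) \<otimes> d [^] j
      = (b [^] (2::nat) \<otimes> a [^] (j * 2)) \<otimes> (d [^] j \<otimes> d [^] j)"
      using c by (simp add: m_assoc)
    also have "d [^] j \<otimes> d [^] j = d [^] (2 * j)"
      using c by (simp add: nat_pow_mult mult_2)
    finally show ?thesis
      using j pow_d by simp
  qed
  have "a [^] j' \<in> M1"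
    using ga pow_mem_generate[OF c(1)] by blast
  then have f1: "f \<notin> M1"
    unfolding f_def using subgroup_mult_right_iff[OF maxesD(1)[OF M'(1)] c(2)] b by blast
  have fN: "f \<notin> N"
    using f1 maxesD(2)[OF M'(1)] by blast
  have of: "ord f = 2"
    using ord_eq_prime[OF f _ f2] fN subgroup.one_closed[OF N_subgroup] by auto
  \<comment> \<open>Outside \<open>N\<close> the cyclic group \<open>M2\<close> has only elements of
    order \<open>2 ^ (n + 1)\<close>, at least 8, so the involution \<open>f\<close> must sit in
    \<open>M3\<close>.\<close>
  have "f \<notin> M2"
  proof
    assume "f \<in> M2"
    then have "ord f = 2 ^ (n + 1)"
      using cyclic_maxes(2)[OF M'(2) k(2) _ fN] p2 by blast
    then show False
      using of m by simp
  qed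
  then have f3: "f \<in> M3"
    using ex_maxes[OF f fN] f1 M(1) by blast
  have Nf: "f \<otimes> y = y \<otimes> f" if "y \<in> N" for y
  proof -
    have y: "y \<in> carrier G"
      using that N_subset by blast
    have "f \<otimes> y = b \<otimes> y \<otimes> a [^] j'"
      unfolding f_def using c y aj[OF that] by (simp add: m_assoc)
    then show ?thesis
      unfolding f_def using c y Nb[OF that] by (simp add: m_assoc)
  qed
  \<comment> \<open>The involution of \<open>generate G {a}\<close>. It lies in \<open>N\<close> and
    commutes with \<open>f\<close>, so \<open>f \<otimes> z\<close> yields a second cyclic group of
    order 2 in \<open>M3\<close>, and only two orders remain unknown.\<close>
  define z where "z = a [^] ((2::nat) ^ n)"
  have z: "z \<in> carrier G" "z \<in> N" "z \<noteq> \<one>" "z [^] (2::nat) = \<one>"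
  proof -
    show "z \<in> carrier G"
      using c z_def by simp
    show "z \<in> N"
      unfolding z_def pow_mem_N_iff[OF c(1) \<open>a \<notin> N\<close>] p2 m by simp
    show "z \<noteq> \<one>"
      unfolding z_def pow_eq_id[OF c(1)] oa by (simp add: power_dvd_imp_le)
    show "z [^] (2::nat) = \<one>"
      unfolding z_def nat_pow_pow[OF c(1)] pow_eq_id[OF c(1)] oa by simp
  qed
  have fz: "f \<otimes> z \<in> M3" "f \<otimes> z \<notin> N" "f \<otimes> z \<in> carrier G"
    using f3 z maxesD[OF M'(3)] f subgroup.m_closed[OF maxesD(1)[OF M'(3)]]
      subgroup_mult_right_iff[OF N_subgroup f z(2)] fN by auto
  have fz2: "(f \<otimes> z) [^] (2::nat) = \<one>"
    using pow_mult_distrib[OF Nf[OF z(2)] f z(1), of 2] f2 z(4) by simp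
  have ofz: "ord (f \<otimes> z) = 2"
    using ord_eq_prime[OF fz(3) _ fz2 two_is_prime_nat] fz(2) subgroup.one_closed[OF N_subgroup] by metis
  let ?A = "generate G {f}" and ?B = "generate G {f \<otimes> z}"
  have AB: "?A \<in> cycs M3" "?B \<in> cycs M3"
    using f3 fN fz unfolding cycs_def by auto
  have cAB: "card ?A = 2" "card ?B = 2"
    using generate_pow_card f fz(3) of ofz by metis+
  have "?A \<noteq> ?B"
  proof
    assume "?A = ?B"
    then have "f \<otimes> z \<in> ?A"
      using generate_singleton_mem by blast
    then have "z \<in> ?A"
      using subgroup_mult_left_iff[OF generate_is_subgroup generate_singleton_mem z(1)] f by blast
    moreover have "z \<in> M1"
      using z(2) maxesD(2)[OF M'(1)] by blast
    ultimately show False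
      using generate_Int_prime_ord[OF maxesD(1)[OF M'(1)] f f1 f2 _ finite_G] z(3) by auto
  qed
  then have "card (cycs M3 - {?A, ?B}) = 2"
    using AB k(3) finite_cycs[OF M'(3)] by (simp add: card_Diff_subset)
  then obtain U V where UV: "cycs M3 - {?A, ?B} = {U, V}" "U \<noteq> V"
    using card_2_iff by metis
  have cyc: "cycs M3 = {?A, ?B, U, V}"
    using UV AB by blast
  obtain x y where xy: "1 \<le> x" "card U = 2 ^ x" "1 \<le> y" "card V = 2 ^ y"
    using card_cycs_member[OF M'(3)] cyc p2 by (metis insertI1 insertI2)
  have "U \<noteq> ?A" "U \<noteq> ?B" "V \<noteq> ?A" "V \<noteq> ?B"
    using UV by blast+
  then have "(\<Sum>C\<in>cycs M3. card C) = 4 + 2 ^ x + 2 ^ y"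
    unfolding cyc using UV(2) \<open>?A \<noteq> ?B\<close> cAB xy by auto
  then have "4 + 2 ^ x + 2 ^ y = (2::nat) ^ (n + 1)"
    using sum_card_cycs[OF M'(3)] p2 by simp
  then have "n = 3 \<or> n = 2 \<and> x = 1 \<and> y = 1"
    using xy by (intro four_powers_of_two)
  then show ?thesis
  proof
    \<comment> \<open>Now all four cyclic groups have order 2, but
      \<open>f \<otimes> a [^] 2\<close> has square \<open>a [^] 4\<close>, which is not trivial
      since \<open>ord a = 8\<close>.\<close>
    assume n: "n = 2 \<and> x = 1 \<and> y = 1"
    have a2: "a [^] (2::nat) \<in> N" "a [^] (2::nat) \<in> carrier G"
      using pow_mem_N[OF c(1)] c p2 by auto
    then have fa: "f \<otimes> a [^] (2::nat) \<in> M3" "f \<otimes> a [^] (2::nat) \<notin> N" "f \<otimes> a [^] (2::nat) \<in> carrier G"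
      using f3 maxesD[OF M'(3)] f subgroup.m_closed[OF maxesD(1)[OF M'(3)]]
        subgroup_mult_right_iff[OF N_subgroup f a2(1)] fN by auto
    then have "generate G {f \<otimes> a [^] (2::nat)} \<in> cycs M3"
      unfolding cycs_def by blast
    then have "card (generate G {f \<otimes> a [^] (2::nat)}) = 2"
      using cyc cAB xy n by auto
    then have "ord (f \<otimes> a [^] (2::nat)) = 2"
      using generate_pow_card[OF fa(3)] by simp
    then have "(f \<otimes> a [^] (2::nat)) [^] (2::nat) = \<one>"
      using pow_ord_eq_1[OF fa(3)] by simp
    then have "a [^] (4::nat) = \<one>"
      using pow_mult_distrib[OF Nf[OF a2(1)] f a2(2), of 2] f2 c by (simp add: nat_pow_pow)
    then have "2 ^ (n + 1) dvd (4::nat)"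
      using pow_eq_id[OF c(1)] oa by simp
    then show ?thesis
      using n by simp
  next
    \<comment> \<open>Here \<open>d = a [^] (8 * h)\<close> and \<open>ord a = 16\<close>, so only
      the parity of \<open>h\<close> matters and the exponent is 1 or 9.\<close>
    assume n: "n = 3"
    have oa': "ord a = 16"
      using oa n by simp
    then have a16: "a [^] (16::nat) = \<one>"
      using pow_ord_eq_1[OF c(1)] by simp
    have "a \<otimes> f = f \<otimes> (a \<otimes> d)"
      unfolding f_def using mult_pow_shift[OF c ab Na[OF d(1)]] c by (simp add: m_assoc)
    also have "a \<otimes> d = a [^] (1 + 8 * h)"
      unfolding i h n using c nat_pow_mult[OF c(1), of 1 "8 * h"] by simp
    also have "\<dots> = a [^] ((1 + 8 * h) mod 16)"
      by (rule nat_pow_mod[OF c(1) a16])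
    finally have af: "a \<otimes> f = f \<otimes> a [^] ((1 + 8 * h) mod 16)" .
    have split: "split_metacyclic 16 2 r" if "a \<otimes> f = f \<otimes> a [^] r" for r
      using that c f ga f1 f2 order_G n p2 oa'
      by (intro split_metacyclicI[OF finite_G, of 2 a f]) auto
    have "(1 + 8 * h) mod 16 = 1 \<or> (1 + 8 * h) mod 16 = 9"
      by presburger
    then show ?thesis
      using split af by auto
  qed
qed

text \<open>Write \<open>b [^] 2 = a [^] t\<close> and let \<open>b\<close> conjugate
  \<open>a\<close> to \<open>a [^] r\<close>. The orders in \<open>M2\<close> determine
  \<open>t\<close> modulo 8 and \<open>r\<close> modulo 4. As \<open>b\<close> commutes with its
  square, this forces \<open>n = 2\<close>. Then all elements of \<open>M3 - N\<close> have the same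
  square, so the three cyclic groups have equal orders, and their sum cannot be a power of
  2.\<close>

lemma two_classification_1_2_3:
  assumes p2: "p = 2" and M: "maxes = {M1, M2, M3}" "M1 \<noteq> M2" "M1 \<noteq> M3" "M2 \<noteq> M3"
    and k: "card (cycs M1) = 1" "card (cycs M2) = 2" "card (cycs M3) = 3"
  shows False
proof -
  have M': "M1 \<in> maxes" "M2 \<in> maxes" "M3 \<in> maxes"
    using M by auto
  obtain a where a: "a \<in> M1" "a \<notin> N"
    using maxes_diff_nonempty[OF M'(1)] by blast
  obtain b where b: "b \<in> M2" "b \<notin> N"
    using maxes_diff_nonempty[OF M'(2)] by blast
  have c: "a \<in> carrier G" "b \<in> carrier G"
    using a b maxesD(4) M' by auto
  have ga: "generate G {a} = M1" and oa: "ord a = 2 ^ (n + 1)"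
    using cyclic_maxes[OF M'(1) k(1) a] p2 by auto
  have card2: "2 \<le> card C" if "C \<in> cycs M3" for C
    using card_cycs_member[OF M'(3) that] self_le_power[of "2::nat"] unfolding p2 by auto
  have "(\<Sum>C\<in>cycs M3. 2) \<le> (\<Sum>C\<in>cycs M3. card C)"
    using card2 by (intro sum_mono)
  then have "6 \<le> (2::nat) ^ (n + 1)"
    using sum_card_cycs[OF M'(3)] k(3) p2 by simp
  then have "2 \<le> n"
    by (cases "n = 0 \<or> n = 1") auto
  then obtain m where m: "n = Suc (Suc m)"
    using that[of "n - 2"] by simp
  have ord2: "ord x = 2 ^ n" if "x \<in> M2" "x \<notin> N" for x
  proof -
    have "generate G {x} \<in> cycs M2"
      using that unfolding cycs_def by blast
    then have "card (generate G {x}) = 2 ^ n"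
      using card_cycs_ne_1(3)[OF M'(2)] k(2) p2 by simp
    then show ?thesis
      using generate_pow_card maxesD(4)[OF M'(2)] that by (metis subsetD)
  qed
  have b1: "b \<notin> M1"
    using b maxes_unique[OF M'(1,2)] M(2) by blast
  obtain t :: nat where t: "b [^] (2::nat) = a [^] t"
    using pow_mem_N[OF c(2)] maxesD(2)[OF M'(1)] ga mem_generate_iff[OF finite_G c(1)] p2 by blast
  have "inv b \<otimes> a \<otimes> b \<in> M1"
    using conj_mem_maxes[OF M'(1) a(1), of "inv b"] c by simp
  then obtain r :: nat where "inv b \<otimes> a \<otimes> b = a [^] r"
    using ga mem_generate_iff[OF finite_G c(1)] by blast
  then have r: "inv b \<otimes> a \<otimes> inv (inv b) = a [^] r"
    using c by simp
  have ab: "a [^] i \<otimes> b = b \<otimes> a [^] (r * i)" for i :: nat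
  proof -
    have "inv b \<otimes> a [^] i \<otimes> b = a [^] (r * i)"
      using conjugate_nat_pow[of "inv b" a i] c unfolding r by (simp add: nat_pow_pow)
    then have "b \<otimes> a [^] (r * i) = b \<otimes> (inv b \<otimes> a [^] i \<otimes> b)"
      by simp
    also have "\<dots> = a [^] i \<otimes> b"
      using c by (simp flip: m_assoc)
    finally show ?thesis
      by simp
  qed
  \<comment> \<open>Every element outside \<open>M1\<close> has the form
    \<open>b \<otimes> a [^] i\<close>, so this formula gives all squares of such elements as powers
    of \<open>a\<close>.\<close>
  have sq: "(b \<otimes> a [^] i) [^] (2::nat) = a [^] (t + (r + 1) * i)" for i :: nat
  proof -
    have "(b \<otimes> a [^] i) [^] (2::nat) = b \<otimes> (a [^] i \<otimes> b) \<otimes> a [^] i"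
      using c by (simp add: numeral_2_eq_2 m_assoc)
    also have "\<dots> = b [^] (2::nat) \<otimes> (a [^] (r * i) \<otimes> a [^] i)"
      unfolding ab using c by (simp add: numeral_2_eq_2 m_assoc)
    finally show ?thesis
      unfolding t using c by (simp add: nat_pow_mult algebra_simps)
  qed
  \<comment> \<open>An element of order \<open>2 ^ n\<close> has a square of order
    \<open>2 ^ (n - 1)\<close>. In a cyclic group of order \<open>2 ^ (n + 1)\<close> this means an
    exponent divisible by 4 but not by 8.\<close>
  have mod8: "s mod 8 = 4" if "x \<in> M2" "x \<notin> N" "x [^] (2::nat) = a [^] s" for x and s :: nat
  proof -
    have x: "x \<in> carrier G"
      using that maxesD(4)[OF M'(2)] by blast
    have pw: "x [^] (2 * l) = a [^] (s * l)" for l :: nat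
      using nat_pow_pow[OF x, of 2 l] that(3) nat_pow_pow[OF c(1)] by simp
    have "x [^] (2 * 2 ^ Suc m :: nat) = \<one>"
      using pow_eq_id[OF x] ord2[OF that(1,2)] m by simp
    then have "(2::nat) ^ (Suc m + 2) dvd s * 2 ^ Suc m"
      unfolding pw pow_eq_id[OF c(1)] oa m by simp
    then have "4 dvd s"
      unfolding power_add by (simp add: mult.commute)
    have "x [^] (2 * 2 ^ m :: nat) \<noteq> \<one>"
      using pow_eq_id[OF x, of "2 * 2 ^ m"] ord2[OF that(1,2)] m
        dvd_imp_le[of "2 ^ Suc (Suc m)" "2 * 2 ^ m"] by auto
    then have "\<not> (2::nat) ^ (m + 3) dvd s * 2 ^ m"
      unfolding pw pow_eq_id[OF c(1)] oa m by (simp add: numeral_3_eq_3)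
    then have "\<not> 8 dvd s"
      unfolding power_add by (simp add: mult.commute)
    then show ?thesis
      using \<open>4 dvd s\<close> by presburger
  qed
  have t4: "t mod 8 = 4"
    using mod8[OF b t] .
  \<comment> \<open>Comparing the exponents for \<open>b\<close> and
    \<open>b \<otimes> a [^] 2\<close> shows that 8 divides \<open>2 * (r + 1)\<close>.\<close>
  have "b \<otimes> a [^] (2::nat) \<in> M2" "b \<otimes> a [^] (2::nat) \<notin> N"
    using b pow_mem_N[OF c(1)] maxesD(2)[OF M'(2)] subgroup.m_closed[OF maxesD(1)[OF M'(2)]]
      subgroup_mult_right_iff[OF N_subgroup c(2)] p2 by auto
  then have "(t + (r + 1) * 2) mod 8 = 4"
    using mod8[OF _ _ sq] by blast
  moreover have "t + (r + 1) * 2 = 8 * (t div 8) + (2 * r + 6)"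
    using mult_div_mod_eq[of 8 t] t4 by simp
  ultimately have "(2 * r + 6) mod 8 = 4"
    by (simp only: mod_mult_self4)
  then have r4: "r mod 4 = 3"
    by presburger
  \<comment> \<open>\<open>b\<close> commutes with its square, so \<open>2 ^ (n + 1)\<close> divides
    \<open>(r - 1) * t\<close>. The exact power of 2 in that product is 8: one factor 2 from
    \<open>r - 1\<close> and two from \<open>t\<close>.\<close>
  have "a [^] t \<otimes> b = b \<otimes> a [^] t"
    using nat_pow_commute[of b b 2] c t by simp
  then have "a [^] (r * t) = a [^] t"
    using ab c by (metis l_cancel nat_pow_closed)
  then have "a [^] int (r * t) = a [^] int t"
    by (simp only: int_pow_int)
  then have "int (2 ^ (n + 1)) dvd int t - int (r * t)"
    unfolding int_pow_eq[OF c(1)] oa .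
  then have "int (2 ^ (n + 1)) dvd (int r - 1) * int t"
    using dvd_minus_iff[of "int (2 ^ (n + 1))" "int t - int (r * t)"] by (simp add: algebra_simps)
  moreover obtain t' where t': "t = 4 * t'" "odd t'"
  proof -
    have "t = 4 * (2 * (t div 8) + 1)"
      using mult_div_mod_eq[of 8 t] t4 by simp
    then show thesis
      by (rule that) simp
  qed
  moreover obtain r' where r': "int r - 1 = 2 * r'" "odd r'"
  proof -
    obtain q where "r = 4 * q + 3"
      using mult_div_mod_eq[of 4 r] r4 by metis
    then have "int r - 1 = 2 * (2 * int q + 1)"
      by simp
    then show thesis
      by (rule that) simp
  qed
  ultimately have "(8::int) * 2 ^ m dvd 8 * (r' * int t')"
    unfolding m by (simp add: mult_ac)
  then have "(2::int) ^ m dvd r' * int t'"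
    by simp
  moreover have "odd (r' * int t')"
    using t' r' by simp
  ultimately have "m = 0"
    using dvd_trans[of 2 "(2::int) ^ m" "r' * int t'"] by (cases m) auto
  then have n: "n = 2"
    using m by simp
  have a8: "a [^] (8::nat) = \<one>"
    using pow_eq_id[OF c(1)] oa n by simp
  define u where "u = a [^] (t + (r + 1))"
  \<comment> \<open>The elements of \<open>M3 - N\<close> are \<open>b \<otimes> a [^] l\<close>
    with \<open>l\<close> odd, since even powers of \<open>a\<close> lie in \<open>N\<close> and
    lead to \<open>M2\<close>. As 4 divides \<open>r + 1\<close>, the exponent
    \<open>t + (r + 1) * l\<close> is the same modulo 8 for all odd \<open>l\<close>, and
    \<open>ord a = 8\<close>.\<close>
  have sq3: "x [^] (2::nat) = u" if x: "x \<in> M3" "x \<notin> N" for x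
  proof -
    interpret normal M1 G
      using maxes_normal[OF M'(1)] .
    have xc: "x \<in> carrier G"
      using x maxesD(4)[OF M'(3)] by blast
    have x1: "x \<notin> M1"
      using x maxes_unique[OF M'(1,3)] M(3) by blast
    obtain i where i: "i < p" "inv (b [^] i) \<otimes> x \<in> M1"
      using coset_pow_prime_index[OF prime maxes_index[OF M'(1)] c(2) b1 xc] by blast
    have "i \<noteq> 0"
      using i x1 xc by (cases i) auto
    then have "i = 1"
      using i p2 by simp
    then have "inv b \<otimes> x \<in> M1"
      using i c by simp
    then obtain l :: nat where l: "inv b \<otimes> x = a [^] l"
      using ga mem_generate_iff[OF finite_G c(1)] by blast
    have xb: "x = b \<otimes> a [^] l"
      unfolding l[symmetric] using c xc by (simp flip: m_assoc)
    have "odd l"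
    proof
      assume "even l"
      then have "a [^] l \<in> N"
        using pow_mem_N_iff[OF c(1) a(2)] p2 by simp
      then have "x \<in> M2"
        unfolding xb using b maxesD(2)[OF M'(2)] subgroup.m_closed[OF maxesD(1)[OF M'(2)]] by blast
      then show False
        using x maxes_unique[OF M'(2,3)] M(4) by blast
    qed
    then obtain q where "l = 2 * q + 1"
      by (metis oddE)
    moreover obtain r'' where "r = 4 * r'' + 3"
      using r4 by (metis mult_div_mod_eq)
    ultimately have eq: "t + (r + 1) * l = 8 * ((r'' + 1) * q) + (t + (r + 1))"
      by (simp add: algebra_simps)
    have "a [^] (t + (r + 1) * l) = a [^] (8 * ((r'' + 1) * q)) \<otimes> u"
      by (simp only: eq u_def nat_pow_mult[OF c(1)])
    moreover have "a [^] (8 * ((r'' + 1) * q)) = \<one>"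
      using nat_pow_pow[OF c(1), of 8] a8 by (metis nat_pow_one)
    ultimately show ?thesis
      unfolding xb sq using c u_def by simp
  qed
  have "card C = 2 * card (generate G {u})" if C: "C \<in> cycs M3" for C
  proof -
    obtain x where x: "x \<in> M3" "x \<notin> N" "x \<in> carrier G" "C = generate G {x}"
      using cycsE[OF C M'(3)] by metis
    then show ?thesis
      using card_generate_Int_N[OF x(3,2)] sq3[OF x(1,2)] generate_pow_card[OF x(3)] p2 by simp
  qed
  then have "3 * (2 * card (generate G {u})) = 2 ^ (n + 1)"
    using sum_card_cycs[OF M'(3)] k(3) p2 by simp
  then have "3 * (2 * card (generate G {u})) = 8"
    using n by simp
  then show False
    by presburger
qed

end

text \<open>A product of an element of \<open>A - B\<close> and one of \<open>B - A\<close> avoids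
  both subgroups and so falls into \<open>C\<close>. Applied to \<open>a\<close> and to its inverse
  this puts \<open>a \<otimes> b\<close> and \<open>inv a \<otimes> b\<close> into \<open>C\<close>,
  and \<open>a \<otimes> a\<close> is their quotient.\<close>

lemma (in group) three_subgroup_cover:
  assumes sub: "subgroup A G" "subgroup B G" "subgroup C G" "subgroup N G"
    and cov: "N \<subseteq> A \<union> B \<union> C" and a: "a \<in> A" "a \<in> N" "a \<notin> B" and b: "b \<in> B" "b \<in> N" "b \<notin> A"
  shows "a \<otimes> b \<in> C" "a \<otimes> a \<in> C"
proof -
  have c: "a \<in> carrier G" "b \<in> carrier G"
    using a b sub(4) subgroup.subset by blast+
  have *: "x \<otimes> b \<in> C" if x: "x \<in> A" "x \<in> N" "x \<notin> B" for x
  proof -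
    have "x \<in> carrier G"
      using x sub(4) subgroup.subset by blast
    then have "x \<otimes> b \<notin> A" "x \<otimes> b \<notin> B"
      using subgroup_mult_left_iff[OF sub(1) x(1) c(2)] subgroup_mult_right_iff[OF sub(2) _ b(1)] x b
      by auto
    moreover have "x \<otimes> b \<in> N"
      using x b subgroup.m_closed[OF sub(4)] by blast
    ultimately show ?thesis
      using cov by blast
  qed
  show "a \<otimes> b \<in> C"
    using *[OF a] .
  have "inv a \<in> A" "inv a \<in> N"
    using a sub subgroup.m_inv_closed by metis+
  moreover have "inv a \<notin> B"
    using a(3) c subgroup.m_inv_closed[OF sub(2), of "inv a"] by auto
  ultimately have "inv a \<otimes> b \<in> C"
    by (rule *)
  then have "(a \<otimes> b) \<otimes> inv (inv a \<otimes> b) \<in> C"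
    using *[OF a] sub(3) by (simp add: subgroup.m_closed subgroup.m_inv_closed)
  moreover have "(a \<otimes> b) \<otimes> inv (inv a \<otimes> b) = a \<otimes> (b \<otimes> inv b) \<otimes> a"
    using c inv_mult_group[of "inv a" b] by (simp only: m_assoc m_closed inv_closed inv_inv)
  ultimately show "a \<otimes> a \<in> C"
    using c by simp
qed

context p_group_over
begin

text \<open>In each \<open>M\<close> the elements outside \<open>N\<close> have order
  \<open>2 ^ n\<close>, and their squares all generate the same subgroup of \<open>N\<close>, of
  index 2. The three subgroups arising in this way cover \<open>N\<close>, but no two of them do.
  For \<open>n = 2\<close> this makes \<open>N\<close> a Klein four-group and yields commutativity;
  every other \<open>n\<close> is contradictory.\<close>

lemma two_classification_2_2_2:
  assumes p2: "p = 2" and M: "maxes = {M1, M2, M3}" "M1 \<noteq> M2" "M1 \<noteq> M3" "M2 \<noteq> M3"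
    and k: "card (cycs M1) = 2" "card (cycs M2) = 2" "card (cycs M3) = 2"
    and cyc: "(\<Union>M\<in>maxes. cycs M) = max_cyclic G"
  shows "split_metacyclic 4 4 1"
proof -
  have M': "M1 \<in> maxes" "M2 \<in> maxes" "M3 \<in> maxes"
    using M by auto
  have kM: "card (cycs M) = 2" if "M \<in> maxes" for M
    using that k M by auto
  obtain x1 where x1: "x1 \<in> M1" "x1 \<notin> N"
    using maxes_diff_nonempty[OF M'(1)] by blast
  obtain x2 where x2: "x2 \<in> M2" "x2 \<notin> N"
    using maxes_diff_nonempty[OF M'(2)] by blast
  obtain x3 where x3: "x3 \<in> M3" "x3 \<notin> N"
    using maxes_diff_nonempty[OF M'(3)] by blast
  have xc: "x1 \<in> carrier G" "x2 \<in> carrier G" "x3 \<in> carrier G"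
    using x1 x2 x3 maxesD(4) M' by auto
  define D where "D x = generate G {x [^] (2::nat)}" for x
  have pow2: "x [^] (2::nat) = x \<otimes> x" if "x \<in> carrier G" for x
    using that by (simp add: numeral_2_eq_2)
  have ordx: "ord x = 2 ^ n" if "M \<in> maxes" "x \<in> M" "x \<notin> N" for M x
  proof -
    have "generate G {x} \<in> cycs M"
      using that unfolding cycs_def by blast
    then have "card (generate G {x}) = 2 ^ n"
      using card_cycs_ne_1(3)[OF that(1)] kM[OF that(1)] p2 by simp
    then show ?thesis
      using generate_pow_card maxesD(4)[OF that(1)] that by (metis subsetD)
  qed
  have D_Int: "D x = generate G {x} \<inter> N" "ord x = 2 * card (D x)" if "x \<in> carrier G" "x \<notin> N" for x
    using card_generate_Int_N[OF that] p2 unfolding D_def by auto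
  have D_sub: "subgroup (D x) G" if "x \<in> carrier G" for x
    using generate_is_subgroup that unfolding D_def by simp
  have "n \<noteq> 0"
  proof
    assume "n = 0"
    then show False
      using D_Int(2)[OF xc(1) x1(2)] ordx[OF M'(1) x1] by simp
  qed
  then obtain m where m: "n = Suc m"
    by (cases n) auto
  have cardD: "card (D x) = 2 ^ m" if "M \<in> maxes" "x \<in> M" "x \<notin> N" for M x
    using D_Int(2)[of x] that maxesD(4)[OF that(1)] ordx[OF that] m by auto
  \<comment> \<open>Only two cyclic groups meet \<open>M - N\<close>. If \<open>x\<close> and
    \<open>y\<close> generate different ones, then \<open>y \<otimes> x [^] 2\<close>, which is
    outside \<open>N\<close>, lies in one of them. It cannot be that of \<open>x\<close>, so
    \<open>x [^] 2\<close> lies in that of \<open>y\<close>.\<close>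
  have sq_mem: "x [^] (2::nat) \<in> D y" if L: "M \<in> maxes" and x: "x \<in> M" "x \<notin> N" and y: "y \<in> M" "y \<notin> N"
    for M x y
  proof -
    have c: "x \<in> carrier G" "y \<in> carrier G"
      using x y maxesD(4)[OF L] by auto
    have x2N: "x [^] (2::nat) \<in> N" "x [^] (2::nat) \<in> carrier G"
      using pow_mem_N[OF c(1)] p2 c by auto
    have "x [^] (2::nat) \<in> generate G {y}"
    proof (cases "generate G {x} = generate G {y}")
      case True
      then show ?thesis
        using pow_mem_generate[OF c(1)] by blast
    next
      case False
      let ?z = "y \<otimes> x [^] (2::nat)"
      have z: "?z \<in> M" "?z \<notin> N" "?z \<in> carrier G"
        using y x2N maxesD[OF L] subgroup.m_closed[OF maxesD(1)[OF L]]
          subgroup_mult_right_iff[OF N_subgroup c(2) x2N(1)] c by auto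
      have "{generate G {x}, generate G {y}} \<subseteq> cycs M"
        using x y unfolding cycs_def by blast
      moreover have "card {generate G {x}, generate G {y}} = card (cycs M)"
        using False kM[OF L] by simp
      ultimately have "cycs M = {generate G {x}, generate G {y}}"
        using card_subset_eq[OF finite_cycs[OF L]] by blast
      moreover have "generate G {?z} \<in> cycs M"
        using z unfolding cycs_def by blast
      ultimately have "?z \<in> generate G {x} \<or> ?z \<in> generate G {y}"
        using generate_singleton_mem[of ?z] by auto
      then show ?thesis
      proof
        assume "?z \<in> generate G {x}"
        then have "y \<in> generate G {x}"
          using subgroup_mult_right_iff[OF generate_is_subgroup c(2) pow_mem_generate[OF c(1)]] c
          by blast
        then show ?thesis
          using generate_eq_if_not_mem_N[OF c(1) _ y(2)] False by simp
      next
        assume "?z \<in> generate G {y}"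
        then show ?thesis
          using subgroup_mult_left_iff[OF generate_is_subgroup generate_singleton_mem x2N(2)] c by blast
      qed
    qed
    then show ?thesis
      using x2N D_Int(1)[OF c(2) y(2)] by blast
  qed
  have D_eq: "D x = D y" if L: "M \<in> maxes" "x \<in> M" "x \<notin> N" "y \<in> M" "y \<notin> N" for M x y
  proof -
    have "D x \<subseteq> D y"
      using sq_mem[OF L] D_sub[of y] generate_subgroup_incl[of "{x [^] (2::nat)}" "D y"]
        maxesD(4)[OF L(1)] L(4) unfolding D_def by auto
    moreover have "finite (D y)"
      using D_sub maxesD(4)[OF L(1)] L(4) finite_subgroup by blast
    ultimately show ?thesis
      using card_subset_eq[of "D y" "D x"] cardD[OF L(1)] L by simp
  qed
  \<comment> \<open>Here \<open>cyc\<close> enters: since no maximal cyclic subgroup is hidden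
    inside \<open>N\<close>, each element of \<open>N\<close> lies in a cyclic group generated
    outside \<open>N\<close>.\<close>
  have cover: "N \<subseteq> D x1 \<union> D x2 \<union> D x3"
  proof
    fix y assume y: "y \<in> N"
    then obtain C where C: "C \<in> max_cyclic G" "y \<in> C"
      using ex_max_cyclic[OF finite_G] N_subset by blast
    then obtain L where L: "L \<in> maxes" "C \<in> cycs L"
      using cyc by blast
    obtain x where x: "x \<in> L" "x \<notin> N" "x \<in> carrier G" "C = generate G {x}"
      using cycsE[OF L(2,1)] by metis
    have "y \<in> D x"
      using y C x D_Int(1)[OF x(3,2)] by blast
    moreover have "L = M1 \<or> L = M2 \<or> L = M3"
      using L M by blast
    ultimately show "y \<in> D x1 \<union> D x2 \<union> D x3"
      using D_eq[OF L(1) x(1,2)] x1 x2 x3 by blast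
  qed
  have D_N: "D x \<subseteq> N" if "x \<in> carrier G" "x \<notin> N" for x
    using D_Int(1)[OF that] by blast
  \<comment> \<open>Both subgroups have half the order of \<open>N\<close> and share the identity,
    so their union is too small.\<close>
  have not_two: "\<not> N \<subseteq> D x \<union> D y"
    if L: "M \<in> maxes" "x \<in> M" "x \<notin> N" "M' \<in> maxes" "y \<in> M'" "y \<notin> N" for M M' x y
  proof
    assume "N \<subseteq> D x \<union> D y"
    have c: "x \<in> carrier G" "y \<in> carrier G"
      using L maxesD(4) by auto
    have fin: "finite (D x)" "finite (D y)"
      using c D_sub finite_subgroup by auto
    have "\<one> \<in> D x \<inter> D y"
      using c D_sub subgroup.one_closed by blast
    then have "0 < card (D x \<inter> D y)"
      using fin by (auto simp: card_gt_0_iff)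
    moreover have "card N \<le> card (D x \<union> D y)"
      using \<open>N \<subseteq> D x \<union> D y\<close> fin by (intro card_mono) auto
    ultimately show False
      using card_Un_Int[OF fin] cardD[OF L(1-3)] cardD[OF L(4-6)] card_N p2 m by simp
  qed
  have ne: "D x1 \<noteq> D x2" "D x1 \<noteq> D x3" "D x2 \<noteq> D x3"
    using cover not_two[OF M'(1) x1 M'(3) x3] not_two[OF M'(1) x1 M'(2) x2] by auto
  define u v w where "u = x1 [^] (2::nat)" and "v = x2 [^] (2::nat)" and "w = x3 [^] (2::nat)"
  have uvw: "u \<in> carrier G" "v \<in> carrier G" "w \<in> carrier G" "u \<in> N" "v \<in> N" "w \<in> N"
    "u \<in> D x1" "v \<in> D x2" "w \<in> D x3"
    using xc pow_mem_N p2 generate_singleton_mem unfolding u_def v_def w_def D_def by auto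
  have ordu: "ord u = 2 ^ m" "ord v = 2 ^ m" "ord w = 2 ^ m"
    using generate_pow_card[of u] generate_pow_card[of v] generate_pow_card[of w] uvw
      cardD[OF M'(1) x1] cardD[OF M'(2) x2] cardD[OF M'(3) x3]
    unfolding D_def u_def v_def w_def by auto
  have not_mem: "x [^] (2::nat) \<notin> D y" if "D x \<noteq> D y" "card (D x) = card (D y)"
    "x \<in> carrier G" "y \<in> carrier G" for x y
  proof
    assume "x [^] (2::nat) \<in> D y"
    then have "D x \<subseteq> D y"
      using generate_subgroup_incl[of "{x [^] (2::nat)}" "D y"] D_sub[OF that(4)] unfolding D_def by auto
    then show False
      using card_subset_eq[of "D y" "D x"] that finite_subgroup[OF D_sub[OF that(4)]] by blast
  qed
  have nm: "u \<notin> D x2" "u \<notin> D x3" "v \<notin> D x1" "v \<notin> D x3" "w \<notin> D x1" "w \<notin> D x2"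
    unfolding u_def v_def w_def
    by (rule not_mem; simp add: ne ne[symmetric] cardD[OF M'(1) x1] cardD[OF M'(2) x2]
        cardD[OF M'(3) x3] xc)+
  note Ds = D_sub[OF xc(1)] D_sub[OF xc(2)] D_sub[OF xc(3)]
  have uv: "u \<otimes> v \<in> D x3"
    using three_subgroup_cover(1)[OF Ds N_subgroup cover] uvw nm by blast
  \<comment> \<open>Any of the three subgroups can play the part of the third in
    \<open>three_subgroup_cover\<close>, so squares pass from one subgroup into the others.\<close>
  have uu: "u \<otimes> u \<in> D x2"
    using three_subgroup_cover(2)[OF Ds(1,3,2) N_subgroup _ uvw(7,4) nm(2) uvw(9,6) nm(5)] cover by blast
  have vv: "v \<otimes> v \<in> D x1"
    using three_subgroup_cover(2)[OF Ds(2,3,1) N_subgroup _ uvw(8,5) nm(4) uvw(9,6) nm(6)] cover by blast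
  have ww: "w \<otimes> w \<in> D x1"
    using three_subgroup_cover(2)[OF Ds(3,2,1) N_subgroup _ uvw(9,6) nm(6) uvw(8,5) nm(4)] cover by blast
  \<comment> \<open>Conjugates of \<open>x\<close> stay in \<open>M - N\<close>, and all squares
    from there lie in \<open>D x\<close>; hence \<open>D x\<close> is normal in
    \<open>G\<close>.\<close>
  have conjD: "g \<otimes> y \<otimes> inv g \<in> D x" if L: "M \<in> maxes" "x \<in> M" "x \<notin> N" and g: "g \<in> carrier G"
    and y: "y \<in> D x" for M x g y
  proof -
    have c: "x \<in> carrier G"
      using L maxesD(4) by blast
    let ?x = "g \<otimes> x \<otimes> inv g"
    have "?x \<in> M"
      using conj_mem_maxes[OF L(1,2) g] .
    moreover have "?x \<notin> N"
    proof
      assume "?x \<in> N"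
      moreover have "x = inv g \<otimes> ?x \<otimes> inv (inv g)"
        using c g by (simp add: m_assoc) (simp flip: m_assoc)
      ultimately show False
        using normal.inv_op_closed2[OF N_normal, of "inv g" ?x] g L(3) by simp
    qed
    ultimately have "?x [^] (2::nat) \<in> D x"
      using sq_mem[OF L(1) _ _ L(2,3)] by blast
    then have s: "g \<otimes> x [^] (2::nat) \<otimes> inv g \<in> D x"
      using conjugate_nat_pow[OF g c] by simp
    obtain l :: nat where l: "y = (x [^] (2::nat)) [^] l"
      using y mem_generate_iff[OF finite_G, of "x [^] (2::nat)"] c unfolding D_def by auto
    have "g \<otimes> y \<otimes> inv g = (g \<otimes> x [^] (2::nat) \<otimes> inv g) [^] l"
      unfolding l using conjugate_nat_pow[OF g, of "x [^] (2::nat)" l] c by simp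
    then show ?thesis
      using subgroup_nat_pow_closed[OF D_sub[OF c] s] by simp
  qed
  show ?thesis
  proof (cases m)
    \<comment> \<open>The three subgroups would all be trivial and hence equal.\<close>
    case 0
    then show ?thesis
      using ordu ne uvw ord_eq_1[of u] ord_eq_1[of v] unfolding D_def u_def v_def by simp
  next
    case (Suc q)
    have x12: "x1 \<otimes> x2 \<in> M3" "x1 \<otimes> x2 \<notin> N" "x1 \<otimes> x2 \<in> carrier G"
    proof -
      have "x2 \<notin> M1" "x1 \<notin> M2"
        using maxes_unique[OF M'(1,2)] x1 x2 M(2) by blast+
      then have 12: "x1 \<otimes> x2 \<notin> M1" "x1 \<otimes> x2 \<notin> M2"
        using subgroup_mult_left_iff[OF maxesD(1)[OF M'(1)] x1(1) xc(2)]
          subgroup_mult_right_iff[OF maxesD(1)[OF M'(2)] xc(1) x2(1)] by auto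
      then show "x1 \<otimes> x2 \<notin> N" "x1 \<otimes> x2 \<in> carrier G"
        using maxesD(2)[OF M'(1)] xc by auto
      then show "x1 \<otimes> x2 \<in> M3"
        using ex_maxes 12 M(1) by blast
    qed
    show ?thesis
    proof (cases q)
      case 0
      then have n: "n = 2"
        using m Suc by simp
      have two: "y = \<one> \<or> y = z" if z: "z \<in> carrier G" "ord z = 2" "y \<in> generate G {z}" for y z
      proof -
        obtain l :: nat where "y = z [^] l"
          using mem_generate_iff[OF finite_G z(1)] z(3) by blast
        then have "y = z [^] (l mod 2)"
          using nat_pow_mod[OF z(1), of 2 l] z pow_ord_eq_1[OF z(1)] by simp
        moreover have "l mod 2 = 0 \<or> l mod 2 = 1"
          by presburger
        ultimately show ?thesis
          using z(1) by auto
      qed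
      have ord2: "ord u = 2" "ord v = 2" "ord w = 2"
        using ordu Suc 0 by auto
      \<comment> \<open>\<open>N\<close> consists of the identity and the involutions
        \<open>u\<close>, \<open>v\<close>, \<open>w\<close>, so \<open>u \<otimes> v = w\<close>.
        But \<open>w\<close> is also the square of \<open>x1 \<otimes> x2\<close>, an element of
        \<open>M3 - N\<close>. Comparing the two expressions and cancelling makes \<open>x1\<close>
        and \<open>x2\<close> commute.\<close>
      have "u \<otimes> v \<noteq> \<one>"
      proof
        assume "u \<otimes> v = \<one>"
        then have "u \<otimes> v \<in> D x1"
          using Ds(1) subgroup.one_closed by metis
        then show False
          using subgroup_mult_left_iff[OF Ds(1) uvw(7,2)] nm(3) by blast
      qed
      then have uvw': "u \<otimes> v = w"
        using two[OF uvw(3) ord2(3)] uv unfolding D_def w_def by blast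
      let ?y = "(x1 \<otimes> x2) [^] (2::nat)"
      have "?y \<in> D x3"
        using sq_mem[OF M'(3) x12(1,2) x3] .
      moreover have "?y \<noteq> \<one>"
      proof
        assume "?y = \<one>"
        then have "card (D (x1 \<otimes> x2)) = 1"
          unfolding D_def using generate_one by simp
        then show False
          using cardD[OF M'(3) x12(1,2)] Suc by simp
      qed
      ultimately have "?y = w"
        using two[OF uvw(3) ord2(3)] unfolding D_def w_def by blast
      then have "x1 \<otimes> (x2 \<otimes> x1) \<otimes> x2 = x1 \<otimes> (x1 \<otimes> x2) \<otimes> x2"
        using uvw'[symmetric] xc unfolding u_def v_def by (simp add: pow2 m_assoc)
      then have "x1 \<otimes> (x2 \<otimes> x1) = x1 \<otimes> (x1 \<otimes> x2)"
        using xc by (subst (asm) right_cancel) auto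
      then have comm: "x1 \<otimes> x2 = x2 \<otimes> x1"
        using l_cancel[of x1 "x2 \<otimes> x1" "x1 \<otimes> x2"] xc by simp
      have "generate G {x1} \<inter> generate G {x2} = {\<one>}"
      proof -
        have "y = \<one>" if y: "y \<in> generate G {x1}" "y \<in> generate G {x2}" for y
        proof -
          have "y \<in> M1" "y \<in> M2"
            using y generate_subgroup_incl[of "{x1}" M1] generate_subgroup_incl[of "{x2}" M2]
              x1 x2 maxesD(1) M' by auto
          then have "y \<in> N"
            using maxes_unique[OF M'(1,2)] M(2) by blast
          then have "y \<in> D x1" "y \<in> D x2"
            using y D_Int(1) xc x1 x2 by auto
          then show ?thesis
            using two[OF uvw(1) ord2(1)] nm(1) unfolding D_def u_def by blast
        qed
        then show ?thesis
          using generate.one[of G "{x1}"] generate.one[of G "{x2}"] by blast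
      qed
      moreover have "ord x1 = 4" "ord x2 = 4" "order G = 4 * 4"
        using ordx[OF M'(1) x1] ordx[OF M'(2) x2] order_G n p2 by auto
      moreover have "x1 \<otimes> x2 = x2 \<otimes> x1 [^] (1::nat)"
        using comm xc(1) by simp
      ultimately show ?thesis
        unfolding split_metacyclic_def using xc(1,2) by blast
    next
      \<comment> \<open>Now \<open>u\<close>, \<open>v\<close>, \<open>w\<close> have order at least
        4. It turns out that \<open>u\<close> and \<open>v\<close> commute and have the same
        involution among their powers. Then \<open>u \<otimes> v\<close> has smaller order than
        \<open>w\<close>, so it is a power of \<open>w \<otimes> w\<close>, which lies in
        \<open>D x1\<close>; this would put \<open>v\<close> into \<open>D x1\<close>.\<close>
      case (Suc q')
      let ?e = "2 ^ q :: nat"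
      have m': "(2::nat) ^ m = 2 * ?e"
        using \<open>m = Suc q\<close> by simp
      have comm_of: "x1 \<otimes> y = y \<otimes> x1" if y: "y \<in> D x1" for y
      proof -
        obtain l :: nat where "y = (x1 [^] (2::nat)) [^] l"
          using y mem_generate_iff[OF finite_G, of "x1 [^] (2::nat)"] xc unfolding D_def by auto
        then have "y = x1 [^] (2 * l)"
          using xc by (simp add: nat_pow_pow)
        then show ?thesis
          using nat_pow_commute[of x1 x1 "2 * l"] xc by simp
      qed
      have v_pow: "v [^] (2 * l) \<in> D x1" for l :: nat
        using vv subgroup_nat_pow_closed[OF Ds(1), of "v \<otimes> v" l] nat_pow_pow[OF uvw(2), of 2 l]
          pow2[OF uvw(2)] by simp
      have conj_fix: "x1 \<otimes> y \<otimes> inv x1 = y" if "y \<in> D x1" for y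
        using comm_of[OF that] subgroup.mem_carrier[OF Ds(1) that] xc(1) by (simp add: m_assoc)
      have "x1 \<otimes> v \<otimes> inv x1 \<in> D x2"
        using conjD[OF M'(2) x2 xc(1) uvw(8)] .
      then obtain i :: nat where i: "x1 \<otimes> v \<otimes> inv x1 = v [^] i"
        using mem_generate_iff[OF finite_G uvw(2)] unfolding D_def v_def by blast
      \<comment> \<open>Even powers of \<open>v\<close> lie in \<open>D x1\<close> and are fixed by
        \<open>x1\<close>. If the conjugate of \<open>v\<close> were such a power, then
        \<open>v\<close> would equal it and lie in \<open>D x1\<close>.\<close>
      have "odd i"
      proof
        assume "even i"
        then have "v [^] i \<in> D x1"
          using v_pow by (metis evenE)
        then have "x1 \<otimes> v [^] i \<otimes> inv x1 = v [^] i"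
          by (rule conj_fix)
        then have "x1 \<otimes> v [^] i \<otimes> inv x1 = x1 \<otimes> v \<otimes> inv x1"
          unfolding i .
        then have "x1 \<otimes> v [^] i = x1 \<otimes> v"
          using xc(1) uvw(2) by simp
        then have "v [^] i = v"
          by (rule l_cancel) (use xc(1) uvw(2) in auto)
        then show False
          using \<open>v [^] i \<in> D x1\<close> nm(3) by simp
      qed
      then obtain l where l: "i = Suc (2 * l)"
        by (metis oddE Suc_eq_plus1)
      \<comment> \<open>Conjugation by \<open>x1\<close> multiplies \<open>v\<close> by
        \<open>y\<close>, which it fixes and whose square is trivial. Applied twice it therefore
        fixes \<open>v\<close>, that is, \<open>u\<close> commutes with \<open>v\<close>.\<close>
      define y where "y = v [^] (2 * l)"
      have yc: "y \<in> carrier G"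
        using uvw y_def by simp
      have vy: "x1 \<otimes> v \<otimes> inv x1 = v \<otimes> y"
        unfolding i l y_def using uvw(2) nat_pow_Suc2 by simp
      have "y \<otimes> y = \<one>"
      proof -
        have "v [^] (2::nat) = x1 \<otimes> v [^] (2::nat) \<otimes> inv x1"
          using conj_fix[of "v [^] (2::nat)"] v_pow[of 1] by simp
        also have "\<dots> = (v [^] i) [^] (2::nat)"
          using conjugate_nat_pow[OF xc(1) uvw(2), of 2] i by simp
        also have "\<dots> = v [^] (2::nat) \<otimes> v [^] (2 * l * 2)"
          using nat_pow_mult[OF uvw(2), of 2 "2 * l * 2"] nat_pow_pow[OF uvw(2), of i 2] unfolding l by simp
        finally have "v [^] (2 * l * 2) = \<one>"
          using uvw(2) l_cancel_one'[of "v [^] (2::nat)" "v [^] (2 * l * 2)"] by simp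
        then show ?thesis
          unfolding y_def using uvw(2) by (simp add: nat_pow_mult mult_2_right)
      qed
      have "x1 \<otimes> (x1 \<otimes> v \<otimes> inv x1) \<otimes> inv x1 = v"
      proof -
        have "x1 \<otimes> (v \<otimes> y) \<otimes> inv x1 = (x1 \<otimes> v \<otimes> inv x1) \<otimes> (x1 \<otimes> y \<otimes> inv x1)"
          using xc uvw(2) yc by (simp add: m_assoc) (simp flip: m_assoc)
        also have "x1 \<otimes> y \<otimes> inv x1 = y"
          using conj_fix v_pow unfolding y_def by blast
        finally show ?thesis
          using \<open>y \<otimes> y = \<one>\<close> uvw(2) yc by (simp add: vy m_assoc)
      qed
      then have "u \<otimes> v \<otimes> inv u = v"
        unfolding u_def using xc uvw(2) by (simp add: pow2 inv_mult_group m_assoc)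
      then have comm: "u \<otimes> v = v \<otimes> u"
        using uvw by (metis inv_solve_right m_closed)
      have ue: "u [^] ?e \<noteq> \<one>" "u [^] (?e * 2) = \<one>" "v [^] (?e * 2) = \<one>" "w [^] (?e * 2) = \<one>"
        using pow_eq_id uvw(1-3) ordu m' dvd_imp_le[of "2 * ?e" ?e] by (auto simp: mult.commute)
      \<comment> \<open>The involution among the powers of \<open>u\<close> is a power of
        \<open>u \<otimes> u\<close>, hence lies in the cyclic group \<open>D x2\<close>, whose only
        involution is that of \<open>v\<close>.\<close>
      have "u [^] ?e \<in> D x2"
        using uu subgroup_nat_pow_closed[OF Ds(2), of "u \<otimes> u" "2 ^ q'"] nat_pow_pow[OF uvw(1), of 2 "2 ^ q'"]
          pow2[OF uvw(1)] Suc by simp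
      then obtain r :: nat where r: "u [^] ?e = v [^] r"
        using mem_generate_iff[OF finite_G uvw(2)] unfolding D_def v_def by blast
      have "v [^] (r * 2) = \<one>"
        using ue(2) r nat_pow_pow[OF uvw(1)] nat_pow_pow[OF uvw(2)] by metis
      then have "?e dvd r"
        using pow_eq_id[OF uvw(2)] ordu m' by (simp add: mult.commute)
      then obtain s where s: "r = ?e * s" ..
      then have "v [^] r = (v [^] ?e) [^] (s mod 2)"
        using nat_pow_mod[of "v [^] ?e" 2 s] uvw(2) ue(3) by (simp add: nat_pow_pow)
      moreover have "s mod 2 = 0 \<or> s mod 2 = 1"
        by presburger
      ultimately have "u [^] ?e = v [^] ?e"
        using r ue(1) uvw(2) by auto
      then have "(u \<otimes> v) [^] ?e = v [^] (?e * 2)"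
        using pow_mult_distrib[OF comm uvw(1,2)] uvw by (simp add: nat_pow_mult mult_2_right)
      then have uve: "(u \<otimes> v) [^] ?e = \<one>"
        using ue(3) by simp
      obtain l' :: nat where l': "u \<otimes> v = w [^] l'"
        using uv mem_generate_iff[OF finite_G uvw(3)] unfolding D_def w_def by blast
      then have "2 * ?e dvd l' * ?e"
        using uve pow_eq_id[OF uvw(3), of "l' * ?e"] ordu(3) m' uvw(3) by (simp add: nat_pow_pow)
      then have "even l'"
        by simp
      then obtain l'' where "l' = 2 * l''" ..
      then have "u \<otimes> v = (w \<otimes> w) [^] l''"
        using l' nat_pow_pow[OF uvw(3), of 2 l''] pow2[OF uvw(3)] by simp
      then have "u \<otimes> v \<in> D x1"
        using subgroup_nat_pow_closed[OF Ds(1) ww] by simp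
      then show ?thesis
        using subgroup_mult_left_iff[OF Ds(1) uvw(7,2)] nm(3) by blast
    qed
  qed
qed

lemma two_classification:
  assumes six: "card (max_cyclic G) = 6" and p2: "p = 2"
  shows "split_metacyclic 4 4 1 \<or> split_metacyclic 16 2 1 \<or> split_metacyclic 16 2 9"
proof -
  obtain M1 M2 M3 where M: "maxes = {M1, M2, M3}" "M1 \<noteq> M2" "M1 \<noteq> M3" "M2 \<noteq> M3"
    using card_maxes p2 card_3_iff[of maxes] by auto
  have M': "M1 \<in> maxes" "M2 \<in> maxes" "M3 \<in> maxes"
    using M by auto
  define k where "k M = card (cycs M)" for M
  have sum: "(\<Sum>L\<in>maxes. k L) = k M1 + k M2 + k M3"
    using M by simp
  have pos: "1 \<le> k M1" "1 \<le> k M2" "1 \<le> k M3"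
    using card_cycs_pos M' unfolding k_def by auto
  show ?thesis
  proof (cases "k M1 = 1 \<or> k M2 = 1 \<or> k M3 = 1")
    \<comment> \<open>Each count is at least 2 and the total is at most 6, so all counts are 2, the
      bound is attained, and no maximal cyclic subgroup lies inside \<open>N\<close>.\<close>
    case False
    then have "2 \<le> k M1" "2 \<le> k M2" "2 \<le> k M3"
      using pos by auto
    moreover have "k M1 + k M2 + k M3 \<le> 6"
      using sum sum_card_cycs_le six unfolding k_def by simp
    ultimately have k: "k M1 = 2" "k M2 = 2" "k M3 = 2"
      by auto
    then have "(\<Union>L\<in>maxes. cycs L) = max_cyclic G"
      using sum six unfolding k_def by (intro Union_cycs_eq_if_sum_eq) simp
    then show ?thesis
      using two_classification_2_2_2[OF p2 M] k unfolding k_def by blast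
  next
    case True
    then have "(\<Sum>L\<in>maxes. k L) = 6"
      using sum_card_cycs_eq M' six unfolding k_def by metis
    then have six': "k M1 + k M2 + k M3 = 6"
      using sum by simp
    have *: ?thesis if L: "maxes = {L1, L2, L3}" "L1 \<noteq> L2" "L1 \<noteq> L3" "L2 \<noteq> L3"
      and kL: "k L1 = 1" "k L2 + k L3 = 5" "1 \<le> k L2" "1 \<le> k L3" for L1 L2 L3
    proof -
      have L': "maxes = {L1, L3, L2}"
        using L(1) by auto
      \<comment> \<open>Up to the order of the last two groups only 1, 1, 4 and 1, 2, 3
        remain.\<close>
      consider "k L2 = 1" "k L3 = 4" | "k L2 = 4" "k L3 = 1" | "k L2 = 2" "k L3 = 3" | "k L2 = 3" "k L3 = 2"
        using kL by linarith
      then show ?thesis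
        using two_classification_1_1_4[OF p2 L(1,2)] two_classification_1_1_4[OF p2 L' L(3)]
          two_classification_1_2_3[OF p2 L] two_classification_1_2_3[OF p2 L' L(3,2)] L(4) kL(1)
        unfolding k_def by cases auto
    qed
    have perm: "maxes = {M2, M1, M3}" "maxes = {M3, M1, M2}"
      using M(1) by auto
    show ?thesis
      using True
    proof (elim disjE)
      assume "k M1 = 1"
      then show ?thesis
        using *[OF M] six' pos by simp
    next
      assume "k M2 = 1"
      then show ?thesis
        using *[OF perm(1)] M six' pos by simp
    next
      assume "k M3 = 1"
      then show ?thesis
        using *[OF perm(2)] M six' pos by simp
    qed
  qed
qed

end

section \<open>Identifying the groups\<close>

context group
begin

text \<open>By counting: trivial intersection makes multiplication injective on pairs from the two
  cyclic groups, and there are as many pairs as elements of \<open>G\<close>.\<close>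

lemma split_metacyclic_set_mult:
  assumes "finite (carrier G)" "a \<in> carrier G" "c \<in> carrier G"
    and "generate G {a} \<inter> generate G {c} = {\<one>}" "order G = ord a * ord c"
    and "g \<in> carrier G"
  shows "\<exists>i j. g = c [^] (i::nat) \<otimes> a [^] (j::nat)"
proof -
  interpret D: group_disjoint_sum G "generate G {c}" "generate G {a}"
    using assms generate_is_subgroup by (simp add: group_disjoint_sum_def)
  have "inj_on (\<lambda>(x, y). x \<otimes> y) (generate G {c} \<times> generate G {a})"
    using D.cancel assms(4) by (auto simp: inj_on_def Int_commute)
  then have "card ((\<lambda>(x, y). x \<otimes> y) ` (generate G {c} \<times> generate G {a})) = order G"
    using assms generate_pow_card[of a] generate_pow_card[of c]
    by (simp add: card_image card_cartesian_product mult.commute)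
  moreover have "(\<lambda>(x, y). x \<otimes> y) ` (generate G {c} \<times> generate G {a}) \<subseteq> carrier G"
    using generate_singleton_subset[OF assms(2)] generate_singleton_subset[OF assms(3)] by auto
  ultimately have "(\<lambda>(x, y). x \<otimes> y) ` (generate G {c} \<times> generate G {a}) = carrier G"
    using card_subset_eq[OF assms(1)] by (simp add: order_def)
  then have "g \<in> (\<lambda>(x, y). x \<otimes> y) ` (generate G {c} \<times> generate G {a})"
    using assms(6) by simp
  then obtain x y where "x \<in> generate G {c}" "y \<in> generate G {a}" "g = x \<otimes> y"
    by auto
  then show ?thesis
    using mem_generate_iff assms by metis
qed

lemma cyclic_subgroup_iso:
  assumes "finite (carrier G)" "a \<in> carrier G"
  shows "G\<lparr>carrier := generate G {a}\<rparr> \<cong> integer_mod_group (ord a)"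
proof -
  have sub: "subgroup (generate G {a}) G"
    using assms generate_is_subgroup by simp
  interpret A: group "G\<lparr>carrier := generate G {a}\<rparr>"
    using sub by (rule subgroup_imp_group)
  have "generate (G\<lparr>carrier := generate G {a}\<rparr>) {a} = generate G {a}"
    using generate_consistent[of "{a}" "generate G {a}"] sub generate_singleton_mem by simp
  then have "cyclic_group (G\<lparr>carrier := generate G {a}\<rparr>)"
    using A.cyclic_group_iff_generate generate_singleton_mem by auto
  moreover have "finite (generate G {a})"
    using generate_singleton_subset assms finite_subset by blast
  ultimately show ?thesis
    using A.cyclic_iso_integer_mod_group generate_pow_card[OF assms(2)] by (simp add: order_def)
qed

text \<open>Both orders of the factors are provided, because the classification puts the larger
  cyclic group first and the final list the smaller one.\<close>

lemma split_metacyclic_abelian_iso: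
  assumes "finite (carrier G)" "split_metacyclic m k 1"
  shows "G \<cong> integer_mod_group m \<times>\<times> integer_mod_group k"
    and "G \<cong> integer_mod_group k \<times>\<times> integer_mod_group m"
proof -
  have iso: "G \<cong> integer_mod_group (ord a) \<times>\<times> integer_mod_group (ord c)"
    if c: "a \<in> carrier G" "c \<in> carrier G" and int: "generate G {a} \<inter> generate G {c} = {\<one>}"
      and ord: "order G = ord a * ord c" and comm: "a \<otimes> c = c \<otimes> a" for a c
  proof -
    let ?A = "generate G {a}" and ?C = "generate G {c}"
    have sub: "subgroup ?A G" "subgroup ?C G"
      using c generate_is_subgroup by auto
    have commAC: "x \<otimes> y = y \<otimes> x" if xy: "x \<in> ?A" "y \<in> ?C" for x y
    proof -
      obtain i j :: nat where ij: "x = a [^] i" "y = c [^] j"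
        using xy mem_generate_iff[OF assms(1)] c by meson
      have "c [^] j \<otimes> a = a \<otimes> c [^] j"
        using nat_pow_commute[of c a j] c comm by simp
      then show ?thesis
        unfolding ij using nat_pow_commute[of a "c [^] j" i] c by simp
    qed
    note prod = commuting_set_mult[OF sub int commAC]
    have "card (?A <#> ?C) = order G"
      using prod(2) ord generate_pow_card c by simp
    then have "?A <#> ?C = carrier G"
      using prod(1) assms(1) by (simp add: card_subset_eq order_def subgroup.subset)
    then have "G\<lparr>carrier := ?A\<rparr> \<times>\<times> G\<lparr>carrier := ?C\<rparr> \<cong> G"
      using prod(3) by (auto simp: is_iso_def)
    then have "G \<cong> G\<lparr>carrier := ?A\<rparr> \<times>\<times> G\<lparr>carrier := ?C\<rparr>"
      by (rule group.iso_sym[OF DirProd_group[OF subgroup_imp_group[OF sub(1)] subgroup_imp_group[OF sub(2)]]])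
    also have "\<dots> \<cong> integer_mod_group (ord a) \<times>\<times> integer_mod_group (ord c)"
      using group.DirProd_iso_trans[OF subgroup_imp_group[OF sub(1)]
          cyclic_subgroup_iso[OF assms(1) c(1)] cyclic_subgroup_iso[OF assms(1) c(2)]] .
    finally show ?thesis .
  qed
  obtain a c where ac: "a \<in> carrier G" "c \<in> carrier G" "ord a = m" "ord c = k"
    "generate G {a} \<inter> generate G {c} = {\<one>}" "order G = m * k" "a \<otimes> c = c \<otimes> a [^] (1::nat)"
    using assms(2) unfolding split_metacyclic_def by blast
  show "G \<cong> integer_mod_group m \<times>\<times> integer_mod_group k"
    using iso[of a c] ac by simp
  have "c \<otimes> a = a \<otimes> c"
    using ac by simp
  then show "G \<cong> integer_mod_group k \<times>\<times> integer_mod_group m"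
    using iso[of c a] ac by (simp add: Int_commute mult.commute)
qed

end

section \<open>Groups presented by metacyclic relations\<close>

definition metacyclic_relations :: "nat \<Rightarrow> nat \<Rightarrow> nat \<Rightarrow> (two_gens word \<times> two_gens word) set"
  where "metacyclic_relations m k r = {(a_pow m, []), (b_pow k, []), (a_conj_b, a_pow r)}"

lemma pres_class_pow:
  "pres_class R [(x, True)] [^]\<^bsub>presented_group R\<^esub> (k::nat) = pres_class R (replicate k (x, True))"
proof (induction k)
  case 0
  interpret group "presented_group R"
    by (rule group_presented_group)
  show ?case
    by (simp add: presented_group_def)
next
  case (Suc k)
  then show ?case
    by (simp add: presented_group_mult replicate_append_same)
qed

lemma pres_class_mem: "pres_class R u \<in> carrier (presented_group R)"
  by (simp add: presented_group_def)

text \<open>The conjugation relation moves powers of \<open>A\<close> to the right of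
  \<open>B\<close>, so every class has the form \<open>B [^] i \<otimes> A [^] j\<close>, with
  exponents reduced modulo \<open>k\<close> and \<open>m\<close>. This is only an upper bound, and
  for arbitrary \<open>r\<close> the order can be smaller; equality will come from a surjection onto
  a group of order \<open>m * k\<close>.\<close>

lemma metacyclic_presentation:
  fixes m k r :: nat
  assumes "0 < m" "0 < k"
  defines "H \<equiv> presented_group (metacyclic_relations m k r)"
  shows "finite (carrier H)" and "order H \<le> m * k"
proof -
  let ?R = "metacyclic_relations m k r"
  interpret H: group H
    unfolding H_def by (rule group_presented_group)
  define A B where "A = pres_class ?R [(GenA, True)]" and "B = pres_class ?R [(GenB, True)]"
  have AB: "A \<in> carrier H" "B \<in> carrier H"
    unfolding A_def B_def H_def by (rule pres_class_mem)+
  have one: "\<one>\<^bsub>H\<^esub> = pres_class ?R []"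
    by (simp add: H_def presented_group_def)
  have rel: "pres_class ?R (a_pow m) = pres_class ?R []" "pres_class ?R (b_pow k) = pres_class ?R []"
    "pres_class ?R a_conj_b = pres_class ?R (a_pow r)"
    unfolding pres_class_eq_iff by (auto intro!: pres_rel simp: metacyclic_relations_def)
  have Am: "A [^]\<^bsub>H\<^esub> m = \<one>\<^bsub>H\<^esub>" and Bk: "B [^]\<^bsub>H\<^esub> k = \<one>\<^bsub>H\<^esub>"
    unfolding A_def B_def H_def pres_class_pow rel by (simp_all add: presented_group_def)
  have inv: "pres_class ?R [(x, False)] = inv\<^bsub>H\<^esub> pres_class ?R [(x, True)]" for x
  proof -
    have "pres_class ?R [(x, False)] \<otimes>\<^bsub>H\<^esub> pres_class ?R [(x, True)] = \<one>\<^bsub>H\<^esub>"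
      unfolding one unfolding H_def presented_group_mult pres_class_eq_iff
      using pres_cancel[of ?R x False] by simp
    then show ?thesis
      by (intro H.inv_equality[symmetric]) (simp_all add: H_def pres_class_mem)
  qed
  have "inv\<^bsub>H\<^esub> B \<otimes>\<^bsub>H\<^esub> A \<otimes>\<^bsub>H\<^esub> B = A [^]\<^bsub>H\<^esub> r"
  proof -
    have "inv\<^bsub>H\<^esub> B \<otimes>\<^bsub>H\<^esub> A \<otimes>\<^bsub>H\<^esub> B = pres_class ?R a_conj_b"
      unfolding A_def B_def inv[symmetric] unfolding H_def presented_group_mult by simp
    then show ?thesis
      unfolding rel(3) A_def H_def pres_class_pow .
  qed
  then have conj: "inv\<^bsub>H\<^esub> B \<otimes>\<^bsub>H\<^esub> A \<otimes>\<^bsub>H\<^esub> inv\<^bsub>H\<^esub> (inv\<^bsub>H\<^esub> B) = A [^]\<^bsub>H\<^esub> r"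
    using AB by simp
  have AjB: "A [^]\<^bsub>H\<^esub> j \<otimes>\<^bsub>H\<^esub> B = B \<otimes>\<^bsub>H\<^esub> A [^]\<^bsub>H\<^esub> (r * j)" for j :: nat
  proof -
    have "inv\<^bsub>H\<^esub> B \<otimes>\<^bsub>H\<^esub> A [^]\<^bsub>H\<^esub> j \<otimes>\<^bsub>H\<^esub> B = A [^]\<^bsub>H\<^esub> (r * j)"
      using H.conjugate_nat_pow[of "inv\<^bsub>H\<^esub> B" A j] AB unfolding conj by (simp add: H.nat_pow_pow)
    then have "B \<otimes>\<^bsub>H\<^esub> A [^]\<^bsub>H\<^esub> (r * j) = B \<otimes>\<^bsub>H\<^esub> (inv\<^bsub>H\<^esub> B \<otimes>\<^bsub>H\<^esub> A [^]\<^bsub>H\<^esub> j \<otimes>\<^bsub>H\<^esub> B)"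
      by simp
    also have "\<dots> = A [^]\<^bsub>H\<^esub> j \<otimes>\<^bsub>H\<^esub> B"
      using AB by (simp flip: H.m_assoc)
    finally show ?thesis
      by simp
  qed
  define S where "S = {B [^]\<^bsub>H\<^esub> i \<otimes>\<^bsub>H\<^esub> A [^]\<^bsub>H\<^esub> j | (i::nat) (j::nat). True}"
  have Sc: "g \<in> carrier H" if "g \<in> S" for g
    using that AB unfolding S_def by auto
  have SA: "g \<otimes>\<^bsub>H\<^esub> A [^]\<^bsub>H\<^esub> l \<in> S" if g: "g \<in> S" for g and l :: nat
  proof -
    obtain i j :: nat where "g = B [^]\<^bsub>H\<^esub> i \<otimes>\<^bsub>H\<^esub> A [^]\<^bsub>H\<^esub> j"
      using g unfolding S_def by blast
    then have "g \<otimes>\<^bsub>H\<^esub> A [^]\<^bsub>H\<^esub> l = B [^]\<^bsub>H\<^esub> i \<otimes>\<^bsub>H\<^esub> A [^]\<^bsub>H\<^esub> (j + l)"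
      using AB by (simp add: H.m_assoc H.nat_pow_mult)
    then show ?thesis
      unfolding S_def by blast
  qed
  have SB1: "g \<otimes>\<^bsub>H\<^esub> B \<in> S" if g: "g \<in> S" for g
  proof -
    obtain i j :: nat where "g = B [^]\<^bsub>H\<^esub> i \<otimes>\<^bsub>H\<^esub> A [^]\<^bsub>H\<^esub> j"
      using g unfolding S_def by blast
    then have "g \<otimes>\<^bsub>H\<^esub> B = B [^]\<^bsub>H\<^esub> i \<otimes>\<^bsub>H\<^esub> (A [^]\<^bsub>H\<^esub> j \<otimes>\<^bsub>H\<^esub> B)"
      using AB by (simp add: H.m_assoc)
    also have "\<dots> = B [^]\<^bsub>H\<^esub> Suc i \<otimes>\<^bsub>H\<^esub> A [^]\<^bsub>H\<^esub> (r * j)"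
      unfolding AjB using AB by (simp add: H.m_assoc)
    finally show ?thesis
      unfolding S_def by blast
  qed
  have SB: "g \<otimes>\<^bsub>H\<^esub> B [^]\<^bsub>H\<^esub> l \<in> S" if "g \<in> S" for g and l :: nat
  proof (induction l)
    case (Suc l)
    have "g \<otimes>\<^bsub>H\<^esub> B [^]\<^bsub>H\<^esub> Suc l = (g \<otimes>\<^bsub>H\<^esub> B [^]\<^bsub>H\<^esub> l) \<otimes>\<^bsub>H\<^esub> B"
      using Sc[OF that] AB by (simp add: H.m_assoc)
    then show ?case
      using SB1[OF Suc] by simp
  qed (use that Sc in simp)
  \<comment> \<open>Inverse letters become nonnegative powers of the generators, so natural
    exponents suffice in the normal form. The truncated \<open>l - 1\<close> is harmless since
    \<open>0 < l\<close>.\<close>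
  have inv_pow: "inv\<^bsub>H\<^esub> x = x [^]\<^bsub>H\<^esub> (l - 1)" if "x \<in> carrier H" "x [^]\<^bsub>H\<^esub> l = \<one>\<^bsub>H\<^esub>" "0 < l" for x and l :: nat
  proof -
    have "x [^]\<^bsub>H\<^esub> (l - 1) \<otimes>\<^bsub>H\<^esub> x = x [^]\<^bsub>H\<^esub> Suc (l - 1)"
      by simp
    then have "x [^]\<^bsub>H\<^esub> (l - 1) \<otimes>\<^bsub>H\<^esub> x = \<one>\<^bsub>H\<^esub>"
      using that by simp
    then show ?thesis
      using that by (intro H.inv_equality) auto
  qed
  have letter: "g \<otimes>\<^bsub>H\<^esub> pres_class ?R [l] \<in> S" if g: "g \<in> S" for g and l
  proof -
    obtain x s where l: "l = (x, s)"
      by fastforce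
    have 1: "pres_class ?R [l] = A [^]\<^bsub>H\<^esub> (1::nat)" if "x = GenA" "s"
      using that AB l A_def by simp
    have 2: "pres_class ?R [l] = A [^]\<^bsub>H\<^esub> (m - 1)" if "x = GenA" "\<not> s"
      using that l inv[of GenA] inv_pow[OF AB(1) Am assms(1)] A_def by simp
    have 3: "pres_class ?R [l] = B [^]\<^bsub>H\<^esub> (1::nat)" if "x = GenB" "s"
      using that AB l B_def by simp
    have 4: "pres_class ?R [l] = B [^]\<^bsub>H\<^esub> (k - 1)" if "x = GenB" "\<not> s"
      using that l inv[of GenB] inv_pow[OF AB(2) Bk assms(2)] B_def by simp
    show ?thesis
      using 1 2 3 4 SA[OF g] SB[OF g] by (metis two_gens.exhaust)
  qed
  \<comment> \<open>Words grow at the right end, the side on which \<open>letter\<close> keeps the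
    normal form.\<close>
  have all: "pres_class ?R u \<in> S" for u
  proof (induction u rule: rev_induct)
    case Nil
    have "\<one>\<^bsub>H\<^esub> = B [^]\<^bsub>H\<^esub> (0::nat) \<otimes>\<^bsub>H\<^esub> A [^]\<^bsub>H\<^esub> (0::nat)"
      by simp
    then show ?case
      unfolding one[symmetric] S_def by blast
  next
    case (snoc l u)
    have "pres_class ?R (u @ [l]) = pres_class ?R u \<otimes>\<^bsub>H\<^esub> pres_class ?R [l]"
      unfolding H_def presented_group_mult ..
    then show ?case
      using letter[OF snoc] by simp
  qed
  let ?f = "\<lambda>(i, j). B [^]\<^bsub>H\<^esub> (i::nat) \<otimes>\<^bsub>H\<^esub> A [^]\<^bsub>H\<^esub> (j::nat)"
  have sub: "carrier H \<subseteq> ?f ` ({..<k} \<times> {..<m})"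
  proof
    fix g assume "g \<in> carrier H"
    then obtain u where "g = pres_class ?R u"
      unfolding H_def presented_group_def by auto
    then have "g \<in> S"
      using all by simp
    then obtain i j :: nat where "g = B [^]\<^bsub>H\<^esub> i \<otimes>\<^bsub>H\<^esub> A [^]\<^bsub>H\<^esub> j"
      unfolding S_def by blast
    then have "g = ?f (i mod k, j mod m)"
      using H.nat_pow_mod[OF AB(1) Am, of j] H.nat_pow_mod[OF AB(2) Bk, of i] by simp
    moreover have "(i mod k, j mod m) \<in> {..<k} \<times> {..<m}"
      using assms by simp
    ultimately show "g \<in> ?f ` ({..<k} \<times> {..<m})"
      by (rule image_eqI)
  qed
  show "finite (carrier H)"
    using sub by (rule finite_subset) simp
  have "card (carrier H) \<le> card ({..<k} \<times> {..<m})"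
    using sub by (intro surj_card_le) auto
  then show "order H \<le> m * k"
    by (simp add: order_def card_cartesian_product mult.commute)
qed

text \<open>Evaluating words at \<open>a\<close> and \<open>c\<close> respects the relations and
  maps the presented group onto \<open>G\<close>. Its order is at most
  \<open>m * k = order G\<close>, so the surjection is a bijection. The parameters 9, 3, 4 and 16,
  2, 9 give \<open>R3\<close> and \<open>T5\<close>.\<close>

lemma (in group) split_metacyclic_iso_presented_group:
  assumes "finite (carrier G)" "split_metacyclic m k r"
  shows "G \<cong> presented_group (metacyclic_relations m k r)"
proof -
  let ?R = "metacyclic_relations m k r"
  define H where "H = presented_group ?R"
  have H: "group H"
    unfolding H_def by (rule group_presented_group)
  obtain a c where ac: "a \<in> carrier G" "c \<in> carrier G" "ord a = m" "ord c = k"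
    "generate G {a} \<inter> generate G {c} = {\<one>}" "order G = m * k" "a \<otimes> c = c \<otimes> a [^] r"
    using assms(2) unfolding split_metacyclic_def by blast
  have pos: "0 < m" "0 < k"
    using ord_ge_1[OF assms(1)] ac by force+
  define gen where "gen x = (case x of GenA \<Rightarrow> a | GenB \<Rightarrow> c)" for x
  define letter where "letter l = (if snd l then gen (fst l) else inv gen (fst l))" for l
  define ev where "ev u = foldr (\<lambda>l g. letter l \<otimes> g) u \<one>" for u
  have gen: "gen x \<in> carrier G" for x
    using ac unfolding gen_def by (cases x) auto
  then have letter: "letter l \<in> carrier G" for l
    unfolding letter_def by simp
  have ev_closed: "ev u \<in> carrier G" for u
    unfolding ev_def by (induction u) (simp_all add: letter)
  have ev_append: "ev (u @ v) = ev u \<otimes> ev v" for u v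
  proof (induction u)
    case (Cons l u)
    then show ?case
      using letter[of l] ev_closed[of u] ev_closed[of v] by (simp add: ev_def m_assoc)
  qed (use ev_closed[of v] in \<open>simp add: ev_def\<close>)
  have ev_pow: "ev (replicate i (x, True)) = gen x [^] i" for i x
  proof (induction i)
    case (Suc i)
    then have "ev (replicate (Suc i) (x, True)) = gen x \<otimes> gen x [^] i"
      by (simp add: ev_def letter_def)
    then show ?case
      using nat_pow_Suc2[OF gen] by simp
  qed (simp add: ev_def)
  have ev_eq: "ev u = ev v" if "pres_eq ?R u v" for u v
    using that
  proof (induction rule: pres_eq.induct)
    case (pres_rel u v)
    have "ev a_conj_b = inv c \<otimes> (a \<otimes> c)"
      using ac by (simp add: ev_def letter_def gen_def)
    also have "\<dots> = a [^] r"
      unfolding ac(7) using ac(1,2) by (simp flip: m_assoc)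
    finally have "ev a_conj_b = ev (a_pow r)"
      using ev_pow[of r GenA] by (simp add: gen_def)
    moreover have "ev (a_pow m) = ev []" "ev (b_pow k) = ev []"
      using ev_pow[of m GenA] ev_pow[of k GenB] ac pow_ord_eq_1[of a] pow_ord_eq_1[of c]
      by (simp_all add: gen_def ev_def)
    ultimately show ?case
      using pres_rel unfolding metacyclic_relations_def by auto
  next
    case (pres_cancel x s)
    then show ?case
      using gen[of x] by (cases s) (simp_all add: ev_def letter_def)
  next
    case (pres_append u u' v v')
    then show ?case
      by (simp add: ev_append)
  qed simp_all
  \<comment> \<open>\<open>ev\<close> is constant on each class, so \<open>the_elem\<close> returns
    its single value there.\<close>
  define h where "h U = the_elem (ev ` U)" for U
  have h: "h (pres_class ?R u) = ev u" for u
  proof -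
    have "ev ` pres_class ?R u = {ev u}"
      using ev_eq pres_refl unfolding pres_class_def by fastforce
    then show ?thesis
      unfolding h_def by simp
  qed
  have hom: "h \<in> hom H G"
  proof (rule homI)
    fix U V assume "U \<in> carrier H" "V \<in> carrier H"
    then obtain u v where "U = pres_class ?R u" "V = pres_class ?R v"
      unfolding H_def presented_group_def by auto
    then show "h U \<in> carrier G" "h (U \<otimes>\<^bsub>H\<^esub> V) = h U \<otimes> h V"
      unfolding H_def by (simp_all add: h presented_group_mult ev_closed ev_append)
  qed
  have "carrier G \<subseteq> h ` carrier H"
  proof
    fix g assume "g \<in> carrier G"
    then obtain i j :: nat where "g = c [^] i \<otimes> a [^] j"
      using split_metacyclic_set_mult[OF assms(1) ac(1,2,5)] ac(3,4,6) by blast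
    then have "g = h (pres_class ?R (b_pow i @ a_pow j))"
      unfolding h ev_append ev_pow by (simp add: gen_def)
    then show "g \<in> h ` carrier H"
      unfolding H_def using pres_class_mem by blast
  qed
  then have img: "h ` carrier H = carrier G"
    using hom by (auto simp: hom_def)
  have fin: "finite (carrier H)" and "card (carrier H) \<le> m * k"
    using metacyclic_presentation[OF pos, of r] unfolding H_def order_def by auto
  then have "card (h ` carrier H) = card (carrier H)"
    using img ac(6) card_image_le[OF fin, of h] by (simp add: order_def)
  then have "inj_on h (carrier H)"
    using eq_card_imp_inj_on[OF fin] by blast
  then have "h \<in> iso H G"
    using hom img by (simp add: iso_def bij_betw_def)
  then show ?thesis
    using group.iso_sym[OF H] is_isoI unfolding H_def by blast
qed

text \<open>The Sylow subgroup itself appears as a product of two cyclic groups, so adjoining the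
  cyclic complement nests to the left, while the final list nests to the right.\<close>

lemma DirProd_assoc_iso: "(G \<times>\<times> H) \<times>\<times> K \<cong> G \<times>\<times> H \<times>\<times> K"
proof (rule is_isoI)
  show "(\<lambda>((x, y), z). (x, y, z)) \<in> iso ((G \<times>\<times> H) \<times>\<times> K) (G \<times>\<times> H \<times>\<times> K)"
    by (auto simp: iso_def hom_def bij_betw_def inj_on_def DirProd_def image_iff)
qed

lemma (in p_group_over) classification:
  assumes "card (max_cyclic G) = 6"
  shows "p = 2 \<and> G \<cong> integer_mod_group 4 \<times>\<times> integer_mod_group 4 \<or>
    p = 5 \<and> G \<cong> integer_mod_group 5 \<times>\<times> integer_mod_group 5 \<or>
    p = 3 \<and> G \<cong> integer_mod_group 3 \<times>\<times> integer_mod_group 9 \<or>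
    p = 3 \<and> G \<cong> R3 \<or>
    p = 2 \<and> G \<cong> integer_mod_group 2 \<times>\<times> integer_mod_group 16 \<or>
    p = 2 \<and> G \<cong> T5"
proof -
  note ab = split_metacyclic_abelian_iso[OF finite_G]
  note pres = split_metacyclic_iso_presented_group[OF finite_G, unfolded metacyclic_relations_def]
  show ?thesis
  proof (cases "p = 2")
    case True
    then show ?thesis
      using two_classification[OF assms] ab(1)[of 4 4] ab(2)[of 16 2] pres[of 16 2 9]
      unfolding T5_def by blast
  next
    case False
    then have "2 < p"
      using prime_ge_2_nat[OF prime] by simp
    then show ?thesis
      using odd_classification[OF assms] ab(1)[of 5 5] ab(2)[of 9 3] pres[of 9 3 4]
      unfolding R3_def by blast
  qed
qed

theorem theoremB:
  fixes G :: "('a, 'b) monoid_scheme"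
  assumes "group G" and "finite (carrier G)" and "nilpotent G"
    and "lambda_cov G = 6"
  shows "(\<exists>p n P. Factorial_Ring.prime p \<and> 0 < n \<and> sylow_subgroup p P G \<and> \<not> p dvd n \<and>
            G \<cong> G\<lparr>carrier := P\<rparr> \<times>\<times> integer_mod_group n) \<and>
         ((\<exists>n. 0 < n \<and> odd n \<and>
             G \<cong> integer_mod_group 4 \<times>\<times> integer_mod_group 4 \<times>\<times> integer_mod_group n) \<or>
          (\<exists>n. 0 < n \<and> \<not> 5 dvd n \<and>
             G \<cong> integer_mod_group 5 \<times>\<times> integer_mod_group 5 \<times>\<times> integer_mod_group n) \<or>
          (\<exists>n. 0 < n \<and> \<not> 3 dvd n \<and>
             G \<cong> integer_mod_group 3 \<times>\<times> integer_mod_group 9 \<times>\<times> integer_mod_group n) \<or>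
          (\<exists>n. 0 < n \<and> \<not> 3 dvd n \<and> G \<cong> R3 \<times>\<times> integer_mod_group n) \<or>
          (\<exists>n. 0 < n \<and> odd n \<and>
             G \<cong> integer_mod_group 2 \<times>\<times> integer_mod_group 16 \<times>\<times> integer_mod_group n) \<or>
          (\<exists>n. 0 < n \<and> odd n \<and> G \<cong> T5 \<times>\<times> integer_mod_group n))"
proof -
  interpret group G by fact
  obtain p P n where p: "Factorial_Ring.prime p" and P: "sylow_subgroup p P G"
    and n: "0 < n" "\<not> p dvd n" and nc: "\<not> cyclic_group (G\<lparr>carrier := P\<rparr>)"
    and six: "card (max_cyclic (G\<lparr>carrier := P\<rparr>)) = 6"
    and iso: "G \<cong> G\<lparr>carrier := P\<rparr> \<times>\<times> integer_mod_group n"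
    using nilpotent_lambda_six_decomposition[OF assms(2-4)] by blast
  let ?L = "G\<lparr>carrier := P\<rparr>"
  have P': "subgroup P G" "card P = p ^ multiplicity p (order G)"
    using P unfolding sylow_subgroup_def by auto
  interpret L: group ?L
    using P'(1) by (rule subgroup_imp_group)
  have "finite (carrier ?L)"
    using subgroup.subset[OF P'(1)] assms(2) finite_subset by auto
  moreover have "order ?L = p ^ multiplicity p (order G)"
    using P'(2) by (simp add: order_def)
  ultimately obtain m N where "p_group_over ?L p m N"
    using L.ex_p_group_over[OF _ p _ nilpotent_normalizer_condition[OF assms(3) P'(1)] nc] by blast
  note cases = p_group_over.classification[OF this six]
  have prod': "G \<cong> integer_mod_group i \<times>\<times> integer_mod_group j \<times>\<times> integer_mod_group n"
    if "?L \<cong> integer_mod_group i \<times>\<times> integer_mod_group j" for i j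
    using iso_trans[OF iso_trans[OF iso L.DirProd_iso_trans[OF that iso_refl]] DirProd_assoc_iso] .
  have R: "G \<cong> R3 \<times>\<times> integer_mod_group n" if "?L \<cong> R3"
    using iso_trans[OF iso L.DirProd_iso_trans[OF that iso_refl]] .
  have T: "G \<cong> T5 \<times>\<times> integer_mod_group n" if "?L \<cong> T5"
    using iso_trans[OF iso L.DirProd_iso_trans[OF that iso_refl]] .
  have "(\<exists>n. 0 < n \<and> odd n \<and>
             G \<cong> integer_mod_group 4 \<times>\<times> integer_mod_group 4 \<times>\<times> integer_mod_group n) \<or>
          (\<exists>n. 0 < n \<and> \<not> 5 dvd n \<and>
             G \<cong> integer_mod_group 5 \<times>\<times> integer_mod_group 5 \<times>\<times> integer_mod_group n) \<or>
          (\<exists>n. 0 < n \<and> \<not> 3 dvd n \<and>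
             G \<cong> integer_mod_group 3 \<times>\<times> integer_mod_group 9 \<times>\<times> integer_mod_group n) \<or>
          (\<exists>n. 0 < n \<and> \<not> 3 dvd n \<and> G \<cong> R3 \<times>\<times> integer_mod_group n) \<or>
          (\<exists>n. 0 < n \<and> odd n \<and>
             G \<cong> integer_mod_group 2 \<times>\<times> integer_mod_group 16 \<times>\<times> integer_mod_group n) \<or>
          (\<exists>n. 0 < n \<and> odd n \<and> G \<cong> T5 \<times>\<times> integer_mod_group n)"
    using cases
  proof (elim disjE conjE)
    assume "p = 2" "?L \<cong> integer_mod_group 4 \<times>\<times> integer_mod_group 4"
    then show ?thesis
      using n prod'[of 4 4] by blast
  next
    assume "p = 5" "?L \<cong> integer_mod_group 5 \<times>\<times> integer_mod_group 5"
    then show ?thesis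
      using n prod'[of 5 5] by blast
  next
    assume "p = 3" "?L \<cong> integer_mod_group 3 \<times>\<times> integer_mod_group 9"
    then show ?thesis
      using n prod'[of 3 9] by blast
  next
    assume "p = 3" "?L \<cong> R3"
    then show ?thesis
      using n R by blast
  next
    assume "p = 2" "?L \<cong> integer_mod_group 2 \<times>\<times> integer_mod_group 16"
    then show ?thesis
      using n prod'[of 2 16] by blast
  next
    assume "p = 2" "?L \<cong> T5"
    then show ?thesis
      using n T by blast
  qed
  then show ?thesis
    using p P n iso by blast
qed

end
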